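(* Let $\mu\in\mathcal P(\mathbb R^d)$. Suppose $f$ satisfies conditions (a), (b), (c) below with constants $L,M$. Let $T>0$ and $h\ge 0$ satisfy $L(T^2+Th)\le \frac1{12}$. Suppose $\tilde\nu_h$ is a stationary distribution of the uHMC-v kernel $\tilde{\mathrm P}_{T,h}$ and there exist constants $c_1\ge 1$, $c_2>0$ such that for every integer $k\ge 1$ and every probability distribution $\rho$ on $\mathbb R^d$, $W_2(\rho\tilde{\mathrm P}_{T,h}^k,\tilde\nu_h)\le c_1e^{-c_2k}W_2(\rho,\tilde\nu_h)$. Then for every integer $k\ge 0$, \[ \mathsf{KL}(\mu\tilde{\mathrm P}_{T,h}^{k+1}\,\|\,\tilde\nu_h)\le c_1^2e^{-2c_2k}\Big(\frac{9}{4T^2}+20dM^2T^4\Big)W_2^2(\mu,\tilde\nu_h). \]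
   Context: Let $f:\mathbb R^d\to\mathbb R$. Conditions: (a) $f$ has its global minimum at $0$ and $f(0)=0$; (b) $f\in C^2$ and $\|\nabla^2f(x)\|_{op}\le L$ for all $x$; (c) $f\in C^3$ and $\|\nabla^3 f(x)\|_{op}\le M$ for all $x$. Here for a symmetric $k$-linear form $A$, $\|A\|_{op}=\sup\{|A(u_1,\dots,u_k)|:\|u_1\|=\dots=\|u_k\|=1\}$. For $T>0$ and $h>0$ with $T/h\in\mathbb N$ (always assumed when $h>0$), the velocity Verlet position map $\tilde q_{T,h}(x,v)$ is $x_N$, $N=T/h$, where $x_0=x$, $v_0=v$, $x_{j+1}=x_j+hv_j-\frac{h^2}{2}\nabla f(x_j)$, $v_{j+1}=v_j-\frac h2(\nabla f(x_j)+\nabla f(x_{j+1}))$. For $h=0$, $\tilde q_{T,0}(x,v)=q_T(x,v)$, the position at time $T$ of the solution of $\dot x_t=v_t$, $\dot v_t=-\nabla f(x_t)$ with $(x_0,v_0)=(x,v)$. The uHMC-v kernel $\tilde{\mathrm P}_{T,h}$ maps a probability distribution $\rho$ to $\rho\tilde{\mathrm P}_{T,h}$, the law of $\tilde q_{T,h}(X,\xi)$ with $X\sim\rho$, $\xi\sim\mathcal N(0,I_d)$ independent; $\tilde{\mathrm P}_{T,h}^k$ is its $k$-fold iterate. $W_2$ is the Wasserstein-2 distance, and $\mathsf{KL}(\mu\|\pi)=\mathbb E_\mu[\log\frac{d\mu}{d\pi}]$ if $\mu\ll\pi$ and $+\infty$ otherwise. *)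

theory Defs
  imports "HOL-Probability.Probability"
begin

text \<open>Space R^d is modelled by a euclidean_space type 'a, with d = DIM('a).
  Probability distributions on R^d: measures M with prob_space M and sets M = sets borel.\<close>

definition is_prob_dist :: "'a::euclidean_space measure \<Rightarrow> bool" where
  "is_prob_dist M \<longleftrightarrow> prob_space M \<and> sets M = sets (borel :: 'a measure)"

definition std_gauss :: "'a::euclidean_space measure" where
  "std_gauss = density lborel
     (\<lambda>v. ennreal ((2 * pi) powr (- real DIM('a) / 2) * exp (- (norm v)\<^sup>2 / 2)))"

definition ham_flow_pos :: "('a::euclidean_space \<Rightarrow> 'a) \<Rightarrow> real \<Rightarrow> 'a \<Rightarrow> 'a \<Rightarrow> 'a" where
  "ham_flow_pos gradf T x v =
     fst ((THE y. y 0 = (x, v) \<and>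
            (\<forall>t. (y has_vector_derivative (snd (y t), - gradf (fst (y t)))) (at t))) T)"

definition verlet_step :: "('a::euclidean_space \<Rightarrow> 'a) \<Rightarrow> real \<Rightarrow> 'a \<times> 'a \<Rightarrow> 'a \<times> 'a" where
  "verlet_step gradf h = (\<lambda>(x, v).
     let x' = x + h *\<^sub>R v - (h\<^sup>2 / 2) *\<^sub>R gradf x
     in (x', v - (h / 2) *\<^sub>R (gradf x + gradf x')))"

definition qtilde :: "('a::euclidean_space \<Rightarrow> 'a) \<Rightarrow> real \<Rightarrow> real \<Rightarrow> 'a \<Rightarrow> 'a \<Rightarrow> 'a" where
  "qtilde gradf T h x v =
     (if h = 0 then ham_flow_pos gradf T x v
      else fst ((verlet_step gradf h ^^ nat \<lfloor>T / h\<rfloor>) (x, v)))"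

definition uhmc :: "('a::euclidean_space \<Rightarrow> 'a) \<Rightarrow> real \<Rightarrow> real \<Rightarrow> 'a measure \<Rightarrow> 'a measure" where
  "uhmc gradf T h \<rho> = distr (\<rho> \<Otimes>\<^sub>M std_gauss) borel (\<lambda>(x, v). qtilde gradf T h x v)"

definition couplings :: "'a::euclidean_space measure \<Rightarrow> 'a measure \<Rightarrow> ('a \<times> 'a) measure set" where
  "couplings \<mu> \<nu> = {\<gamma>. prob_space \<gamma> \<and> sets \<gamma> = sets (borel \<Otimes>\<^sub>M borel :: ('a \<times> 'a) measure) \<and>
       distr \<gamma> borel fst = \<mu> \<and> distr \<gamma> borel snd = \<nu>}"

definition W2sq :: "'a::euclidean_space measure \<Rightarrow> 'a measure \<Rightarrow> ennreal" where
  "W2sq \<mu> \<nu> = (INF \<gamma>\<in>couplings \<mu> \<nu>. \<integral>\<^sup>+ z. ennreal ((norm (fst z - snd z))\<^sup>2) \<partial>\<gamma>)"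

definition W2 :: "'a::euclidean_space measure \<Rightarrow> 'a measure \<Rightarrow> ennreal" where
  "W2 \<mu> \<nu> = (if W2sq \<mu> \<nu> = \<infinity> then \<infinity> else ennreal (sqrt (enn2real (W2sq \<mu> \<nu>))))"

text \<open>KL divergence KL(mu || pi) = E_mu[log (d mu / d pi)] if mu << pi, +\<infinity> otherwise.
  The expectation is taken as (integral of positive part) - (integral of negative part) in ereal.\<close>
definition KL :: "'a measure \<Rightarrow> 'a measure \<Rightarrow> ereal" where
  "KL \<mu> \<pi> =
     (if absolutely_continuous \<pi> \<mu> then
        (let D = (\<lambda>x. enn2real (RN_deriv \<pi> \<mu> x)) in
          enn2ereal (\<integral>\<^sup>+ x. ennreal (ln (D x)) \<partial>\<mu>)
          - enn2ereal (\<integral>\<^sup>+ x. ennreal (- ln (D x)) \<partial>\<mu>))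
      else \<infinity>)"

end

theory Submission
  imports Defs
begin

text \<open>
  Couple the chains started at \<open>x\<close> and \<open>y\<close> so that they meet after one step: since \<open>L T\<^sup>2\<close> is small,
  the position map is nearly \<open>v \<mapsto> x + T v\<close>, and there is a diffeomorphism \<open>\<Phi>(v) = v + g(v)\<close> of the velocities with
  \<open>q(y, \<Phi>(v)) = q(x, v)\<close>, where \<open>|g| \<le> C |x - y| / T\<close> and \<open>|Dg| \<le> C M T\<^sup>2 |x - y|\<close>.
  The relative entropy of the law of \<open>\<Phi>(\<xi>)\<close> with respect to the law of \<open>\<xi>\<close> equals
  \<open>E[|g|\<^sup>2 / 2 + tr Dg - log det (I + Dg)]\<close> by Gaussian integration by parts, which is of order
  \<open>|g|\<^sup>2 + d |Dg|\<^sup>2\<close>. In the Donsker--Varadhan dual form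
  \<open>E \<phi>(q(x, \<xi>)) \<le> log E exp (\<phi>(q(y, \<xi>))) + K |x - y|\<^sup>2\<close> this bound passes to the limit of vanishing step size,
  can be integrated against any coupling, and gives \<open>KL(\<mu>P | \<nu>P) \<le> K W\<^sub>2(\<mu>, \<nu>)\<^sup>2\<close>. Stationarity and the contraction of
  \<open>W\<^sub>2\<close> do the rest.
\<close>

section \<open>The determinant near the identity\<close>

text \<open>The dual form suits the case h = 0: the flow is reached only as a pointwise limit of
  Verlet maps with steps T / (n + 1), and integrals of bounded continuous test functions pass to
  that limit by dominated convergence, so the flow is never differentiated in its initial data. It
  also makes measurability of \<Phi> in (x, y) irrelevant: only an inequality between two integrals
  is integrated over a coupling, and concavity of ln moves the logarithm outside. Constants: L T^2 /
  2 \<le> 1/24 lets the deviation from free motion be absorbed, with a factor 24/23, and puts the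
  velocity derivative of the position map within T / 23 of T times the identity. Hence that map
  expands distances by at least (22/23) T, which gives |g| \<le> (12/11) |x - y| / T, |Dg| \<le>
  1/11 and |Dg| \<le> (5/4) M T^2 |x - y|. The cost |g|^2 / 2 + d |Dg|^2 then has coefficients
  72/121 and 25/16, below 9/4 and 20. Of the integration by parts only one sign is used: the mean of
  tr Dg - v . g is nonnegative.\<close>

lemma det_mat1_has_derivative:
  fixes C :: "real^'n^'n"
  shows "((\<lambda>t. det (mat 1 + t *\<^sub>R C)) has_real_derivative trace C) (at 0)"
proof -
  define D where "D p = (if p = id then trace C else 0)" for p :: "'n \<Rightarrow> 'n"
  have *: "((\<lambda>t. of_int (sign p) * (\<Prod>i\<in>UNIV. (mat 1 + t *\<^sub>R C) $ i $ p i)) has_derivative (\<lambda>y. y * D p)) (at 0)"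
    if p: "p permutes UNIV" for p :: "'n \<Rightarrow> 'n"
  proof -
    have 1: "((\<lambda>t. (mat 1 + t *\<^sub>R C) $ i $ p i) has_derivative (\<lambda>y. y * C $ i $ p i)) (at 0)" for i
      by (auto intro!: derivative_eq_intros)
    have 2: "((\<lambda>t. \<Prod>i\<in>UNIV. (mat 1 + t *\<^sub>R C) $ i $ p i) has_derivative
      (\<lambda>y. \<Sum>i\<in>UNIV. y * C $ i $ p i * (\<Prod>j\<in>UNIV - {i}. (mat 1 + 0 *\<^sub>R C) $ j $ p j))) (at 0)"
      by (rule has_derivative_prod) (rule 1)
    have 3: "of_int (sign p) * (\<Sum>i\<in>UNIV. y * C $ i $ p i * (\<Prod>j\<in>UNIV - {i}. (mat 1 + 0 *\<^sub>R C) $ j $ p j)) = y * D p" for y :: real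
    proof (cases "p = id")
      case True
      have "(\<Prod>j\<in>UNIV - {i}. (mat 1 + 0 *\<^sub>R C) $ j $ p j) = 1" for i
        using True by (intro prod.neutral) (auto simp: mat_def)
      then show ?thesis using True by (simp add: D_def trace_def sum_distrib_left)
    next
      case False
      have "(\<Prod>j\<in>UNIV - {i}. (mat 1 + 0 *\<^sub>R C) $ j $ p j) = 0" for i
      proof -
        \<comment> \<open>A permutation other than the identity moves some j and also p j, so a
          moved index remains after removing i; its factor is an off-diagonal entry of the identity
          matrix. Only the identity permutation contributes to first order.\<close>
        have "\<exists>j. j \<noteq> i \<and> p j \<noteq> j"
        proof -
          obtain j where j: "p j \<noteq> j" using False by (auto simp: fun_eq_iff)
          moreover have "p (p j) \<noteq> p j" using j permutes_inj[OF p] by (auto dest: injD)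
          ultimately show ?thesis by metis
        qed
        then obtain j where "j \<noteq> i" "p j \<noteq> j" by blast
        then show ?thesis by (intro prod_zero) (auto simp: mat_def intro!: bexI[of _ j])
      qed
      then show ?thesis using False by (simp only: D_def if_False mult_zero_right sum.neutral_const)
    qed
    show ?thesis
      using has_derivative_mult_right[OF 2, of "of_int (sign p)"] unfolding 3 .
  qed
  have "((\<lambda>t. \<Sum>p | p permutes UNIV. of_int (sign p) * (\<Prod>i\<in>UNIV. (mat 1 + t *\<^sub>R C) $ i $ p i))
     has_derivative (\<lambda>y. \<Sum>p | p permutes (UNIV::'n set). y * D p)) (at 0)"
    by (rule has_derivative_sum) (use * in auto)
  moreover have "(\<Sum>p | p permutes (UNIV::'n set). y * D p) = y * trace C" for y
  proof -
    have "(\<Sum>p | p permutes (UNIV::'n set). y * D p) = y * (\<Sum>p | p permutes (UNIV::'n set). if p = id then trace C else 0)"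
      unfolding D_def sum_distrib_left ..
    also have "\<dots> = y * trace C"
      using finite_permutations[of "UNIV :: 'n set"] permutes_id[of "UNIV :: 'n set"]
      by (subst sum.delta) auto
    finally show ?thesis .
  qed
  moreover have "(*) (trace C) = (\<lambda>y. y * trace C)" by (simp add: fun_eq_iff mult.commute)
  ultimately show ?thesis
    unfolding has_field_derivative_def det_def by simp
qed

definition tr :: "('a::euclidean_space \<Rightarrow> 'a) \<Rightarrow> real" where
  "tr B = (\<Sum>b\<in>Basis. B b \<bullet> b)"

lemma abs_tr_le:
  fixes B :: "'a::euclidean_space \<Rightarrow> 'a"
  assumes "\<And>u. norm (B u) \<le> a * norm u"
  shows "\<bar>tr B\<bar> \<le> real DIM('a) * a"
proof -
  have "\<bar>B b \<bullet> b\<bar> \<le> a" if "b \<in> Basis" for b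
    using Cauchy_Schwarz_ineq2[of "B b" b] assms[of b] that by simp
  then have "(\<Sum>b\<in>(Basis::'a set). \<bar>B b \<bullet> b\<bar>) \<le> (\<Sum>b\<in>(Basis::'a set). a)"
    by (intro sum_mono)
  then show ?thesis
    unfolding tr_def by (intro order_trans[OF sum_abs]) simp
qed

lemma trace_matrix_eq_tr:
  fixes B :: "real^'n \<Rightarrow> real^'n"
  shows "trace (matrix B) = tr B"
proof -
  have "inj (\<lambda>i::'n. axis i (1::real))" by (auto simp: inj_on_def axis_eq_axis)
  moreover have "(Basis :: (real^'n) set) = range (\<lambda>i. axis i 1)"
    by (auto simp: Basis_vec_def)
  ultimately show ?thesis
    unfolding tr_def by (subst \<open>Basis = _\<close>, subst sum.reindex) (auto simp: trace_def matrix_def inner_axis)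
qed

text \<open>Jacobi's formula along det (I + s B): with R the inverse of I + s B, the logarithmic
  derivative is tr (R B) = tr B - s tr (R B B), and |R| \<le> 2 because |s B| \<le> 1/2. It is
  therefore at least tr B - 2 s d a^2, and integrating over [0, 1] gives the exponent. The term tr B
  is kept exactly because integration by parts compensates it later; only the second-order part is
  estimated.\<close>

lemma det_id_plus_ge:
  fixes B :: "real^'n \<Rightarrow> real^'n"
  assumes lin: "linear B" and bd: "\<And>u. norm (B u) \<le> a * norm u" and a: "a \<le> 1/2"
  shows "exp (tr B - real CARD('n) * a\<^sup>2) \<le> \<bar>det (matrix (\<lambda>u. u + B u))\<bar>"
proof -
  obtain e :: "real^'n" where "e \<in> Basis" using nonempty_Basis by blast
  then have a0: "0 \<le> a" using order_trans[OF norm_ge_zero bd[of e]] by simp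
  define d where "d = real CARD('n)"
  define m where "m s = det (matrix (\<lambda>u. u + s *\<^sub>R B u))" for s
  \<comment> \<open>squared, because the sign of the determinant \<open>m s\<close> is not known in advance\<close>
  define k where "k s = (m s * exp (- s * tr B + s\<^sup>2 * d * a\<^sup>2))\<^sup>2" for s
  have dm: "\<exists>t. (m has_real_derivative m s * t) (at s) \<and> t \<ge> tr B - 2 * s * d * a\<^sup>2" if s: "0 \<le> s" "s \<le> 1" for s
  proof -
    let ?A = "\<lambda>u. u + s *\<^sub>R B u"
    have linA: "linear ?A"
      using lin by (auto simp: linear_iff algebra_simps)
    have low: "norm u \<le> 2 * norm (?A u)" for u
    proof -
      have "norm (s *\<^sub>R B u) \<le> 1 * (a * norm u)"
        using s bd[of u] mult_mono[of s 1 "norm (B u)" "a * norm u"] by simp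
      also have "\<dots> \<le> 1/2 * norm u" using mult_right_mono[OF a norm_ge_zero[of u]] by simp
      finally show ?thesis using norm_diff_ineq[of u "s *\<^sub>R B u"] by simp
    qed
    have "inj ?A"
      unfolding linear_injective_0[OF linA] using low by (metis mult_zero_right norm_eq_zero norm_le_zero_iff)
    then obtain R where R: "linear R" "\<And>x. R (?A x) = x" "\<And>x. ?A (R x) = x"
      using linear_injective_isomorphism[OF linA] by blast
    have Rn: "norm (R u) \<le> 2 * norm u" for u using low[of "R u"] R(3) by simp
    \<comment> \<open>Resolvent identity; taken at w = B b it splits tr (R B) into tr B and a term
      quadratic in B.\<close>
    have Req: "R w = w - s *\<^sub>R R (B w)" for w
      using R(2)[of w] by (simp add: linear_add[OF R(1)] linear_scale[OF R(1)] algebra_simps)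
    define C where "C = R \<circ> B"
    have linC: "linear C" unfolding C_def using lin R(1) by (rule linear_compose)
    \<comment> \<open>The factorisation I + (s + t) B = (I + s B) (I + t C) with C = R B reduces the
      derivative at s to the derivative at the identity.\<close>
    have meq: "m (s + t) = m s * det (mat 1 + t *\<^sub>R matrix C)" for t
    proof -
      have l2: "linear (\<lambda>u. u + t *\<^sub>R C u)"
        using linC by (auto simp: linear_iff algebra_simps)
      have "?A (u + t *\<^sub>R C u) = u + (s + t) *\<^sub>R B u" for u
      proof -
        have "?A (u + t *\<^sub>R C u) = ?A u + t *\<^sub>R ?A (C u)"
          using linear_add[OF linA] linear_scale[OF linA] by presburger
        also have "?A (C u) = B u" using R(3)[of "B u"] by (simp add: C_def)
        finally show ?thesis by (simp add: algebra_simps)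
      qed
      then have "(\<lambda>u. u + (s + t) *\<^sub>R B u) = ?A \<circ> (\<lambda>u. u + t *\<^sub>R C u)" by (simp add: fun_eq_iff)
      then have "m (s + t) = m s * det (matrix (\<lambda>u. u + t *\<^sub>R C u))"
        unfolding m_def by (simp only: matrix_compose[OF l2 linA] det_mul)
      also have "matrix (\<lambda>u. u + t *\<^sub>R C u) = mat 1 + t *\<^sub>R matrix C"
        by (auto simp: matrix_def mat_def vec_eq_iff axis_def)
      finally show ?thesis .
    qed
    have "((\<lambda>t. m s * det (mat 1 + t *\<^sub>R matrix C)) has_real_derivative m s * trace (matrix C)) (at 0)"
      by (rule DERIV_cmult) (rule det_mat1_has_derivative)
    then have "((\<lambda>t. m (s + t)) has_real_derivative m s * tr C) (at 0)"
      by (simp add: meq[symmetric] trace_matrix_eq_tr)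
    then have "(m has_real_derivative m s * tr C) (at s)"
      using DERIV_shift[of m "m s * tr C" 0 s] by (simp add: add.commute)
    moreover have "tr C \<ge> tr B - 2 * s * d * a\<^sup>2"
    proof -
      have "norm (R (B (B u))) \<le> 2 * a\<^sup>2 * norm u" for u
        using Rn[of "B (B u)"] bd[of "B u"] mult_left_mono[OF bd[of u] a0]
        by (simp add: power2_eq_square)
      from abs_tr_le[OF this] have "\<bar>tr (\<lambda>u. R (B (B u)))\<bar> \<le> d * (2 * a\<^sup>2)"
        by (simp add: d_def)
      then have "s * tr (\<lambda>u. R (B (B u))) \<le> s * (d * (2 * a\<^sup>2))"
        using s by (intro mult_left_mono) auto
      moreover have "tr C = tr B - s * tr (\<lambda>u. R (B (B u)))"
        unfolding C_def tr_def comp_def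
        by (subst Req) (simp add: inner_diff_left sum_subtractf sum_distrib_left)
      ultimately show ?thesis by (simp add: algebra_simps)
    qed
    ultimately show ?thesis by blast
  qed
  have "k 0 \<le> k 1"
  proof (rule DERIV_nonneg_imp_nondecreasing[where f = k])
    fix s :: real assume s: "0 \<le> s" "s \<le> 1"
    obtain t where t: "(m has_real_derivative m s * t) (at s)" "t \<ge> tr B - 2 * s * d * a\<^sup>2"
      using dm[OF s] by blast
    have "(k has_real_derivative 2 * k s * (t - tr B + 2 * s * d * a\<^sup>2)) (at s)"
      unfolding k_def
      by (rule derivative_eq_intros t refl | simp)+ (simp add: power2_eq_square algebra_simps)
    moreover have "2 * k s * (t - tr B + 2 * s * d * a\<^sup>2) \<ge> 0" using t(2) by (simp add: k_def)
    ultimately show "\<exists>y. (k has_real_derivative y) (at s) \<and> 0 \<le> y" by blast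
  qed simp
  moreover have "k 0 = 1"
    by (simp add: k_def m_def matrix_id_mat_1[unfolded id_def])
  ultimately have "1 \<le> \<bar>m 1 * exp (- tr B + d * a\<^sup>2)\<bar>"
    by (simp add: k_def abs_le_square_iff[of 1, simplified])
  then have "1 \<le> \<bar>m 1\<bar> * exp (- (tr B - d * a\<^sup>2))" by (simp add: abs_mult)
  then show ?thesis
    unfolding m_def d_def exp_minus by (simp add: field_simps)
qed

text \<open>
  The change of variables theorem is only available on \<open>real^'n\<close> with a well-ordered index type;
  the following type of indices transports it to an arbitrary Euclidean space.
\<close>

typedef (overloaded) ('a::euclidean_space) basis_index = "Basis :: 'a set"
  using nonempty_Basis by blast

lemma inj_Rep_basis_index: "inj Rep_basis_index"
  by (simp add: inj_on_def Rep_basis_index_inject)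

lemma range_Rep_basis_index: "range (Rep_basis_index :: 'a::euclidean_space basis_index \<Rightarrow> 'a) = Basis"
  using type_definition.Rep_range[OF type_definition_basis_index] .

instance basis_index :: (euclidean_space) finite
proof
  show "finite (UNIV :: 'a basis_index set)"
    using finite_imageD[OF _ inj_Rep_basis_index] by (simp add: range_Rep_basis_index)
qed

instantiation basis_index :: (euclidean_space) wellorder
begin

text \<open>The order is pulled back from an enumeration of the finite type; it carries no geometric
  meaning.\<close>

definition less_eq_basis_index :: "'a basis_index \<Rightarrow> 'a basis_index \<Rightarrow> bool" where
  "less_eq_basis_index i j \<longleftrightarrow> to_nat_on UNIV i \<le> to_nat_on UNIV j"

definition less_basis_index :: "'a basis_index \<Rightarrow> 'a basis_index \<Rightarrow> bool" where
  "less_basis_index i j \<longleftrightarrow> to_nat_on UNIV i < to_nat_on UNIV j"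

instance
proof
  have inj: "inj (to_nat_on (UNIV :: 'a basis_index set))"
    by (intro inj_on_to_nat_on countable_finite finite)
  show "i = j" if "i \<le> j" "j \<le> i" for i j :: "'a basis_index"
    using that injD[OF inj, of i j] by (simp add: less_eq_basis_index_def)
  show "P i" if "\<And>i. (\<And>j. j < i \<Longrightarrow> P j) \<Longrightarrow> P i" for P and i :: "'a basis_index"
  proof (induction "to_nat_on UNIV i" arbitrary: i rule: less_induct)
    case less
    show ?case
      by (rule that) (rule less, simp add: less_basis_index_def)
  qed
qed (auto simp: less_eq_basis_index_def less_basis_index_def)

end

section \<open>The standard Gaussian measure\<close>

definition gauss_density :: "'a::euclidean_space \<Rightarrow> real" where
  "gauss_density v = (2 * pi) powr (- real DIM('a) / 2) * exp (- (norm v)\<^sup>2 / 2)"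

lemma gauss_density_nonneg [simp]: "0 \<le> gauss_density v"
  by (simp add: gauss_density_def)

lemma gauss_density_measurable [measurable]: "gauss_density \<in> borel_measurable borel"
  unfolding gauss_density_def by measurable

lemma gauss_density_eq_prod:
  "gauss_density (v :: 'a::euclidean_space) = (\<Prod>b\<in>Basis. std_normal_density (v \<bullet> b))"
proof -
  have "(\<Prod>b\<in>(Basis::'a set). 1 / sqrt (2 * pi)) = (2 * pi) powr (- real DIM('a) / 2)"
    by (simp add: powr_half_sqrt[symmetric] powr_minus_divide[symmetric] powr_power)
  moreover have "(\<Prod>b\<in>(Basis::'a set). exp (- (v \<bullet> b)\<^sup>2 / 2)) = exp (- (norm v)\<^sup>2 / 2)"
    by (simp add: exp_sum[symmetric] sum_negf sum_divide_distrib[symmetric] power2_norm_eq_inner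
        euclidean_inner[of v v]) (simp add: power2_eq_square)
  ultimately show ?thesis
    unfolding gauss_density_def std_normal_density_def prod.distrib by (simp only:)
qed

lemma std_gauss_eq: "std_gauss = density lborel (\<lambda>v. ennreal (gauss_density v))"
  by (simp add: std_gauss_def gauss_density_def)

lemma sets_std_gauss [simp, measurable_cong]: "sets std_gauss = sets borel"
  by (simp add: std_gauss_def)

lemma space_std_gauss [simp]: "space std_gauss = UNIV"
  by (simp add: std_gauss_def)

lemma nn_integral_std_gauss_prod:
  fixes g :: "'a::euclidean_space \<Rightarrow> real \<Rightarrow> real"
  assumes [measurable]: "\<And>b. b \<in> Basis \<Longrightarrow> g b \<in> borel_measurable borel"
    and nn: "\<And>b x. b \<in> Basis \<Longrightarrow> 0 \<le> g b x"
  shows "(\<integral>\<^sup>+v. ennreal (\<Prod>b\<in>Basis. g b (v \<bullet> b)) \<partial>std_gauss)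
    = (\<Prod>b\<in>Basis. \<integral>\<^sup>+x. ennreal (std_normal_density x * g b x) \<partial>lborel)"
proof -
  have "(\<integral>\<^sup>+v. ennreal (\<Prod>b\<in>Basis. g b (v \<bullet> b)) \<partial>std_gauss)
    = (\<integral>\<^sup>+v. (\<Prod>b\<in>Basis. ennreal (std_normal_density (v \<bullet> b) * g b (v \<bullet> b))) \<partial>lborel)"
    unfolding std_gauss_eq
    by (subst nn_integral_density)
      (auto simp: gauss_density_eq_prod ennreal_mult'[symmetric] prod_ennreal nn prod_nonneg prod.distrib
        intro!: nn_integral_cong)
  also have "\<dots> = (\<Prod>b\<in>Basis. \<integral>\<^sup>+x. ennreal (std_normal_density x * g b x) \<partial>lborel)"
    by (subst nn_integral_lborel_prod[where f = "\<lambda>b x. ennreal (std_normal_density x * g b x)"]) auto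
  finally show ?thesis .
qed

lemma prob_space_std_gauss: "prob_space (std_gauss :: 'a::euclidean_space measure)"
proof
  have "emeasure std_gauss (space (std_gauss :: 'a measure)) = (\<integral>\<^sup>+(v::'a). ennreal (\<Prod>b\<in>(Basis::'a set). 1) \<partial>std_gauss)"
    by (simp only: prod.neutral_const ennreal_1 nn_integral_const mult_1)
  also have "\<dots> = 1"
    by (subst nn_integral_std_gauss_prod) (auto simp: nn_integral_eq_integral)
  finally show "emeasure std_gauss (space (std_gauss :: 'a measure)) = 1" .
qed

text \<open>This first moment makes \<open>v \<bullet> g v\<close> integrable for bounded
  \<open>g\<close>. The norm is at most the sum of the absolute coordinates, and each coordinate
  integral factorises into one-dimensional ones.\<close>

lemma integrable_std_gauss_norm: "integrable std_gauss (\<lambda>v :: 'a::euclidean_space. norm v)"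
proof -
  have 1: "integrable std_gauss (\<lambda>v :: 'a. \<bar>v \<bullet> b\<bar>)" if b: "b \<in> Basis" for b
  proof (rule integrableI_nonneg)
    define g where "g b' = (if b' = b then \<lambda>x. \<bar>x\<bar> else (\<lambda>x::real. 1))" for b'
    have "(\<integral>\<^sup>+v. ennreal \<bar>v \<bullet> b\<bar> \<partial>std_gauss) = (\<integral>\<^sup>+v. ennreal (\<Prod>b'\<in>Basis. g b' (v \<bullet> b')) \<partial>std_gauss)"
    proof (intro nn_integral_cong)
      fix v :: 'a
      have "(\<Prod>b'\<in>Basis. g b' (v \<bullet> b')) = (\<Prod>b'\<in>Basis. if b' = b then \<bar>v \<bullet> b\<bar> else 1)"
        by (intro prod.cong) (auto simp: g_def)
      then show "ennreal \<bar>v \<bullet> b\<bar> = ennreal (\<Prod>b'\<in>Basis. g b' (v \<bullet> b'))"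
        using b by (simp add: prod.delta)
    qed
    also have "\<dots> = (\<Prod>b'\<in>Basis. \<integral>\<^sup>+x. ennreal (std_normal_density x * g b' x) \<partial>lborel)"
      by (rule nn_integral_std_gauss_prod) (auto simp: g_def)
    also have "\<dots> < \<infinity>"
    proof -
      have "(\<integral>\<^sup>+x. ennreal (std_normal_density x * g b' x) \<partial>lborel) < \<infinity>" for b'
        using integrable_std_normal_moment_abs[of 1] integrable_normal_density[of 1 0]
        by (auto simp: g_def nn_integral_eq_integral)
      then show ?thesis
        unfolding less_top[symmetric] infinity_ennreal_def ennreal_prod_eq_top by (auto simp: less_top)
    qed
    finally show "(\<integral>\<^sup>+v. ennreal \<bar>v \<bullet> b\<bar> \<partial>std_gauss) < \<infinity>" .
  qed auto
  have "integrable std_gauss (\<lambda>v :: 'a. \<Sum>b\<in>Basis. \<bar>v \<bullet> b\<bar>)"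
    using 1 by auto
  then show ?thesis
    by (rule Bochner_Integration.integrable_bound) (auto intro!: AE_I2 order_trans[OF norm_le_l1])
qed

interpretation std_gauss: prob_space "std_gauss :: 'a::euclidean_space measure"
  by (rule prob_space_std_gauss)

lemma measure_std_gauss_UNIV [simp]: "measure (std_gauss :: 'a::euclidean_space measure) UNIV = 1"
  using std_gauss.prob_space by simp

lemma integrable_std_gauss_bounded:
  fixes \<phi> :: "'a::euclidean_space \<Rightarrow> real"
  assumes "\<phi> \<in> borel_measurable borel" "\<And>x. \<bar>\<phi> x\<bar> \<le> b"
  shows "integrable std_gauss \<phi>"
  by (rule std_gauss.integrable_const_bound[where B = b]) (use assms in auto)

section \<open>Entropy cost of a small perturbation of the Gaussian\<close>

lemma (in prob_space) exp_expectation_le: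
  fixes X :: "'a \<Rightarrow> real"
  assumes "integrable M X" "integrable M (\<lambda>x. exp (X x))"
  shows "exp (expectation X) \<le> expectation (\<lambda>x. exp (X x))"
proof -
  \<comment> \<open>The integrand on the right is the tangent line of exp at the mean, evaluated at
    X.\<close>
  have "exp (expectation X) = expectation (\<lambda>x. exp (expectation X) * (1 + (X x - expectation X)))"
    using assms(1) by (simp add: prob_space)
  also have "\<dots> \<le> expectation (\<lambda>x. exp (X x))"
  proof (rule integral_mono)
    show "exp (expectation X) * (1 + (X x - expectation X)) \<le> exp (X x)" for x
      using mult_left_mono[OF exp_ge_add_one_self[of "X x - expectation X"], of "exp (expectation X)"]
      by (simp add: exp_add[symmetric])
  qed (use assms in auto)
  finally show ?thesis .
qed

text \<open>Real values are embedded in \<open>real^1\<close> to apply the change of variables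
  theorem for vector-valued functions.\<close>

lemma change_of_variables_real:
  fixes \<psi> :: "real^'n::{finite,wellorder} \<Rightarrow> real" and G :: "real^'n::{finite,wellorder} \<Rightarrow> real^'n::{finite,wellorder}"
  assumes der: "\<And>x. (G has_derivative G' x) (at x)" and bij: "bij G"
    and \<psi>: "\<psi> absolutely_integrable_on UNIV"
  shows "(\<lambda>x. \<bar>det (matrix (G' x))\<bar> * \<psi> (G x)) absolutely_integrable_on UNIV"
    and "integral UNIV (\<lambda>x. \<bar>det (matrix (G' x))\<bar> * \<psi> (G x)) = integral UNIV \<psi>"
proof -
  have "(\<lambda>x. \<bar>det (matrix (G' x))\<bar> *\<^sub>R vec (\<psi> (G x)) :: real^1) absolutely_integrable_on UNIV \<and>
      integral UNIV (\<lambda>x. \<bar>det (matrix (G' x))\<bar> *\<^sub>R vec (\<psi> (G x)) :: real^1) = vec (integral UNIV \<psi>)"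
    using has_absolute_integral_change_of_variables[of UNIV G G' "\<lambda>x. vec (\<psi> x) :: real^1" "vec (integral UNIV \<psi>)"]
      der bij \<psi> by (simp add: bij_def absolutely_integrable_on_1_iff integral_on_1_eq)
  then show "(\<lambda>x. \<bar>det (matrix (G' x))\<bar> * \<psi> (G x)) absolutely_integrable_on UNIV"
    and "integral UNIV (\<lambda>x. \<bar>det (matrix (G' x))\<bar> * \<psi> (G x)) = integral UNIV \<psi>"
    by (simp_all add: absolutely_integrable_on_1_iff integral_on_1_eq)
qed

lemma lipschitz_of_derivative_bound:
  fixes g :: "'a::euclidean_space \<Rightarrow> 'b::euclidean_space"
  assumes "\<And>v. (g has_derivative Dg v) (at v)" and "\<And>v u. norm (Dg v u) \<le> a * norm u"
  shows "norm (g u - g v) \<le> a * norm (u - v)"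
proof (rule differentiable_bound[of UNIV])
  show "onorm (Dg x) \<le> a" for x
    using assms(2) by (rule onorm_le)
qed (use assms in \<open>auto\<close>)

text \<open>Solving v + g v = z means finding a fixed point of the contraction v \<mapsto> z - g
  v.\<close>

lemma bij_id_plus_contraction:
  fixes g :: "'a::euclidean_space \<Rightarrow> 'a"
  assumes lip: "\<And>u v. norm (g u - g v) \<le> a * norm (u - v)" and a: "0 \<le> a" "a < 1"
  shows "bij (\<lambda>v. v + g v)"
proof (rule bijI)
  show "inj (\<lambda>v. v + g v)"
  proof (rule injI)
    fix u v assume "u + g u = v + g v"
    then have "u - v = (v + g v) - g u - v" by (metis add_diff_cancel_right')
    then have "norm (u - v) = norm (g u - g v)" by (simp add: norm_minus_commute)
    then have "norm (u - v) \<le> a * norm (u - v)" using lip[of u v] by simp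
    then have "(1 - a) * norm (u - v) \<le> 0" by (simp add: algebra_simps)
    then show "u = v" using a by (simp add: mult_le_0_iff)
  qed
  have "\<exists>v. z = v + g v" for z
  proof -
    have "\<exists>!v. z - g v = v"
      by (rule banach_fix_type[OF a]) (use lip in \<open>auto simp: dist_norm norm_minus_commute\<close>)
    then show ?thesis by (metis diff_add_cancel)
  qed
  then show "surj (\<lambda>v. v + g v)" unfolding surj_def by blast
qed

text \<open>\<open>Dg\<close> is only a pointwise derivative, with no continuity assumed; each
  \<open>Dg v b\<close> is the limit of the measurable difference quotients with increments 1 / (n +
  1).\<close>

lemma borel_measurable_tr_derivative:
  fixes g :: "'a::euclidean_space \<Rightarrow> 'a"
  assumes der: "\<And>v. (g has_derivative Dg v) (at v)"
  shows "(\<lambda>v. tr (Dg v)) \<in> borel_measurable borel"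
proof -
  have cont: "continuous_on UNIV g"
    using der by (intro continuous_at_imp_continuous_on ballI) (rule has_derivative_continuous)
  have [measurable]: "g \<in> borel_measurable borel"
    by (rule borel_measurable_continuous_onI[OF cont])
  have "(\<lambda>v. Dg v b) \<in> borel_measurable borel" for b
  proof (rule borel_measurable_LIMSEQ_metric)
    fix v
    have "((\<lambda>t. g (v + t *\<^sub>R b)) has_vector_derivative Dg v b) (at 0)"
    proof -
      have line: "((\<lambda>t. v + t *\<^sub>R b) has_derivative (\<lambda>t. t *\<^sub>R b)) (at 0)"
        by (auto intro!: derivative_eq_intros)
      have "(g has_derivative Dg v) (at (v + 0 *\<^sub>R b))" using der[of v] by simp
      from has_derivative_compose[OF line this]
      show ?thesis
        unfolding has_vector_derivative_def linear_scale[OF has_derivative_linear[OF der]] .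
    qed
    then have lim: "((\<lambda>t. norm (g (v + t *\<^sub>R b) - g (v + 0 *\<^sub>R b) - (t - 0) *\<^sub>R Dg v b) / norm (t - 0)) \<longlongrightarrow> 0) (at 0)"
      unfolding has_vector_derivative_def has_derivative_iff_norm by (rule conjunct2)
    have "((\<lambda>t. (g (v + t *\<^sub>R b) - g v) /\<^sub>R t) \<longlongrightarrow> Dg v b) (at 0)"
    proof (rule Lim_null[THEN iffD2], rule tendsto_norm_zero_cancel)
      show "((\<lambda>t. norm ((g (v + t *\<^sub>R b) - g v) /\<^sub>R t - Dg v b)) \<longlongrightarrow> 0) (at 0)"
        using lim
      proof (rule Lim_transform_eventually)
        have eq: "norm (g (v + t *\<^sub>R b) - g v - t *\<^sub>R Dg v b) / \<bar>t\<bar> = norm ((g (v + t *\<^sub>R b) - g v) /\<^sub>R t - Dg v b)"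
          if "t \<noteq> 0" for t
        proof -
          have "(g (v + t *\<^sub>R b) - g v) /\<^sub>R t - Dg v b = (g (v + t *\<^sub>R b) - g v - t *\<^sub>R Dg v b) /\<^sub>R t"
            using that by (simp add: scaleR_diff_right)
          then show ?thesis by (simp add: divide_inverse mult.commute)
        qed
        show "\<forall>\<^sub>F t in at 0. norm (g (v + t *\<^sub>R b) - g (v + 0 *\<^sub>R b) - (t - 0) *\<^sub>R Dg v b) / norm (t - 0)
            = norm ((g (v + t *\<^sub>R b) - g v) /\<^sub>R t - Dg v b)"
          unfolding eventually_at_filter by (rule always_eventually) (simp add: eq)
      qed
    qed
    moreover have "filterlim (\<lambda>n. 1 / real (Suc n)) (at 0) sequentially"
      unfolding filterlim_at by (use LIMSEQ_inverse_real_of_nat in \<open>simp add: divide_inverse\<close>)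
    ultimately show "(\<lambda>n. (g (v + (1 / real (Suc n)) *\<^sub>R b) - g v) /\<^sub>R (1 / real (Suc n))) \<longlonglongrightarrow> Dg v b"
      by (rule filterlim_compose)
  qed measurable
  then show ?thesis unfolding tr_def by measurable
qed

lemma gauss_density_shift:
  "gauss_density (v + w) = gauss_density v * exp (- (v \<bullet> w) - (norm w)\<^sup>2 / 2)"
proof -
  have "(norm (v + w))\<^sup>2 = (norm v)\<^sup>2 + 2 * (v \<bullet> w) + (norm w)\<^sup>2"
    by (simp add: power2_norm_eq_inner inner_add inner_commute)
  then have "- (norm (v + w))\<^sup>2 / 2 = - (norm v)\<^sup>2 / 2 + (- (v \<bullet> w) - (norm w)\<^sup>2 / 2)"
    by (simp add: field_simps)
  then show ?thesis
    by (simp only: gauss_density_def exp_add mult.assoc)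
qed

lemma integral_std_gauss:
  fixes \<phi> :: "'a::euclidean_space \<Rightarrow> real"
  assumes "\<phi> \<in> borel_measurable borel"
  shows "(\<integral>v. \<phi> v \<partial>std_gauss) = (\<integral>v. gauss_density v * \<phi> v \<partial>lborel)"
    and "integrable std_gauss \<phi> \<longleftrightarrow> integrable lborel (\<lambda>v. gauss_density v * \<phi> v)"
  using assms unfolding std_gauss_eq by (simp_all add: integral_density integrable_density)

text \<open>A pointwise comparison followed by Jensen. The function \<open>exp (Y v)\<close> times
  the Gaussian density lies below the pullback of \<open>E\<close> under v \<mapsto> v + g v,
  Jacobian included, so the change of variables gives E exp Y \<le> E exp \<phi>; Jensen bounds the
  mean of Y by the logarithm. No density of the law of the perturbed variable appears.\<close>

lemma std_gauss_entropy_bound: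
  fixes g :: "real^'n::{finite,wellorder} \<Rightarrow> real^'n::{finite,wellorder}" and \<phi> :: "real^'n::{finite,wellorder} \<Rightarrow> real"
  assumes der: "\<And>v. (g has_derivative Dg v) (at v)"
    and A: "\<And>v. norm (g v) \<le> A"
    and a: "\<And>v u. norm (Dg v u) \<le> a * norm u" "0 \<le> a" "a \<le> 1/2"
    and \<phi>[measurable]: "\<phi> \<in> borel_measurable borel" and bd: "\<And>x. \<bar>\<phi> x\<bar> \<le> b"
  shows "(\<integral>v. \<phi> (v + g v) \<partial>std_gauss) + (\<integral>v. tr (Dg v) - v \<bullet> g v \<partial>std_gauss)
      \<le> ln (\<integral>v. exp (\<phi> v) \<partial>std_gauss) + (A\<^sup>2 / 2 + real CARD('n) * a\<^sup>2)"
proof -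
  define K where "K = A\<^sup>2 / 2 + real CARD('n) * a\<^sup>2"
  have cont: "continuous_on UNIV g"
    using der by (intro continuous_at_imp_continuous_on ballI) (rule has_derivative_continuous)
  have [measurable]: "g \<in> borel_measurable borel"
    by (rule borel_measurable_continuous_onI[OF cont])
  have [measurable]: "(\<lambda>v. tr (Dg v)) \<in> borel_measurable borel"
    using der by (rule borel_measurable_tr_derivative)
  have bij: "bij (\<lambda>v. v + g v)"
    using lipschitz_of_derivative_bound[OF der a(1)] a by (intro bij_id_plus_contraction[of _ a]) auto
  have der': "((\<lambda>v. v + g v) has_derivative (\<lambda>u. u + Dg v u)) (at v)" for v
    by (auto intro!: derivative_eq_intros der)
  define E where "E w = gauss_density w * exp (\<phi> w)" for w
  \<comment> \<open>\<open>K\<close> pays for |g|^2 / 2 in the shifted Gaussian density and for the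
    remainder d a^2 of the determinant bound; the first-order terms are kept exactly.\<close>
  define Y where "Y v = \<phi> (v + g v) + (tr (Dg v) - v \<bullet> g v) - K" for v
  have [measurable]: "Y \<in> borel_measurable borel" unfolding Y_def by measurable
  have [measurable]: "E \<in> borel_measurable borel" unfolding E_def by measurable
  have iexp: "integrable std_gauss (\<lambda>v. exp (\<phi> v))"
  proof (rule integrable_std_gauss_bounded)
    show "\<bar>exp (\<phi> x)\<bar> \<le> exp b" for x using abs_le_D1[OF bd[of x]] by simp
  qed measurable
  have "integrable lborel E"
    unfolding E_def using iexp by (simp add: integral_std_gauss(2))
  then have "E absolutely_integrable_on UNIV"
    by (simp add: set_integrable_def integrable_completion)
  note cov = change_of_variables_real[OF der' bij this]
  have le: "gauss_density v * exp (Y v) \<le> \<bar>det (matrix (\<lambda>u. u + Dg v u))\<bar> * E (v + g v)" for v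
  proof -
    have "(norm (g v))\<^sup>2 \<le> A\<^sup>2" using A[of v] by (simp add: power_mono)
    then have "exp (Y v) \<le> exp (tr (Dg v) - real CARD('n) * a\<^sup>2) * exp (\<phi> (v + g v)) * exp (- (v \<bullet> g v) - (norm (g v))\<^sup>2 / 2)"
      by (simp add: Y_def K_def exp_add[symmetric])
    also have "\<dots> \<le> \<bar>det (matrix (\<lambda>u. u + Dg v u))\<bar> * exp (\<phi> (v + g v)) * exp (- (v \<bullet> g v) - (norm (g v))\<^sup>2 / 2)"
      by (intro mult_right_mono det_id_plus_ge a has_derivative_linear[OF der]) auto
    finally have "gauss_density v * exp (Y v) \<le> gauss_density v * (\<bar>det (matrix (\<lambda>u. u + Dg v u))\<bar> * exp (\<phi> (v + g v)) * exp (- (v \<bullet> g v) - (norm (g v))\<^sup>2 / 2))"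
      by (rule mult_left_mono) simp
    then show ?thesis
      unfolding E_def gauss_density_shift[of v] by (simp only: mult_ac)
  qed
  \<comment> \<open>The Jacobian integrand is known to be integrable only for the completed measure,
    so the comparison is made there; the dominated function is Borel, which allows the return to
    \<open>lborel\<close>.\<close>
  have iL: "integrable lebesgue (\<lambda>v. gauss_density v * exp (Y v))"
  proof (rule Bochner_Integration.integrable_bound)
    show "integrable lebesgue (\<lambda>v. \<bar>det (matrix (\<lambda>u. u + Dg v u))\<bar> * E (v + g v))"
      using cov(1) by (simp add: set_integrable_def)
    show "(\<lambda>v. gauss_density v * exp (Y v)) \<in> borel_measurable lebesgue"
      by (rule measurable_completion) measurable
    show "AE v in lebesgue. norm (gauss_density v * exp (Y v)) \<le> norm (\<bar>det (matrix (\<lambda>u. u + Dg v u))\<bar> * E (v + g v))"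
      using le by (intro AE_I2) (auto simp: E_def abs_mult)
  qed
  have iexpY: "integrable std_gauss (\<lambda>v. exp (Y v))"
    using iL by (simp add: integral_std_gauss(2) integrable_completion)
  have "(\<integral>v. exp (Y v) \<partial>std_gauss) = (\<integral>v. gauss_density v * exp (Y v) \<partial>lebesgue)"
    by (simp add: integral_std_gauss(1) integral_completion)
  also have "\<dots> \<le> (\<integral>v. \<bar>det (matrix (\<lambda>u. u + Dg v u))\<bar> * E (v + g v) \<partial>lebesgue)"
    using cov(1) by (intro integral_mono iL le) (simp add: set_integrable_def)
  also have "\<dots> = integral UNIV (\<lambda>v. \<bar>det (matrix (\<lambda>u. u + Dg v u))\<bar> * E (v + g v))"
    using set_lebesgue_integral_eq_integral(2)[OF cov(1)] by (simp add: set_lebesgue_integral_def)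
  also have "\<dots> = integral UNIV E" by (rule cov(2))
  also have "\<dots> = (\<integral>v. E v \<partial>lebesgue)"
    using set_lebesgue_integral_eq_integral(2)[OF \<open>E absolutely_integrable_on UNIV\<close>] by (simp add: set_lebesgue_integral_def)
  also have "\<dots> = (\<integral>v. exp (\<phi> v) \<partial>std_gauss)"
    by (simp add: integral_std_gauss(1) integral_completion E_def)
  finally have le1: "(\<integral>v. exp (Y v) \<partial>std_gauss) \<le> (\<integral>v. exp (\<phi> v) \<partial>std_gauss)" .
  have i\<phi>: "integrable std_gauss (\<lambda>v. \<phi> (v + g v))"
    by (rule integrable_std_gauss_bounded[of _ b]) (auto simp: bd)
  have itr: "integrable std_gauss (\<lambda>v. tr (Dg v))"
    by (rule integrable_std_gauss_bounded[of _ "real DIM(real^'n::{finite,wellorder}) * a"]) (auto intro!: abs_tr_le a simp del: DIM_cart)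
  have iip: "integrable std_gauss (\<lambda>v. v \<bullet> g v)"
  proof (rule Bochner_Integration.integrable_bound)
    show "integrable std_gauss (\<lambda>v :: real^'n::{finite,wellorder}. norm v * A)"
      by (intro integrable_mult_left integrable_std_gauss_norm)
    have "\<bar>v \<bullet> g v\<bar> \<le> norm v * A" for v
      using Cauchy_Schwarz_ineq2[of v "g v"] mult_left_mono[OF A[of v], of "norm v"] by simp
    then show "AE v in std_gauss. norm (v \<bullet> g v) \<le> norm (norm v * A)"
      by (intro AE_I2) (metis abs_ge_self order_trans real_norm_def)
  qed measurable
  have iY: "integrable std_gauss Y" unfolding Y_def using i\<phi> itr iip by auto
  have "exp (\<integral>v. Y v \<partial>std_gauss) \<le> (\<integral>v. exp (\<phi> v) \<partial>std_gauss)"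
    using std_gauss.exp_expectation_le[OF iY iexpY] le1 by simp
  then have "(\<integral>v. Y v \<partial>std_gauss) \<le> ln (\<integral>v. exp (\<phi> v) \<partial>std_gauss)"
    by (simp add: ln_ge_iff less_le_trans[OF exp_gt_zero])
  moreover have "(\<integral>v. Y v \<partial>std_gauss) = (\<integral>v. \<phi> (v + g v) \<partial>std_gauss) + (\<integral>v. tr (Dg v) - v \<bullet> g v \<partial>std_gauss) - K"
    unfolding Y_def using i\<phi> itr iip by (simp add: std_gauss.prob_space del: space_std_gauss)
  ultimately show ?thesis by (simp add: K_def)
qed

text \<open>Gaussian integration by parts is the linearisation of the previous bound along \<open>- \<epsilon> g\<close>.\<close>

lemma std_gauss_transport_cart:
  fixes g :: "real^'n::{finite,wellorder} \<Rightarrow> real^'n::{finite,wellorder}" and \<phi> :: "real^'n::{finite,wellorder} \<Rightarrow> real"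
  assumes der: "\<And>v. (g has_derivative Dg v) (at v)"
    and A: "\<And>v. norm (g v) \<le> A"
    and a: "\<And>v u. norm (Dg v u) \<le> a * norm u" "0 \<le> a" "a \<le> 1/2"
    and \<phi>: "\<phi> \<in> borel_measurable borel" and bd: "\<And>x. \<bar>\<phi> x\<bar> \<le> b"
  shows "(\<integral>v. \<phi> (v + g v) \<partial>std_gauss)
      \<le> ln (\<integral>v. exp (\<phi> v) \<partial>std_gauss) + (A\<^sup>2 / 2 + real CARD('n) * a\<^sup>2)"
proof -
  define I where "I = (\<integral>v. tr (Dg v) - v \<bullet> g v \<partial>std_gauss)"
  define K where "K = A\<^sup>2 / 2 + real CARD('n) * a\<^sup>2"
  have K0: "K \<ge> 0" by (simp add: K_def)
  have "- I \<le> \<epsilon> * K" if \<epsilon>: "0 < \<epsilon>" "\<epsilon> \<le> 1" for \<epsilon>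
  proof -
    \<comment> \<open>With \<phi> = 0 only the linear term -\<epsilon> I remains on the left,
      against a cost of order \<epsilon>^2; dividing by \<epsilon> leaves -I \<le> \<epsilon>
      K.\<close>
    have "(\<integral>v. 0 \<partial>(std_gauss :: (real^'n::{finite,wellorder}) measure)) + (\<integral>v. tr (\<lambda>u. - (\<epsilon> *\<^sub>R Dg v u)) - v \<bullet> (- (\<epsilon> *\<^sub>R g v)) \<partial>std_gauss)
      \<le> ln (\<integral>v. exp 0 \<partial>(std_gauss :: (real^'n::{finite,wellorder}) measure)) + ((\<epsilon> * A)\<^sup>2 / 2 + real CARD('n) * (\<epsilon> * a)\<^sup>2)"
    proof (rule std_gauss_entropy_bound[of "\<lambda>v. - (\<epsilon> *\<^sub>R g v)" _ "\<epsilon> * A" "\<epsilon> * a" _ 0])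
      show "((\<lambda>v. - (\<epsilon> *\<^sub>R g v)) has_derivative (\<lambda>u. - (\<epsilon> *\<^sub>R Dg v u))) (at v)" for v
        by (auto intro!: derivative_eq_intros der)
      show "\<epsilon> * a \<le> 1/2" using mult_mono[of \<epsilon> 1 a "1/2"] \<epsilon> a by simp
    qed (use \<epsilon> A a in \<open>auto intro: mult_nonneg_nonneg\<close>)
    moreover have "(\<integral>v. tr (\<lambda>u. - (\<epsilon> *\<^sub>R Dg v u)) - v \<bullet> (- (\<epsilon> *\<^sub>R g v)) \<partial>std_gauss) = - \<epsilon> * I"
      unfolding I_def integral_mult_right_zero[symmetric]
      by (intro Bochner_Integration.integral_cong) (auto simp: tr_def sum_negf sum_distrib_left algebra_simps)
    moreover have "(\<epsilon> * A)\<^sup>2 / 2 + real CARD('n) * (\<epsilon> * a)\<^sup>2 = \<epsilon> * (\<epsilon> * K)"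
      by (simp add: K_def power2_eq_square algebra_simps)
    ultimately have "\<epsilon> * (- I) \<le> \<epsilon> * (\<epsilon> * K)"
      using std_gauss.prob_space[where 'a = "real^'n::{finite,wellorder}"] by simp
    then show ?thesis using \<epsilon> by (simp only: mult_le_cancel_left_pos)
  qed
  then have "\<forall>\<^sub>F \<epsilon> in at_right 0. - I \<le> \<epsilon> * K"
    unfolding eventually_at_right_field by (intro exI[of _ 1]) auto
  then have "- I \<le> 0"
    by (intro tendsto_lowerbound[of "\<lambda>\<epsilon>. \<epsilon> * K" 0 "at_right 0"]) (auto intro!: tendsto_eq_intros)
  then show ?thesis
    using std_gauss_entropy_bound[OF der A a \<phi> bd] by (simp add: I_def)
qed

section \<open>Coordinates on a Euclidean space\<close>

definition of_coords :: "real^('a::euclidean_space basis_index) \<Rightarrow> 'a" where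
  "of_coords x = (\<Sum>i\<in>UNIV. x $ i *\<^sub>R Rep_basis_index i)"

definition to_coords :: "'a::euclidean_space \<Rightarrow> real^('a basis_index)" where
  "to_coords v = (\<chi> i. v \<bullet> Rep_basis_index i)"

lemma inner_Rep_basis_index:
  "Rep_basis_index i \<bullet> Rep_basis_index j = (if i = j then 1 else 0)"
  using Rep_basis_index[of i] Rep_basis_index[of j]
  by (auto simp: inner_Basis Rep_basis_index_inject)

lemma sum_Rep_basis_index:
  "(\<Sum>i\<in>UNIV. F (Rep_basis_index (i :: 'a::euclidean_space basis_index))) = (\<Sum>b\<in>Basis. F b)"
  unfolding range_Rep_basis_index[symmetric] by (simp add: sum.reindex[OF inj_Rep_basis_index])

lemma prod_Rep_basis_index:
  "(\<Prod>i\<in>UNIV. F (Rep_basis_index (i :: 'a::euclidean_space basis_index))) = (\<Prod>b\<in>Basis. F b)"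
  unfolding range_Rep_basis_index[symmetric] by (simp add: prod.reindex[OF inj_Rep_basis_index])

lemma of_coords_inner: "of_coords x \<bullet> Rep_basis_index i = x $ i"
  unfolding of_coords_def by (simp add: inner_sum_left inner_Rep_basis_index if_distrib cong: if_cong)

lemma to_coords_of_coords [simp]: "to_coords (of_coords x) = x"
  by (simp add: to_coords_def vec_eq_iff of_coords_inner)

lemma of_coords_to_coords [simp]: "of_coords (to_coords v) = v"
  unfolding of_coords_def to_coords_def
  using sum_Rep_basis_index[of "\<lambda>b. (v \<bullet> b) *\<^sub>R b"] by (simp add: euclidean_representation)

lemma linear_of_coords: "linear of_coords"
  by (rule linearI) (simp_all add: of_coords_def scaleR_left_distrib sum.distrib scaleR_sum_right)

lemma linear_to_coords: "linear to_coords"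
  by (rule linearI) (simp_all add: to_coords_def vec_eq_iff inner_add_left)

lemma norm_to_coords [simp]: "norm (to_coords v) = norm v"
proof -
  have "(norm (to_coords v))\<^sup>2 = (\<Sum>b\<in>Basis. (v \<bullet> b) * (v \<bullet> b))"
    unfolding power2_norm_eq_inner inner_vec_def to_coords_def
    using sum_Rep_basis_index[of "\<lambda>b. (v \<bullet> b) * (v \<bullet> b)"] by simp
  also have "\<dots> = (norm v)\<^sup>2"
    by (simp add: power2_norm_eq_inner euclidean_inner[of v v])
  finally show ?thesis by simp
qed

lemma norm_of_coords [simp]: "norm (of_coords x) = norm x"
  using norm_to_coords[of "of_coords x"] by simp

lemma CARD_basis_index: "CARD('a::euclidean_space basis_index) = DIM('a)"
  using card_image[OF inj_Rep_basis_index] range_Rep_basis_index by metis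

lemma of_coords_measurable [measurable]: "of_coords \<in> borel_measurable borel"
  by (intro borel_measurable_continuous_onI linear_continuous_on linear_conv_bounded_linear[THEN iffD1] linear_of_coords)

text \<open>Lebesgue measure is determined by the volumes of boxes, and \<open>of_coords\<close>
  matches boxes with boxes of the same side lengths.\<close>

lemma distr_lborel_of_coords:
  "distr lborel borel of_coords = (lborel :: 'a::euclidean_space measure)"
proof (rule lborel_eqI[symmetric])
  fix l u :: 'a assume le: "\<And>b. b \<in> Basis \<Longrightarrow> l \<bullet> b \<le> u \<bullet> b"
  have "of_coords -` box l u = box (to_coords l) (to_coords u)"
  proof -
    have "(of_coords x \<in> box l u) = (x \<in> box (to_coords l) (to_coords u))" for x
    proof -
      have "(of_coords x \<in> box l u) \<longleftrightarrow> (\<forall>b\<in>range Rep_basis_index. l \<bullet> b < of_coords x \<bullet> b \<and> of_coords x \<bullet> b < u \<bullet> b)"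
        by (simp add: mem_box range_Rep_basis_index)
      then show ?thesis
        by (simp add: mem_box_cart of_coords_inner to_coords_def)
    qed
    then show ?thesis by auto
  qed
  then have "emeasure (distr lborel borel of_coords) (box l u) = emeasure lborel (box (to_coords l) (to_coords u))"
    by (simp add: emeasure_distr)
  also have "\<dots> = (\<Prod>b\<in>Basis. (to_coords u - to_coords l) \<bullet> b)"
    by (intro emeasure_lborel_box) (auto simp: Basis_vec_def inner_axis to_coords_def intro!: le Rep_basis_index)
  also have "(\<Prod>b\<in>Basis. (to_coords u - to_coords l) \<bullet> b) = (\<Prod>i\<in>UNIV. (to_coords u - to_coords l) $ i)"
  proof -
    have eq: "(Basis :: (real^'a basis_index) set) = range (\<lambda>i. axis i 1)" by (auto simp: Basis_vec_def)
    have inj: "inj (\<lambda>i::'a basis_index. axis i (1::real))" by (auto simp: inj_on_def axis_eq_axis)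
    show ?thesis unfolding eq prod.reindex[OF inj] by (simp add: inner_axis)
  qed
  also have "\<dots> = (\<Prod>b\<in>Basis. (u - l) \<bullet> b)"
    using prod_Rep_basis_index[of "\<lambda>b. (u - l) \<bullet> b"] by (simp add: to_coords_def inner_diff_left)
  finally show "emeasure (distr lborel borel of_coords) (box l u) = (\<Prod>b\<in>Basis. (u - l) \<bullet> b)" .
qed simp

lemma integral_std_gauss_of_coords:
  fixes \<phi> :: "'a::euclidean_space \<Rightarrow> real"
  assumes [measurable]: "\<phi> \<in> borel_measurable borel"
  shows "(\<integral>v. \<phi> v \<partial>std_gauss) = (\<integral>x. \<phi> (of_coords x) \<partial>std_gauss)"
proof -
  have "gauss_density (of_coords x) = gauss_density x" for x :: "real^'a basis_index"
    by (simp add: gauss_density_def CARD_basis_index)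
  then show ?thesis
    by (simp add: integral_std_gauss(1)) (subst distr_lborel_of_coords[symmetric], simp add: integral_distr)
qed

text \<open>Conjugation by the isometry \<open>of_coords\<close> preserves the bounds A and a, the
  dimension and the Gaussian measure.\<close>

lemma std_gauss_transport:
  fixes g :: "'a::euclidean_space \<Rightarrow> 'a" and \<phi> :: "'a \<Rightarrow> real"
  assumes der: "\<And>v. (g has_derivative Dg v) (at v)"
    and A: "\<And>v. norm (g v) \<le> A"
    and a: "\<And>v u. norm (Dg v u) \<le> a * norm u" "0 \<le> a" "a \<le> 1/2"
    and \<phi>[measurable]: "\<phi> \<in> borel_measurable borel" and bd: "\<And>x. \<bar>\<phi> x\<bar> \<le> b"
  shows "(\<integral>v. \<phi> (v + g v) \<partial>std_gauss)
      \<le> ln (\<integral>v. exp (\<phi> v) \<partial>std_gauss) + (A\<^sup>2 / 2 + real DIM('a) * a\<^sup>2)"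
proof -
  have cont: "continuous_on UNIV g"
    using der by (intro continuous_at_imp_continuous_on ballI) (rule has_derivative_continuous)
  have [measurable]: "g \<in> borel_measurable borel"
    by (rule borel_measurable_continuous_onI[OF cont])
  let ?g = "\<lambda>x. to_coords (g (of_coords x))"
  have "(\<integral>x. \<phi> (of_coords (x + ?g x)) \<partial>std_gauss)
      \<le> ln (\<integral>x. exp (\<phi> (of_coords x)) \<partial>std_gauss) + (A\<^sup>2 / 2 + real CARD('a basis_index) * a\<^sup>2)"
  proof (rule std_gauss_transport_cart[where g = ?g and \<phi> = "\<lambda>x. \<phi> (of_coords x)" and Dg = "\<lambda>x u. to_coords (Dg (of_coords x) (of_coords u))" and b = b])
    show "(?g has_derivative (\<lambda>u. to_coords (Dg (of_coords x) (of_coords u)))) (at x)" for x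
    proof -
      have "(of_coords has_derivative of_coords) (at x)"
        by (rule linear_imp_has_derivative[OF linear_of_coords])
      from has_derivative_compose[OF this der]
      show ?thesis
        by (rule bounded_linear.has_derivative[OF linear_conv_bounded_linear[THEN iffD1, OF linear_to_coords]])
    qed
    show "norm (to_coords (Dg (of_coords x) (of_coords u))) \<le> a * norm u" for x u
      using a(1)[of "of_coords x" "of_coords u"] by simp
  qed (use A a bd in auto)
  moreover have "(\<integral>v. \<phi> (v + g v) \<partial>std_gauss) = (\<integral>x. \<phi> (of_coords (x + ?g x)) \<partial>std_gauss)"
    by (subst integral_std_gauss_of_coords) (simp_all add: linear_add[OF linear_of_coords])
  moreover have "(\<integral>v. exp (\<phi> v) \<partial>std_gauss) = (\<integral>x. exp (\<phi> (of_coords x)) \<partial>std_gauss)"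
    by (subst integral_std_gauss_of_coords) simp_all
  ultimately show ?thesis by (simp only: CARD_basis_index)
qed

section \<open>Stability of the Verlet scheme\<close>

text \<open>The forces \<open>a\<close> are left arbitrary so that the same estimate serves
  differences of trajectories, first variations and differences of first variations. Verlet
  integrates constant acceleration without error, which is why the continuous-time bounds t A and
  t^2 A / 2 hold with t = j h. The ranges differ because \<open>w j\<close> involves
  \<open>a j\<close>, whereas \<open>p j\<close> involves only forces before j.\<close>

lemma forced_verlet_bound:
  fixes p w a :: "nat \<Rightarrow> 'b::real_normed_vector"
  assumes p: "\<And>j. p (Suc j) = p j + h *\<^sub>R w j - (h\<^sup>2 / 2) *\<^sub>R a j"
    and w: "\<And>j. w (Suc j) = w j - (h / 2) *\<^sub>R (a j + a (Suc j))"
    and h: "0 \<le> h" and a: "\<And>j. j < N \<Longrightarrow> norm (a j) \<le> A"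
  shows "j < N \<Longrightarrow> norm (w j - w 0) \<le> real j * h * A"
    and "j \<le> N \<Longrightarrow> norm (p j - p 0 - (real j * h) *\<^sub>R w 0) \<le> (real j * h)\<^sup>2 / 2 * A"
proof -
  show vel: "norm (w j - w 0) \<le> real j * h * A" if "j < N" for j
    using that
  proof (induction j)
    case (Suc j)
    have "norm (a j + a (Suc j)) \<le> A + A"
      using a[of j] a[of "Suc j"] Suc.prems by (intro norm_triangle_le add_mono) auto
    from mult_left_mono[OF this, of "h / 2"] have "norm ((h / 2) *\<^sub>R (a j + a (Suc j))) \<le> h * A"
      using h by simp
    moreover have "w (Suc j) - w 0 = (w j - w 0) - (h / 2) *\<^sub>R (a j + a (Suc j))" by (simp add: w)
    moreover have "norm (w j - w 0) \<le> real j * h * A" using Suc by simp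
    ultimately have "norm (w (Suc j) - w 0) \<le> real j * h * A + h * A"
      by (simp only:) (rule order_trans[OF norm_triangle_ineq4 add_mono])
    then show ?case by (simp add: algebra_simps)
  qed simp
  show "norm (p j - p 0 - (real j * h) *\<^sub>R w 0) \<le> (real j * h)\<^sup>2 / 2 * A" if "j \<le> N"
    using that
  proof (induction j)
    case (Suc j)
    let ?e = "p j - p 0 - (real j * h) *\<^sub>R w 0"
    have "p (Suc j) - p 0 - (real (Suc j) * h) *\<^sub>R w 0 = ?e + h *\<^sub>R (w j - w 0) - (h\<^sup>2 / 2) *\<^sub>R a j"
      by (simp add: p algebra_simps)
    also have "norm \<dots> \<le> norm ?e + norm (h *\<^sub>R (w j - w 0)) + norm ((h\<^sup>2 / 2) *\<^sub>R a j)"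
      by (intro order_trans[OF norm_triangle_ineq4] add_right_mono norm_triangle_ineq)
    \<comment> \<open>The three terms add up because j^2 / 2 + j + 1/2 = (j + 1)^2 / 2.\<close>
    also have "\<dots> \<le> (real j * h)\<^sup>2 / 2 * A + h * (real j * h * A) + (h\<^sup>2 / 2) * A"
      using Suc a[of j] vel[of j] h by (intro add_mono) (auto intro!: mult_left_mono)
    also have "\<dots> = (real (Suc j) * h)\<^sup>2 / 2 * A"
      by (simp add: power2_eq_square field_simps)
    finally show ?case .
  qed simp
qed

text \<open>Absorption instead of a Gronwall factor: if P is the maximum of |p j| and S the bracket
  on the right, then P \<le> S + P / 24 because K T^2 / 2 \<le> 1/24, hence P \<le> (24/23) S.
  Putting this back into the deviation from free motion gives the term S / 23.\<close>

lemma forced_verlet_stability: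
  fixes p w a :: "nat \<Rightarrow> 'b::real_normed_vector"
  assumes p: "\<And>j. p (Suc j) = p j + h *\<^sub>R w j - (h\<^sup>2 / 2) *\<^sub>R a j"
    and w: "\<And>j. w (Suc j) = w j - (h / 2) *\<^sub>R (a j + a (Suc j))"
    and h: "0 \<le> h" and T: "real N * h = T"
    and a: "\<And>j. j < N \<Longrightarrow> norm (a j) \<le> K * norm (p j) + \<kappa>"
    and K: "0 \<le> K" "K * T\<^sup>2 \<le> 1 / 12" and \<kappa>: "0 \<le> \<kappa>"
  shows "j \<le> N \<Longrightarrow> norm (p j) \<le> 24 / 23 * (norm (p 0) + T * norm (w 0) + T\<^sup>2 / 2 * \<kappa>)"
    and "norm (p N - p 0 - T *\<^sub>R w 0) \<le> (norm (p 0) + T * norm (w 0) + T\<^sup>2 / 2 * \<kappa>) / 23 + T\<^sup>2 / 2 * \<kappa>"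
proof -
  define P where "P = Max ((\<lambda>j. norm (p j)) ` {..N})"
  have P: "norm (p j) \<le> P" if "j \<le> N" for j
    using that unfolding P_def by (intro Max_ge) auto
  have P0: "0 \<le> P" using order_trans[OF norm_ge_zero P[of 0]] by simp
  have a': "norm (a j) \<le> K * P + \<kappa>" if "j < N" for j
    using a[OF that] mult_left_mono[OF P[of j] K(1)] that by simp
  have jT: "0 \<le> real j * h \<and> real j * h \<le> T" if "j \<le> N" for j
    using that h unfolding T[symmetric] by (auto intro: mult_right_mono)
  have KP: "T\<^sup>2 / 2 * (K * P + \<kappa>) \<le> P / 24 + T\<^sup>2 / 2 * \<kappa>"
    using mult_right_mono[OF K(2) P0] by (simp add: algebra_simps)
  have dev: "norm (p j - p 0 - (real j * h) *\<^sub>R w 0) \<le> P / 24 + T\<^sup>2 / 2 * \<kappa>" if "j \<le> N" for j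
  proof -
    have "norm (p j - p 0 - (real j * h) *\<^sub>R w 0) \<le> (real j * h)\<^sup>2 / 2 * (K * P + \<kappa>)"
      using forced_verlet_bound(2)[where p = p and w = w and a = a, OF p w h a' that] .
    also have "\<dots> \<le> T\<^sup>2 / 2 * (K * P + \<kappa>)"
      using jT[OF that] K(1) P0 \<kappa> by (intro mult_right_mono divide_right_mono power_mono) auto
    finally show ?thesis using KP by linarith
  qed
  have "norm (p j) \<le> norm (p 0) + T * norm (w 0) + (P / 24 + T\<^sup>2 / 2 * \<kappa>)" if "j \<le> N" for j
  proof -
    have "norm (p 0 + (real j * h) *\<^sub>R w 0 + (p j - p 0 - (real j * h) *\<^sub>R w 0))
        \<le> norm (p 0) + norm ((real j * h) *\<^sub>R w 0) + norm (p j - p 0 - (real j * h) *\<^sub>R w 0)"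
      by (intro order_trans[OF norm_triangle_ineq] add_right_mono norm_triangle_ineq)
    then have "norm (p j) \<le> norm (p 0) + norm ((real j * h) *\<^sub>R w 0) + norm (p j - p 0 - (real j * h) *\<^sub>R w 0)"
      by simp
    also have "norm ((real j * h) *\<^sub>R w 0) \<le> T * norm (w 0)"
      using jT[OF that] by (simp add: mult_right_mono)
    finally show ?thesis using dev[OF that] by linarith
  qed
  then have "P \<le> norm (p 0) + T * norm (w 0) + (P / 24 + T\<^sup>2 / 2 * \<kappa>)"
    unfolding P_def by (subst Max_le_iff) auto
  then have PS: "P \<le> 24 / 23 * (norm (p 0) + T * norm (w 0) + T\<^sup>2 / 2 * \<kappa>)" by argo
  then show "norm (p j) \<le> 24 / 23 * (norm (p 0) + T * norm (w 0) + T\<^sup>2 / 2 * \<kappa>)" if "j \<le> N"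
    using P[OF that] by linarith
  show "norm (p N - p 0 - T *\<^sub>R w 0) \<le> (norm (p 0) + T * norm (w 0) + T\<^sup>2 / 2 * \<kappa>) / 23 + T\<^sup>2 / 2 * \<kappa>"
    using dev[OF order_refl] PS unfolding T by argo
qed

section \<open>Verlet trajectories and their first variation\<close>

definition verlet_pos :: "('a::euclidean_space \<Rightarrow> 'a) \<Rightarrow> real \<Rightarrow> nat \<Rightarrow> 'a \<Rightarrow> 'a \<Rightarrow> 'a" where
  "verlet_pos G h j x v = fst ((verlet_step G h ^^ j) (x, v))"

definition verlet_vel :: "('a::euclidean_space \<Rightarrow> 'a) \<Rightarrow> real \<Rightarrow> nat \<Rightarrow> 'a \<Rightarrow> 'a \<Rightarrow> 'a" where
  "verlet_vel G h j x v = snd ((verlet_step G h ^^ j) (x, v))"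

lemma verlet_0 [simp]: "verlet_pos G h 0 x v = x" "verlet_vel G h 0 x v = v"
  by (simp_all add: verlet_pos_def verlet_vel_def)

lemma verlet_pos_Suc:
  "verlet_pos G h (Suc j) x v = verlet_pos G h j x v + h *\<^sub>R verlet_vel G h j x v - (h\<^sup>2 / 2) *\<^sub>R G (verlet_pos G h j x v)"
  by (simp add: verlet_pos_def verlet_vel_def verlet_step_def Let_def split: prod.split)

lemma verlet_vel_Suc:
  "verlet_vel G h (Suc j) x v = verlet_vel G h j x v - (h / 2) *\<^sub>R (G (verlet_pos G h j x v) + G (verlet_pos G h (Suc j) x v))"
  by (simp add: verlet_pos_def verlet_vel_def verlet_step_def Let_def split: prod.split)

text \<open>The derivative of position and velocity with respect to the initial velocity, in
  direction u. It is again a Verlet recursion, with forces given by \<open>H\<close> along the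
  trajectory.\<close>

primrec verlet_var :: "('a::euclidean_space \<Rightarrow> 'a) \<Rightarrow> ('a \<Rightarrow> 'a \<Rightarrow> 'a) \<Rightarrow> real \<Rightarrow> nat \<Rightarrow> 'a \<Rightarrow> 'a \<Rightarrow> 'a \<Rightarrow> 'a \<times> 'a" where
  "verlet_var G H h 0 x v u = (0, u)"
| "verlet_var G H h (Suc j) x v u =
    (let a = H (verlet_pos G h j x v) (fst (verlet_var G H h j x v u));
         p = fst (verlet_var G H h j x v u) + h *\<^sub>R snd (verlet_var G H h j x v u) - (h\<^sup>2 / 2) *\<^sub>R a
     in (p, snd (verlet_var G H h j x v u) - (h / 2) *\<^sub>R (a + H (verlet_pos G h (Suc j) x v) p)))"

text \<open>\<open>G\<close> stands for the gradient and \<open>H\<close> for the Hessian; the bound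
  on the third derivative enters as a Lipschitz bound on \<open>H\<close>.\<close>

locale smooth_field =
  fixes G :: "'a::euclidean_space \<Rightarrow> 'a" and H :: "'a \<Rightarrow> 'a \<Rightarrow> 'a" and L M :: real
  assumes der: "(G has_derivative H x) (at x)"
    and H_bound: "norm (H x u) \<le> L * norm u"
    and H_lipschitz: "norm (H x u - H y u) \<le> M * norm (x - y) * norm u"
begin

lemma L_nonneg: "0 \<le> L"
proof -
  obtain e :: 'a where "e \<in> Basis" using nonempty_Basis by blast
  then show ?thesis using order_trans[OF norm_ge_zero H_bound[of 0 e]] by simp
qed

lemma M_nonneg: "0 \<le> M"
proof -
  obtain e :: 'a where "e \<in> Basis" using nonempty_Basis by blast
  then show ?thesis using order_trans[OF norm_ge_zero H_lipschitz[of e e 0]] by simp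
qed

lemma lipschitz: "norm (G x - G y) \<le> L * norm (x - y)"
  by (rule lipschitz_of_derivative_bound[OF der H_bound])

text \<open>The difference of two trajectories is a forced Verlet recursion whose force is at most L
  times its position, that is, \<kappa> = 0.\<close>

lemma verlet_difference:
  assumes "0 \<le> h" "real N * h = T" "L * T\<^sup>2 \<le> 1 / 12"
  shows "j \<le> N \<Longrightarrow> norm (verlet_pos G h j x v - verlet_pos G h j y w) \<le> 24 / 23 * (norm (x - y) + T * norm (v - w))"
    and "norm (verlet_pos G h N x v - verlet_pos G h N y w - (x - y) - T *\<^sub>R (v - w)) \<le> (norm (x - y) + T * norm (v - w)) / 23"
proof -
  define p where "p j = verlet_pos G h j x v - verlet_pos G h j y w" for j
  define q where "q j = verlet_vel G h j x v - verlet_vel G h j y w" for j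
  define a where "a j = G (verlet_pos G h j x v) - G (verlet_pos G h j y w)" for j
  have 1: "p (Suc j) = p j + h *\<^sub>R q j - (h\<^sup>2 / 2) *\<^sub>R a j" for j
    by (simp add: p_def q_def a_def verlet_pos_Suc algebra_simps)
  have 2: "q (Suc j) = q j - (h / 2) *\<^sub>R (a j + a (Suc j))" for j
    by (simp add: p_def q_def a_def verlet_vel_Suc algebra_simps)
  have 3: "norm (a j) \<le> L * norm (p j) + 0" for j
    using lipschitz by (simp add: a_def p_def)
  note stab = forced_verlet_stability[where p = p and w = q and a = a, OF 1 2 assms(1,2) 3 L_nonneg assms(3) order_refl]
  show "norm (verlet_pos G h j x v - verlet_pos G h j y w) \<le> 24 / 23 * (norm (x - y) + T * norm (v - w))" if "j \<le> N"
    using stab(1)[OF that] by (simp add: p_def q_def)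
  show "norm (verlet_pos G h N x v - verlet_pos G h N y w - (x - y) - T *\<^sub>R (v - w)) \<le> (norm (x - y) + T * norm (v - w)) / 23"
    using stab(2) by (simp add: p_def q_def)
qed

lemma verlet_has_derivative:
  "((\<lambda>v. verlet_pos G h j x v) has_derivative (\<lambda>u. fst (verlet_var G H h j x v u))) (at v)"
  "((\<lambda>v. verlet_vel G h j x v) has_derivative (\<lambda>u. snd (verlet_var G H h j x v u))) (at v)"
proof (induction j)
  case 0
  show "((\<lambda>v. verlet_pos G h 0 x v) has_derivative (\<lambda>u. fst (verlet_var G H h 0 x v u))) (at v)"
    "((\<lambda>v. verlet_vel G h 0 x v) has_derivative (\<lambda>u. snd (verlet_var G H h 0 x v u))) (at v)"
    by simp_all
next
  case (Suc j)
  note G1 = has_derivative_compose[OF Suc(1) der]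
  show pos: "((\<lambda>v. verlet_pos G h (Suc j) x v) has_derivative (\<lambda>u. fst (verlet_var G H h (Suc j) x v u))) (at v)"
    unfolding verlet_pos_Suc verlet_var.simps Let_def fst_conv
    by (intro has_derivative_diff has_derivative_add has_derivative_scaleR_right Suc G1)
  note G2 = has_derivative_compose[OF pos der]
  show "((\<lambda>v. verlet_vel G h (Suc j) x v) has_derivative (\<lambda>u. snd (verlet_var G H h (Suc j) x v u))) (at v)"
    using G2 unfolding verlet_vel_Suc verlet_var.simps Let_def fst_conv snd_conv
    by (intro has_derivative_diff has_derivative_add has_derivative_scaleR_right Suc G1)
qed

lemma verlet_var_Suc:
  fixes x v u h
  defines "p \<equiv> \<lambda>j. fst (verlet_var G H h j x v u)" and "q \<equiv> \<lambda>j. snd (verlet_var G H h j x v u)"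
  shows "p (Suc j) = p j + h *\<^sub>R q j - (h\<^sup>2 / 2) *\<^sub>R H (verlet_pos G h j x v) (p j)"
    and "q (Suc j) = q j - (h / 2) *\<^sub>R (H (verlet_pos G h j x v) (p j) + H (verlet_pos G h (Suc j) x v) (p (Suc j)))"
  by (simp_all add: p_def q_def Let_def)

lemma verlet_var_bound:
  assumes "0 \<le> h" "real N * h = T" "L * T\<^sup>2 \<le> 1 / 12"
  shows "j \<le> N \<Longrightarrow> norm (fst (verlet_var G H h j x v u)) \<le> 24 / 23 * (T * norm u)"
    and "norm (fst (verlet_var G H h N x v u) - T *\<^sub>R u) \<le> T * norm u / 23"
proof -
  have 3: "norm (H (verlet_pos G h j x v) (fst (verlet_var G H h j x v u))) \<le> L * norm (fst (verlet_var G H h j x v u)) + 0" for j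
    using H_bound by simp
  note stab = forced_verlet_stability[where p = "\<lambda>j. fst (verlet_var G H h j x v u)" and w = "\<lambda>j. snd (verlet_var G H h j x v u)"
      and a = "\<lambda>j. H (verlet_pos G h j x v) (fst (verlet_var G H h j x v u))",
      OF verlet_var_Suc assms(1,2) 3 L_nonneg assms(3) order_refl]
  show "norm (fst (verlet_var G H h j x v u)) \<le> 24 / 23 * (T * norm u)" if "j \<le> N"
    using stab(1)[OF that] by simp
  show "norm (fst (verlet_var G H h N x v u) - T *\<^sub>R u) \<le> T * norm u / 23"
    using stab(2) by simp
qed

text \<open>The difference of two first variations starts from zero and is driven only by the change
  of Hessian between the trajectories, a source of size M R times the first variation. The constant
  is (24/23)^2 / 2: one factor bounds the variation inside \<kappa>, the other comes from
  stability.\<close>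

lemma verlet_var_difference:
  assumes h: "0 \<le> h" "real N * h = T" "L * T\<^sup>2 \<le> 1 / 12"
    and R: "\<And>j. j \<le> N \<Longrightarrow> norm (verlet_pos G h j x v - verlet_pos G h j y w) \<le> R"
  shows "norm (fst (verlet_var G H h N x v u) - fst (verlet_var G H h N y w u)) \<le> 288 / 529 * (M * R * T ^ 3 * norm u)"
proof -
  have T0: "0 \<le> T" using h by (metis mult_nonneg_nonneg of_nat_0_le_iff)
  have R0: "0 \<le> R" using order_trans[OF norm_ge_zero R[of 0]] by simp
  define P where "P j = fst (verlet_var G H h j x v u)" for j
  define P' where "P' j = fst (verlet_var G H h j y w u)" for j
  define p where "p j = P j - P' j" for j
  define q where "q j = snd (verlet_var G H h j x v u) - snd (verlet_var G H h j y w u)" for j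
  define a where "a j = H (verlet_pos G h j x v) (P j) - H (verlet_pos G h j y w) (P' j)" for j
  define \<kappa> where "\<kappa> = M * R * (24 / 23 * (T * norm u))"
  have 1: "p (Suc j) = p j + h *\<^sub>R q j - (h\<^sup>2 / 2) *\<^sub>R a j" for j
    unfolding p_def q_def a_def P_def P'_def verlet_var_Suc(1) by (simp add: algebra_simps del: verlet_var.simps)
  have 2: "q (Suc j) = q j - (h / 2) *\<^sub>R (a j + a (Suc j))" for j
    unfolding p_def q_def a_def P_def P'_def verlet_var_Suc(2) by (simp add: algebra_simps del: verlet_var.simps)
  have 3: "norm (a j) \<le> L * norm (p j) + \<kappa>" if "j < N" for j
  proof -
    \<comment> \<open>Both Hessians act on the second variation in the bracket, so the first summand
      is linear in p and the bracket is a pure source.\<close>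
    have "a j = H (verlet_pos G h j x v) (p j) + (H (verlet_pos G h j x v) (P' j) - H (verlet_pos G h j y w) (P' j))"
      using linear_diff[OF has_derivative_linear[OF der]] by (simp add: a_def p_def)
    also have "norm \<dots> \<le> L * norm (p j) + M * norm (verlet_pos G h j x v - verlet_pos G h j y w) * norm (P' j)"
      by (intro norm_triangle_le add_mono H_bound H_lipschitz)
    also have "M * norm (verlet_pos G h j x v - verlet_pos G h j y w) * norm (P' j) \<le> \<kappa>"
      unfolding \<kappa>_def P'_def using M_nonneg R0 that
      by (intro mult_mono mult_left_mono R verlet_var_bound(1)[OF h]) auto
    finally show ?thesis by simp
  qed
  have \<kappa>0: "0 \<le> \<kappa>" using M_nonneg R0 T0 by (simp add: \<kappa>_def)
  have "norm (p N) \<le> 24 / 23 * (norm (p 0) + T * norm (q 0) + T\<^sup>2 / 2 * \<kappa>)"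
    using forced_verlet_stability(1)[where p = p and w = q and a = a, OF 1 2 h(1,2) 3 L_nonneg h(3) \<kappa>0 order_refl] .
  also have "\<dots> = 288 / 529 * (M * R * T ^ 3 * norm u)"
    by (simp add: p_def q_def P_def P'_def \<kappa>_def power2_eq_square power3_eq_cube)
  finally show ?thesis by (simp add: p_def P_def P'_def)
qed

end

section \<open>The change of velocity that makes two trajectories meet\<close>

context smooth_field
begin

text \<open>After division by T the position map is the identity plus a 1/23-Lipschitz map.\<close>

lemma bij_verlet_pos:
  assumes h: "0 \<le> h" "real N * h = T" "L * T\<^sup>2 \<le> 1 / 12" and T: "0 < T"
  shows "bij (verlet_pos G h N x)"
proof -
  let ?F = "verlet_pos G h N x"
  define g where "g v = ?F v /\<^sub>R T - v" for v
  have "norm (g u - g v) \<le> 1 / 23 * norm (u - v)" for u v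
  proof -
    have "g u - g v = (?F u - ?F v - T *\<^sub>R (u - v)) /\<^sub>R T"
      using T by (simp add: g_def algebra_simps)
    then have "norm (g u - g v) = norm (?F u - ?F v - T *\<^sub>R (u - v)) / T"
      using T by (simp add: divide_inverse)
    also have "\<dots> \<le> T * norm (u - v) / 23 / T"
      using verlet_difference(2)[OF h, of x u x v] T by (intro divide_right_mono) auto
    finally show ?thesis using T by simp
  qed
  then have "bij (\<lambda>v. v + g v)" by (rule bij_id_plus_contraction) auto
  moreover have "bij (\<lambda>v::'a. T *\<^sub>R v)"
    by (rule bij_betw_byWitness[where f' = "\<lambda>v. v /\<^sub>R T"]) (use T in auto)
  moreover have "?F = (\<lambda>v. T *\<^sub>R v) \<circ> (\<lambda>v. v + g v)"
    using T by (auto simp: g_def fun_eq_iff)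
  ultimately show ?thesis by (simp add: bij_comp)
qed

text \<open>The map v + g v is the inverse of the position map at y composed with the position map
  at x. Two bounds on Dg are needed: 1/11 holds however far apart x and y are and keeps the
  determinant estimate applicable, while the bound proportional to |x - y| gives the quadratic
  cost.\<close>

lemma verlet_transport:
  assumes h: "0 \<le> h" "real N * h = T" "L * T\<^sup>2 \<le> 1 / 12" and T: "0 < T"
  obtains g Dg where "\<And>v. (g has_derivative Dg v) (at v)"
    and "\<And>v. norm (g v) \<le> 12 / 11 * norm (x - y) / T"
    and "\<And>v u. norm (Dg v u) \<le> 1 / 11 * norm u"
    and "\<And>v u. norm (Dg v u) \<le> 5 / 4 * M * T\<^sup>2 * norm (x - y) * norm u"
    and "\<And>v. verlet_pos G h N y (v + g v) = verlet_pos G h N x v"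
proof -
  let ?Fx = "verlet_pos G h N x" and ?Fy = "verlet_pos G h N y"
  let ?Jx = "\<lambda>v u. fst (verlet_var G H h N x v u)" and ?Jy = "\<lambda>v u. fst (verlet_var G H h N y v u)"
  have bij: "bij ?Fy" using h T by (rule bij_verlet_pos)
  define \<Phi> where "\<Phi> v = inv ?Fy (?Fx v)" for v
  have \<Phi>: "?Fy (\<Phi> v) = ?Fx v" for v
    unfolding \<Phi>_def using bij by (simp add: bij_is_surj surj_f_inv_f)
  have low: "22 / 23 * T * norm (v - w) \<le> norm (?Fy v - ?Fy w)" for v w
  proof -
    have "norm (T *\<^sub>R (v - w)) \<le> norm (?Fy v - ?Fy w) + norm (?Fy v - ?Fy w - T *\<^sub>R (v - w))"
      by (metis norm_triangle_sub norm_minus_commute)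
    moreover have "norm (?Fy v - ?Fy w - T *\<^sub>R (v - w)) \<le> T * norm (v - w) / 23"
      using verlet_difference(2)[OF h, of y v y w] by simp
    ultimately show ?thesis using T by simp
  qed
  have lowJ: "22 / 23 * T * norm u \<le> norm (?Jy w u)" for w u
  proof -
    have "norm (T *\<^sub>R u) \<le> norm (?Jy w u) + norm (?Jy w u - T *\<^sub>R u)"
      by (metis norm_triangle_sub norm_minus_commute)
    then show ?thesis using verlet_var_bound(2)[OF h, of y w u] T by simp
  qed
  have linJ: "linear (?Jy w)" for w
    using has_derivative_linear[OF verlet_has_derivative(1)] .
  have "\<exists>R. linear R \<and> (\<forall>u. R (?Jy w u) = u) \<and> (\<forall>u. ?Jy w (R u) = u)" for w
  proof -
    have "inj (?Jy w)"
      unfolding linear_injective_0[OF linJ] using lowJ[of _ w] T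
      by (metis mult_le_0_iff norm_eq_zero norm_le_zero_iff norm_zero not_le divide_pos_pos mult_pos_pos zero_less_numeral)
    then show ?thesis using linear_injective_isomorphism[OF linJ] by blast
  qed
  then obtain R where R: "\<And>w. linear (R w)" "\<And>w u. R w (?Jy w u) = u" "\<And>w u. ?Jy w (R w u) = u"
    by metis
  have Rn: "norm (R w u) \<le> 23 / (22 * T) * norm u" for w u
    using lowJ[of "R w u" w] T by (simp add: R field_simps)
  have contF: "isCont (inv ?Fy) z" for z
  proof -
    have "norm (inv ?Fy z - inv ?Fy z') \<le> 23 / (22 * T) * norm (z - z')" for z z'
      using low[of "inv ?Fy z" "inv ?Fy z'"] T bij by (simp add: bij_is_surj surj_f_inv_f field_simps)
    then have "(23 / (22 * T))-lipschitz_on UNIV (inv ?Fy)"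
      using T by (intro lipschitz_onI) (auto simp: dist_norm)
    then show ?thesis
      using lipschitz_on_continuous_on continuous_on_eq_continuous_at open_UNIV by blast
  qed
  \<comment> \<open>Both the invertible derivative and the continuity of the inverse come from the
    expansion factor (22/23) T.\<close>
  have dinv: "(inv ?Fy has_derivative R (\<Phi> v)) (at (?Fx v))" for v
  proof (rule has_derivative_inverse_basic[where T = UNIV])
    show "(?Fy has_derivative ?Jy (\<Phi> v)) (at (inv ?Fy (?Fx v)))"
      using verlet_has_derivative(1) by (simp add: \<Phi>_def)
    show "bounded_linear (R (\<Phi> v))" using R(1) by (simp add: linear_conv_bounded_linear)
  qed (use R(2) contF bij in \<open>auto simp: fun_eq_iff bij_is_surj surj_f_inv_f\<close>)
  have d\<Phi>: "(\<Phi> has_derivative (\<lambda>u. R (\<Phi> v) (?Jx v u))) (at v)" for v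
    unfolding \<Phi>_def using has_derivative_compose[OF verlet_has_derivative(1) dinv]
    by (simp add: \<Phi>_def)
  define g where "g v = \<Phi> v - v" for v
  define Dg where "Dg v u = R (\<Phi> v) (?Jx v u) - u" for v u
  have Dg_eq: "Dg v u = R (\<Phi> v) (?Jx v u - ?Jy (\<Phi> v) u)" for v u
    unfolding Dg_def linear_diff[OF R(1)] R(2) ..
  have Dg_le: "norm (Dg v u) \<le> 23 / (22 * T) * norm (?Jx v u - ?Jy (\<Phi> v) u)" for v u
    unfolding Dg_eq by (rule Rn)
  have g_le: "norm (g v) \<le> 12 / 11 * norm (x - y) / T" for v
  proof -
    \<comment> \<open>Expansion of the map at y, applied to \<Phi> v and v; the quotient of 24/23 by
      22/23 is 12/11.\<close>
    have "22 / 23 * T * norm (\<Phi> v - v) \<le> norm (?Fx v - ?Fy v)"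
      using low[of "\<Phi> v" v] by (simp add: \<Phi>)
    also have "\<dots> \<le> 24 / 23 * norm (x - y)"
      using verlet_difference(1)[OF h order_refl, of x v y v] by simp
    finally show ?thesis using T by (simp add: g_def field_simps)
  qed
  show thesis
  proof (rule that)
    show "(g has_derivative Dg v) (at v)" for v
      unfolding g_def Dg_def by (intro has_derivative_diff d\<Phi> has_derivative_ident)
    show "norm (g v) \<le> 12 / 11 * norm (x - y) / T" for v by (rule g_le)
    show "?Fy (v + g v) = ?Fx v" for v by (simp add: g_def \<Phi>)
    show "norm (Dg v u) \<le> 1 / 11 * norm u" for v u
    proof -
      \<comment> \<open>Each derivative is within T / 23 of T times the identity; 2/23 divided by
        22/23 is 1/11.\<close>
      have "norm (?Jx v u - ?Jy (\<Phi> v) u) \<le> norm (?Jx v u - T *\<^sub>R u) + norm (?Jy (\<Phi> v) u - T *\<^sub>R u)"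
        using norm_triangle_ineq4[of "?Jx v u - T *\<^sub>R u" "?Jy (\<Phi> v) u - T *\<^sub>R u"] by simp
      also have "\<dots> \<le> 2 / 23 * T * norm u"
        using verlet_var_bound(2)[OF h, of x v u] verlet_var_bound(2)[OF h, of y "\<Phi> v" u] by simp
      finally have "23 / (22 * T) * norm (?Jx v u - ?Jy (\<Phi> v) u) \<le> 23 / (22 * T) * (2 / 23 * T * norm u)"
        using T by (intro mult_left_mono) auto
      then show ?thesis using Dg_le[of v u] T by simp
    qed
    show "norm (Dg v u) \<le> 5 / 4 * M * T\<^sup>2 * norm (x - y) * norm u" for v u
    proof -
      \<comment> \<open>The coupled trajectories stay close at all intermediate times: 24/23 times 1
        + 12/11 equals 24/11.\<close>
      have "norm (verlet_pos G h j x v - verlet_pos G h j y (\<Phi> v)) \<le> 24 / 11 * norm (x - y)" if "j \<le> N" for j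
      proof -
        have "T * norm (v - \<Phi> v) \<le> 12 / 11 * norm (x - y)"
          using g_le[of v] T by (simp add: g_def norm_minus_commute field_simps)
        then show ?thesis using verlet_difference(1)[OF h that, of x v y "\<Phi> v"] by simp
      qed
      from verlet_var_difference[OF h this]
      have "23 / (22 * T) * norm (?Jx v u - ?Jy (\<Phi> v) u)
          \<le> 23 / (22 * T) * (288 / 529 * (M * (24 / 11 * norm (x - y)) * T ^ 3 * norm u))"
        using T by (intro mult_left_mono) auto
      also have "\<dots> = 3456 / 2783 * (M * T\<^sup>2 * norm (x - y) * norm u)"
        using T by (simp add: power2_eq_square power3_eq_cube)
      also have "\<dots> \<le> 5 / 4 * (M * T\<^sup>2 * norm (x - y) * norm u)"
        using M_nonneg by (intro mult_right_mono) auto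
      finally show ?thesis using Dg_le[of v u] by (simp add: mult.assoc)
    qed
  qed
qed

end

section \<open>Duality for the relative entropy\<close>

lemma outer_open_approx:
  fixes M :: "'b::euclidean_space measure"
  assumes "finite_measure M" and M: "sets M = sets borel" and A: "A \<in> sets borel" and \<epsilon>: "0 < \<epsilon>"
  obtains U where "open U" "A \<subseteq> U" "measure M (U - A) < \<epsilon>"
proof -
  interpret finite_measure M by fact
  have [simp]: "space M = UNIV" using sets_eq_imp_space_eq[OF M] by simp
  have "(INF U \<in> {U. A \<subseteq> U \<and> open U}. emeasure M U) = emeasure M A"
    using outer_regular[OF M _ A] by simp
  also have "\<dots> < ennreal (measure M A + \<epsilon>)"
    using \<epsilon> by (simp add: emeasure_eq_measure ennreal_less_iff)
  finally obtain U where U: "A \<subseteq> U" "open U" "emeasure M U < ennreal (measure M A + \<epsilon>)"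
    unfolding INF_less_iff by auto
  have "measure M (U - A) = measure M U - measure M A"
    using U A by (intro finite_measure_Diff) (auto simp: M)
  also have "\<dots> < \<epsilon>"
    using U(3) by (simp add: emeasure_eq_measure ennreal_less_iff)
  finally show thesis using U that by blast
qed

text \<open>Urysohn's lemma is applied to the closed sets -V inside A and -U outside A; the
  resulting function can differ from the indicator only on the small sets U - A and V \<inter>
  A.\<close>

lemma indicator_L1_approx_continuous:
  fixes M :: "'b::euclidean_space measure"
  assumes fin: "finite_measure M" and M: "sets M = sets borel" and A: "A \<in> sets borel" and \<epsilon>: "0 < \<epsilon>"
  obtains \<psi> :: "'b \<Rightarrow> real" where "continuous_on UNIV \<psi>" "\<And>x. \<bar>\<psi> x\<bar> \<le> 1"
    "(\<integral>x. \<bar>indicator A x - \<psi> x\<bar> \<partial>M) < \<epsilon>"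
proof -
  interpret finite_measure M by fact
  obtain U where U: "open U" "A \<subseteq> U" "measure M (U - A) < \<epsilon> / 2"
    using outer_open_approx[OF fin M A, of "\<epsilon> / 2"] \<epsilon> by auto
  have "- A \<in> sets borel" using A by auto
  then obtain V where V: "open V" "- A \<subseteq> V" "measure M (V - - A) < \<epsilon> / 2"
    using outer_open_approx[OF fin M, of "- A" "\<epsilon> / 2"] \<epsilon> by auto
  obtain \<psi> :: "'b \<Rightarrow> real" where \<psi>: "continuous_on UNIV \<psi>" "\<And>x. \<psi> x \<in> closed_segment 1 0"
    "\<And>x. x \<in> - V \<Longrightarrow> \<psi> x = 1" "\<And>x. x \<in> - U \<Longrightarrow> \<psi> x = 0"
    using Urysohn[of "- V" "- U" 1 "0::real"] U V by auto
  have r: "0 \<le> \<psi> x \<and> \<psi> x \<le> 1" for x using \<psi>(2)[of x] by (simp add: closed_segment_eq_real_ivl)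
  have [measurable]: "\<psi> \<in> borel_measurable M"
    using borel_measurable_continuous_onI[OF \<psi>(1)] measurable_cong_sets[OF M refl] by blast
  have [measurable]: "A \<in> sets M" "U \<in> sets M" "V \<in> sets M" using A U V by (auto simp: M)
  have pt: "\<bar>indicator A x - \<psi> x\<bar> \<le> indicator (U - A) x + indicator (V - - A) x" for x
  proof (cases "x \<in> A")
    case True
    then show ?thesis using U(2) \<psi>(3)[of x] r[of x] by (cases "x \<in> V") (auto simp: indicator_def)
  next
    case False
    then show ?thesis using V(2) \<psi>(4)[of x] r[of x] by (cases "x \<in> U") (auto simp: indicator_def)
  qed
  have "(\<integral>x. \<bar>indicator A x - \<psi> x\<bar> \<partial>M) \<le> (\<integral>x. indicator (U - A) x + indicator (V - - A) x \<partial>M)"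
  proof (rule integral_mono[OF _ _ pt])
    show "integrable M (\<lambda>x. \<bar>indicator A x - \<psi> x\<bar>)"
      by (rule integrable_const_bound[where B = 1]) (use r in \<open>auto simp: indicator_def\<close>)
    show "integrable M (\<lambda>x. indicator (U - A) x + indicator (V - - A) x :: real)"
      by (intro Bochner_Integration.integrable_add integrable_real_indicator) (auto simp: less_top[symmetric])
  qed
  also have "\<dots> = measure M (U - A) + measure M (V - - A)"
  proof -
    have "U - A \<in> sets M" "V - - A \<in> sets M" by auto
    then show ?thesis
      by (subst Bochner_Integration.integral_add) (auto simp: less_top[symmetric] dest: sets.sets_into_space intro!: arg_cong2[of _ _ _ _ "(+)"] arg_cong[of _ _ "measure M"])
  qed
  also have "\<dots> < \<epsilon>" using U V by simp
  finally show thesis using that \<psi>(1) r by (metis abs_of_nonneg)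
qed

lemma integrable_L1_approx_continuous:
  fixes M :: "'b::euclidean_space measure" and \<phi> :: "'b \<Rightarrow> real"
  assumes fin: "finite_measure M" and M: "sets M = sets borel" and \<phi>: "integrable M \<phi>"
  shows "\<forall>\<epsilon>>0. \<exists>\<psi>. continuous_on UNIV \<psi> \<and> (\<exists>b. \<forall>x. \<bar>\<psi> x\<bar> \<le> b) \<and> (\<integral>x. \<bar>\<phi> x - \<psi> x\<bar> \<partial>M) < \<epsilon>"
  using \<phi>
proof (induction \<phi> rule: integrable_induct)
  interpret finite_measure M by fact
  have meas: "\<psi> \<in> borel_measurable M" if "continuous_on UNIV \<psi>" for \<psi> :: "'b \<Rightarrow> real"
    using borel_measurable_continuous_onI[OF that] measurable_cong_sets[OF M refl] by blast
  have int: "integrable M \<psi>" if "continuous_on UNIV \<psi>" "\<forall>x. \<bar>\<psi> x\<bar> \<le> b" for \<psi> :: "'b \<Rightarrow> real" and b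
    by (rule integrable_const_bound[where B = b]) (use that meas in auto)
  {
    case (base A c)
    show ?case
    proof (intro allI impI)
      fix \<epsilon> :: real assume "0 < \<epsilon>"
      then have "0 < \<epsilon> / (\<bar>c\<bar> + 1)" by simp
      from indicator_L1_approx_continuous[OF fin M _ this, of A] base
      obtain \<psi> where \<psi>: "continuous_on UNIV \<psi>" "\<And>x. \<bar>\<psi> x\<bar> \<le> 1" "(\<integral>x. \<bar>indicator A x - \<psi> x\<bar> \<partial>M) < \<epsilon> / (\<bar>c\<bar> + 1)"
        by (metis M)
      have "(\<integral>x. \<bar>indicator A x *\<^sub>R c - \<psi> x * c\<bar> \<partial>M) = (\<integral>x. \<bar>indicator A x - \<psi> x\<bar> \<partial>M) * \<bar>c\<bar>"
        unfolding integral_mult_left_zero[symmetric]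
        by (intro Bochner_Integration.integral_cong) (auto simp: abs_mult[symmetric] algebra_simps)
      also have "\<dots> \<le> \<epsilon> / (\<bar>c\<bar> + 1) * \<bar>c\<bar>" using \<psi>(3) by (intro mult_right_mono) auto
      also have "\<dots> < \<epsilon>" using \<open>0 < \<epsilon>\<close> by (simp add: field_simps)
      finally have "(\<integral>x. \<bar>indicator A x *\<^sub>R c - \<psi> x * c\<bar> \<partial>M) < \<epsilon>" .
      moreover have "\<forall>x. \<bar>\<psi> x * c\<bar> \<le> 1 * \<bar>c\<bar>" using mult_right_mono[OF \<psi>(2), of "\<bar>c\<bar>"] by (simp add: abs_mult)
      moreover have "continuous_on UNIV (\<lambda>x. \<psi> x * c)" using \<psi>(1) by (intro continuous_intros)
      ultimately show "\<exists>\<psi>. continuous_on UNIV \<psi> \<and> (\<exists>b. \<forall>x. \<bar>\<psi> x\<bar> \<le> b) \<and> (\<integral>x. \<bar>indicator A x *\<^sub>R c - \<psi> x\<bar> \<partial>M) < \<epsilon>"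
        by blast
    qed
  next
    case (add f g)
    show ?case
    proof (intro allI impI)
      fix \<epsilon> :: real assume "0 < \<epsilon>"
      then have "0 < \<epsilon> / 2" by simp
      obtain \<psi>1 b1 where 1: "continuous_on UNIV \<psi>1" "\<forall>x. \<bar>\<psi>1 x\<bar> \<le> b1" "(\<integral>x. \<bar>f x - \<psi>1 x\<bar> \<partial>M) < \<epsilon> / 2"
        using add.IH(1) \<open>0 < \<epsilon> / 2\<close> by blast
      obtain \<psi>2 b2 where 2: "continuous_on UNIV \<psi>2" "\<forall>x. \<bar>\<psi>2 x\<bar> \<le> b2" "(\<integral>x. \<bar>g x - \<psi>2 x\<bar> \<partial>M) < \<epsilon> / 2"
        using add.IH(2) \<open>0 < \<epsilon> / 2\<close> by blast
      have i: "integrable M (\<lambda>x. \<bar>f x - \<psi>1 x\<bar>)" "integrable M (\<lambda>x. \<bar>g x - \<psi>2 x\<bar>)"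
        using add.hyps int[OF 1(1,2)] int[OF 2(1,2)] by auto
      have "(\<integral>x. \<bar>f x + g x - (\<psi>1 x + \<psi>2 x)\<bar> \<partial>M) \<le> (\<integral>x. \<bar>f x - \<psi>1 x\<bar> + \<bar>g x - \<psi>2 x\<bar> \<partial>M)"
        using add.hyps int[OF 1(1,2)] int[OF 2(1,2)] i
        by (intro integral_mono) auto
      also have "\<dots> < \<epsilon>" using i 1 2 by simp
      finally have "(\<integral>x. \<bar>f x + g x - (\<psi>1 x + \<psi>2 x)\<bar> \<partial>M) < \<epsilon>" .
      moreover have "\<forall>x. \<bar>\<psi>1 x + \<psi>2 x\<bar> \<le> b1 + b2"
        using 1(2) 2(2) by (auto intro: order_trans[OF abs_triangle_ineq] add_mono)
      moreover have "continuous_on UNIV (\<lambda>x. \<psi>1 x + \<psi>2 x)" using 1 2 by (intro continuous_intros)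
      ultimately show "\<exists>\<psi>. continuous_on UNIV \<psi> \<and> (\<exists>b. \<forall>x. \<bar>\<psi> x\<bar> \<le> b) \<and> (\<integral>x. \<bar>f x + g x - \<psi> x\<bar> \<partial>M) < \<epsilon>"
        by blast
    qed
  next
    case (lim f s)
    show ?case
    proof (intro allI impI)
      fix \<epsilon> :: real assume "0 < \<epsilon>"
      have "(\<lambda>i. \<integral>x. \<bar>f x - s i x\<bar> \<partial>M) \<longlonglongrightarrow> (\<integral>x. 0 \<partial>M)"
      proof (rule integral_dominated_convergence[where w = "\<lambda>x. 3 * \<bar>f x\<bar>"])
        show "AE x in M. (\<lambda>i. \<bar>f x - s i x\<bar>) \<longlonglongrightarrow> 0"
          using lim.hyps(2) by (intro AE_I2 tendsto_rabs_zero) (auto intro!: tendsto_eq_intros)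
        show "AE x in M. norm \<bar>f x - s i x\<bar> \<le> 3 * \<bar>f x\<bar>" for i
        proof (rule AE_I2)
          fix x assume "x \<in> space M"
          then show "norm \<bar>f x - s i x\<bar> \<le> 3 * \<bar>f x\<bar>" using lim.hyps(3)[of x i] by simp
        qed
      qed (use lim.hyps in auto)
      then have "\<forall>\<^sub>F i in sequentially. (\<integral>x. \<bar>f x - s i x\<bar> \<partial>M) < \<epsilon> / 2"
        using \<open>0 < \<epsilon>\<close> by (intro order_tendstoD(2)) auto
      then obtain i where i: "(\<integral>x. \<bar>f x - s i x\<bar> \<partial>M) < \<epsilon> / 2"
        by (auto dest: eventually_happens)
      obtain \<psi> b where \<psi>: "continuous_on UNIV \<psi>" "\<forall>x. \<bar>\<psi> x\<bar> \<le> b" "(\<integral>x. \<bar>s i x - \<psi> x\<bar> \<partial>M) < \<epsilon> / 2"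
        using lim.IH[of i] \<open>0 < \<epsilon>\<close> by (meson half_gt_zero)
      have ii: "integrable M (\<lambda>x. \<bar>f x - s i x\<bar>)" "integrable M (\<lambda>x. \<bar>s i x - \<psi> x\<bar>)"
        using lim.hyps int[OF \<psi>(1,2)] by auto
      have "(\<integral>x. \<bar>f x - \<psi> x\<bar> \<partial>M) \<le> (\<integral>x. \<bar>f x - s i x\<bar> + \<bar>s i x - \<psi> x\<bar> \<partial>M)"
        using lim.hyps int[OF \<psi>(1,2)] ii by (intro integral_mono) auto
      also have "\<dots> < \<epsilon>" using ii i \<psi> by simp
      finally show "\<exists>\<psi>. continuous_on UNIV \<psi> \<and> (\<exists>b. \<forall>x. \<bar>\<psi> x\<bar> \<le> b) \<and> (\<integral>x. \<bar>f x - \<psi> x\<bar> \<partial>M) < \<epsilon>"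
        using \<psi> by blast
    qed
  }
qed

lemma abs_integral_diff_le:
  fixes \<phi> \<psi> :: "'a \<Rightarrow> real"
  assumes "integrable M \<phi>" "integrable M \<psi>"
  shows "\<bar>(\<integral>x. \<phi> x \<partial>M) - (\<integral>x. \<psi> x \<partial>M)\<bar> \<le> (\<integral>x. \<bar>\<phi> x - \<psi> x\<bar> \<partial>M)"
  using assms integral_abs_bound[of M "\<lambda>x. \<phi> x - \<psi> x"] by simp

text \<open>One approximant must serve both measures, so it is found in L1 of a finite measure
  dominating both. Clipping it to [-b, b] restores the bound and cannot increase the error, because
  \<phi> already takes values there.\<close>

lemma bounded_L1_approx_continuous:
  fixes \<mu> \<nu> :: "'b::euclidean_space measure" and \<phi> :: "'b \<Rightarrow> real"
  assumes fin: "finite_measure \<mu>" "finite_measure \<nu>" and sets: "sets \<mu> = sets borel" "sets \<nu> = sets borel"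
    and \<phi>[measurable]: "\<phi> \<in> borel_measurable borel" and bd: "\<And>x. \<bar>\<phi> x\<bar> \<le> b" and \<epsilon>: "0 < \<epsilon>"
  obtains \<psi> where "continuous_on UNIV \<psi>" "\<And>x. \<bar>\<psi> x\<bar> \<le> b"
    "(\<integral>x. \<bar>\<phi> x - \<psi> x\<bar> \<partial>\<mu>) < \<epsilon>" "(\<integral>x. \<bar>\<phi> x - \<psi> x\<bar> \<partial>\<nu>) < \<epsilon>"
proof -
  interpret \<mu>: finite_measure \<mu> by fact
  interpret \<nu>: finite_measure \<nu> by fact
  define P where "P = sup_measure' \<mu> \<nu>"
  have sP: "sets P = sets borel" by (simp add: P_def sets)
  have eq: "sets \<nu> = sets \<mu>" by (simp add: sets)
  have finP: "finite_measure P"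
  proof
    have "emeasure P (space P) = (SUP Y\<in>sets \<mu>. emeasure \<mu> (space P \<inter> Y) + emeasure \<nu> (space P \<inter> - Y))"
      unfolding P_def by (rule emeasure_sup_measure'[OF eq]) (metis P_def sP sets(1) sets.top)
    also have "\<dots> \<le> emeasure \<mu> (space \<mu>) + emeasure \<nu> (space \<nu>)"
      by (rule SUP_least) (rule add_mono[OF emeasure_space emeasure_space])
    also have "\<dots> < \<infinity>" by (simp add: \<mu>.emeasure_eq_measure \<nu>.emeasure_eq_measure)
    finally show "emeasure P (space P) \<noteq> \<infinity>" by simp
  qed
  interpret P: finite_measure P by fact
  have meas: "f \<in> borel_measurable M" if "f \<in> borel_measurable borel" "sets M = sets borel" for f :: "'b \<Rightarrow> real" and M
    using that measurable_cong_sets[OF that(2) refl] by blast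
  have "integrable P \<phi>"
    by (rule P.integrable_const_bound[where B = b]) (use bd meas[OF \<phi> sP] in auto)
  from integrable_L1_approx_continuous[OF finP sP this, rule_format, OF \<epsilon>]
  obtain \<psi> where \<psi>: "continuous_on UNIV \<psi>" "(\<integral>x. \<bar>\<phi> x - \<psi> x\<bar> \<partial>P) < \<epsilon>" "\<exists>b. \<forall>x. \<bar>\<psi> x\<bar> \<le> b"
    by blast
  then obtain c where c: "\<And>x. \<bar>\<psi> x\<bar> \<le> c" by blast
  define \<psi>' where "\<psi>' x = max (- b) (min b (\<psi> x))" for x
  have cont: "continuous_on UNIV \<psi>'" unfolding \<psi>'_def using \<psi>(1) by (intro continuous_intros)
  have b0: "0 \<le> b" using bd[of 0] by simp
  have bd': "\<bar>\<psi>' x\<bar> \<le> b" for x using b0 by (auto simp: \<psi>'_def)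
  have [measurable]: "\<psi> \<in> borel_measurable borel" "\<psi>' \<in> borel_measurable borel"
    using \<psi>(1) cont by (auto intro: borel_measurable_continuous_onI)
  have le: "(\<integral>x. \<bar>\<phi> x - \<psi>' x\<bar> \<partial>M) < \<epsilon>"
    if M: "finite_measure M" "sets M = sets borel" "\<And>X. X \<in> sets M \<Longrightarrow> emeasure M X \<le> emeasure P X" for M
  proof -
    interpret M: finite_measure M by fact
    have int: "integrable N (\<lambda>x. \<bar>\<phi> x - \<psi>' x\<bar>)" "integrable N (\<lambda>x. \<bar>\<phi> x - \<psi> x\<bar>)"
      if "finite_measure N" "sets N = sets borel" for N :: "'b measure"
    proof -
      interpret N: finite_measure N by fact
      have "\<bar>\<phi> x - \<psi>' x\<bar> \<le> b + b" "\<bar>\<phi> x - \<psi> x\<bar> \<le> b + c" for x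
        using bd[of x] bd'[of x] c[of x] by linarith+
      note le = this
      show "integrable N (\<lambda>x. \<bar>\<phi> x - \<psi>' x\<bar>)"
        by (rule N.integrable_const_bound[where B = "b + b"]) (rule AE_I2, use le in simp, rule meas[OF _ that(2)], measurable)
      show "integrable N (\<lambda>x. \<bar>\<phi> x - \<psi> x\<bar>)"
        by (rule N.integrable_const_bound[where B = "b + c"]) (rule AE_I2, use le in simp, rule meas[OF _ that(2)], measurable)
    qed
    have "ennreal (\<integral>x. \<bar>\<phi> x - \<psi>' x\<bar> \<partial>M) = (\<integral>\<^sup>+x. \<bar>\<phi> x - \<psi>' x\<bar> \<partial>M)"
      using int[OF M(1,2)] by (intro nn_integral_eq_integral[symmetric]) auto
    also have "\<dots> \<le> (\<integral>\<^sup>+x. \<bar>\<phi> x - \<psi>' x\<bar> \<partial>P)"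
    proof (rule nn_integral_mono_measure)
      show "M \<le> P" using M sP by (subst le_measure) auto
    qed (simp add: M sP)
    also have "\<dots> \<le> (\<integral>\<^sup>+x. \<bar>\<phi> x - \<psi> x\<bar> \<partial>P)"
    proof (intro nn_integral_mono ennreal_leI)
      show "\<bar>\<phi> x - \<psi>' x\<bar> \<le> \<bar>\<phi> x - \<psi> x\<bar>" for x
        using bd[of x] unfolding \<psi>'_def by (auto simp: max_def min_def split: if_splits)
    qed
    also have "\<dots> = ennreal (\<integral>x. \<bar>\<phi> x - \<psi> x\<bar> \<partial>P)"
      using int[OF finP sP] by (intro nn_integral_eq_integral) auto
    finally show ?thesis
      using \<psi>(2) by (simp add: ennreal_le_iff)
  qed
  show thesis
  proof (rule that[OF cont bd'])
    show "(\<integral>x. \<bar>\<phi> x - \<psi>' x\<bar> \<partial>\<mu>) < \<epsilon>"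
      by (rule le[OF fin(1) sets(1)]) (unfold P_def, rule le_emeasure_sup_measure'1[OF eq])
    show "(\<integral>x. \<bar>\<phi> x - \<psi>' x\<bar> \<partial>\<nu>) < \<epsilon>"
      by (rule le[OF fin(2) sets(2)]) (unfold P_def, rule le_emeasure_sup_measure'2[OF eq], simp add: eq)
  qed
qed

section \<open>From bounded continuous test functions to the relative entropy\<close>

lemma exp_diff_le:
  fixes s t :: real
  assumes "s \<le> b"
  shows "exp s - exp t \<le> exp b * \<bar>t - s\<bar>"
proof -
  have "exp s * (1 + (t - s)) \<le> exp s * exp (t - s)" by (intro mult_left_mono) auto
  then have "exp s - exp t \<le> exp s * (s - t)" by (simp add: exp_add[symmetric] algebra_simps)
  also have "\<dots> \<le> exp s * \<bar>t - s\<bar>" by (intro mult_left_mono) auto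
  also have "\<dots> \<le> exp b * \<bar>t - s\<bar>" using assms by (intro mult_right_mono) auto
  finally show ?thesis .
qed

text \<open>The approximants keep the bound b, and exp is Lipschitz with constant exp b below b, so
  an L1 error \<epsilon> costs \<epsilon> on the left and exp b * \<epsilon> inside the logarithm;
  then \<epsilon> tends to 0.\<close>

lemma donsker_varadhan_bounded_measurable:
  fixes \<mu> \<nu> :: "'b::euclidean_space measure" and \<phi> :: "'b \<Rightarrow> real"
  assumes \<mu>: "prob_space \<mu>" "sets \<mu> = sets borel" and \<nu>: "prob_space \<nu>" "sets \<nu> = sets borel"
    and cont: "\<And>\<psi> :: 'b \<Rightarrow> real. continuous_on UNIV \<psi> \<Longrightarrow> (\<And>x. \<bar>\<psi> x\<bar> \<le> b) \<Longrightarrow>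
      (\<integral>x. \<psi> x \<partial>\<mu>) \<le> C + ln (\<integral>x. exp (\<psi> x) \<partial>\<nu>)"
    and \<phi>[measurable]: "\<phi> \<in> borel_measurable borel" and bd: "\<And>x. \<bar>\<phi> x\<bar> \<le> b"
  shows "(\<integral>x. \<phi> x \<partial>\<mu>) \<le> C + ln (\<integral>x. exp (\<phi> x) \<partial>\<nu>)"
proof -
  interpret \<mu>: prob_space \<mu> by fact
  interpret \<nu>: prob_space \<nu> by fact
  have meas: "f \<in> borel_measurable M" if "f \<in> borel_measurable borel" "sets M = sets borel" for f :: "'b \<Rightarrow> real" and M
    using that measurable_cong_sets[OF that(2) refl] by blast
  have int\<mu>: "integrable \<mu> \<psi>" if "\<psi> \<in> borel_measurable borel" "\<And>x. \<bar>\<psi> x\<bar> \<le> b" for \<psi>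
    by (intro \<mu>.integrable_const_bound[where B = b] AE_I2 meas[OF _ \<mu>(2)]) (use that in auto)
  have int\<nu>: "integrable \<nu> \<psi>" if "\<psi> \<in> borel_measurable borel" "\<And>x. \<bar>\<psi> x\<bar> \<le> b" for \<psi>
    by (intro \<nu>.integrable_const_bound[where B = b] AE_I2 meas[OF _ \<nu>(2)]) (use that in auto)
  have inte: "integrable \<nu> (\<lambda>x. exp (\<psi> x))" if "\<psi> \<in> borel_measurable borel" "\<And>x. \<bar>\<psi> x\<bar> \<le> b" for \<psi>
  proof (intro \<nu>.integrable_const_bound[where B = "exp b"] AE_I2 meas[OF _ \<nu>(2)])
    show "norm (exp (\<psi> x)) \<le> exp b" for x using that(2)[of x] by simp
  qed (use that(1) in measurable)
  have epos: "exp (- b) \<le> (\<integral>x. exp (\<psi> x) \<partial>\<nu>)" if "\<psi> \<in> borel_measurable borel" "\<And>x. \<bar>\<psi> x\<bar> \<le> b" for \<psi>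
  proof -
    have "(\<integral>x. exp (- b) \<partial>\<nu>) \<le> (\<integral>x. exp (\<psi> x) \<partial>\<nu>)"
    proof (intro integral_mono inte that)
      show "exp (- b) \<le> exp (\<psi> x)" for x using that(2)[of x] by simp
    qed (use order_trans[OF abs_ge_zero bd[of undefined]] in simp_all)
    then show ?thesis by (simp add: \<nu>.prob_space)
  qed
  define E where "E = (\<integral>x. exp (\<phi> x) \<partial>\<nu>)"
  have E0: "0 < E" using less_le_trans[OF exp_gt_zero epos[OF \<phi> bd]] by (simp add: E_def)
  have "(\<integral>x. \<phi> x \<partial>\<mu>) \<le> C + ln (E + exp b * \<epsilon>) + \<epsilon>" if \<epsilon>: "0 < \<epsilon>" for \<epsilon>
  proof -
    obtain \<psi> where \<psi>: "continuous_on UNIV \<psi>" "\<And>x. \<bar>\<psi> x\<bar> \<le> b"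
      "(\<integral>x. \<bar>\<phi> x - \<psi> x\<bar> \<partial>\<mu>) < \<epsilon>" "(\<integral>x. \<bar>\<phi> x - \<psi> x\<bar> \<partial>\<nu>) < \<epsilon>"
      using bounded_L1_approx_continuous[OF \<mu>.finite_measure_axioms \<nu>.finite_measure_axioms \<mu>(2) \<nu>(2) \<phi> bd \<epsilon>] by blast
    have m: "\<psi> \<in> borel_measurable borel" using \<psi>(1) by (rule borel_measurable_continuous_onI)
    have "(\<integral>x. \<phi> x \<partial>\<mu>) \<le> (\<integral>x. \<psi> x \<partial>\<mu>) + \<epsilon>"
      using abs_integral_diff_le[OF int\<mu>[OF \<phi> bd] int\<mu>[OF m \<psi>(2)]] \<psi>(3) by linarith
    also have "(\<integral>x. \<psi> x \<partial>\<mu>) \<le> C + ln (\<integral>x. exp (\<psi> x) \<partial>\<nu>)" by (rule cont[OF \<psi>(1,2)])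
    also have "ln (\<integral>x. exp (\<psi> x) \<partial>\<nu>) \<le> ln (E + exp b * \<epsilon>)"
    proof -
      have "(\<integral>x. exp (\<psi> x) - exp (\<phi> x) \<partial>\<nu>) \<le> (\<integral>x. exp b * \<bar>\<phi> x - \<psi> x\<bar> \<partial>\<nu>)"
        using int\<nu>[OF \<phi> bd] int\<nu>[OF m \<psi>(2)] inte[OF \<phi> bd] inte[OF m \<psi>(2)] \<psi>(2)
        by (intro integral_mono exp_diff_le) (auto dest: abs_le_D1)
      also have "\<dots> \<le> exp b * \<epsilon>" using \<psi>(4) by simp
      finally have "(\<integral>x. exp (\<psi> x) \<partial>\<nu>) \<le> E + exp b * \<epsilon>"
        using inte[OF \<phi> bd] inte[OF m \<psi>(2)] by (simp add: E_def)
      then show ?thesis using less_le_trans[OF exp_gt_zero epos[OF m \<psi>(2)]] by simp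
    qed
    finally show ?thesis by simp
  qed
  then have "\<forall>\<^sub>F \<epsilon> in at_right 0. (\<integral>x. \<phi> x \<partial>\<mu>) \<le> C + ln (E + exp b * \<epsilon>) + \<epsilon>"
    unfolding eventually_at_right_field by (intro exI[of _ 1]) auto
  moreover have "((\<lambda>\<epsilon>. C + ln (E + exp b * \<epsilon>) + \<epsilon>) \<longlongrightarrow> C + ln (E + exp b * 0) + 0) (at_right 0)"
    using E0 by (intro tendsto_intros) auto
  ultimately have "(\<integral>x. \<phi> x \<partial>\<mu>) \<le> C + ln (E + exp b * 0) + 0"
    by (intro tendsto_lowerbound) auto
  then show ?thesis by (simp add: E_def)
qed

text \<open>For a \<nu>-null set A the test function n 1_A leaves the logarithm at 0, so n \<mu>(A)
  \<le> C for every n.\<close>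

lemma absolutely_continuous_of_donsker_varadhan:
  fixes \<mu> \<nu> :: "'b measure"
  assumes \<mu>: "prob_space \<mu>" and \<nu>: "prob_space \<nu>" and sets: "sets \<mu> = sets \<nu>"
    and dv: "\<And>\<phi> :: 'b \<Rightarrow> real. \<And>b. \<phi> \<in> borel_measurable \<nu> \<Longrightarrow> (\<And>x. \<bar>\<phi> x\<bar> \<le> b) \<Longrightarrow>
      (\<integral>x. \<phi> x \<partial>\<mu>) \<le> C + ln (\<integral>x. exp (\<phi> x) \<partial>\<nu>)"
  shows "absolutely_continuous \<nu> \<mu>"
proof -
  interpret \<mu>: prob_space \<mu> by fact
  interpret \<nu>: prob_space \<nu> by fact
  show ?thesis
    unfolding absolutely_continuous_def
  proof
    fix A assume A: "A \<in> null_sets \<nu>"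
    then have [measurable]: "A \<in> sets \<nu>" "A \<in> sets \<mu>" by (auto simp: sets)
    have "real n * measure \<mu> A \<le> C" for n :: nat
    proof -
      have "(\<integral>x. real n * indicator A x \<partial>\<mu>) \<le> C + ln (\<integral>x. exp (real n * indicator A x) \<partial>\<nu>)"
        by (rule dv[where b = "real n"]) (auto simp: indicator_def)
      also have "(\<integral>x. exp (real n * indicator A x) \<partial>\<nu>) = (\<integral>x. 1 \<partial>\<nu>)"
      proof (rule integral_cong_AE)
        show "AE x in \<nu>. exp (real n * indicator A x) = 1"
          using AE_not_in[OF A] by eventually_elim simp
      qed measurable
      finally show ?thesis by (simp add: \<nu>.prob_space sets.Int_space_eq2)
    qed
    then have "measure \<mu> A \<le> 0"
      by (metis linorder_not_le mult.commute reals_Archimedean3)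
    then show "A \<in> null_sets \<mu>"
      by (auto simp: null_sets_def \<mu>.emeasure_eq_measure measure_le_0_iff)
  qed
qed

text \<open>The optimal test function ln D is unbounded, so it is truncated to \<phi> n. Since
  \<open>KL\<close> is a difference of two integrals, the negative part is first shown to be finite;
  the positive part is then bounded by C plus the negative part, using the truncations and monotone
  convergence.\<close>

lemma KL_le_of_donsker_varadhan:
  fixes \<mu> \<nu> :: "'b measure"
  assumes \<mu>: "prob_space \<mu>" and \<nu>: "prob_space \<nu>" and sets: "sets \<mu> = sets \<nu>"
    and dv: "\<And>\<phi> :: 'b \<Rightarrow> real. \<And>b. \<phi> \<in> borel_measurable \<nu> \<Longrightarrow> (\<And>x. \<bar>\<phi> x\<bar> \<le> b) \<Longrightarrow>
      (\<integral>x. \<phi> x \<partial>\<mu>) \<le> C + ln (\<integral>x. exp (\<phi> x) \<partial>\<nu>)"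
  shows "KL \<mu> \<nu> \<le> ereal C"
proof -
  interpret \<mu>: prob_space \<mu> by fact
  interpret \<nu>: prob_space \<nu> by fact
  have ac: "absolutely_continuous \<nu> \<mu>"
    using \<mu> \<nu> sets dv by (rule absolutely_continuous_of_donsker_varadhan)
  define D where "D x = enn2real (RN_deriv \<nu> \<mu> x)" for x
  have D0: "0 \<le> D x" for x by (simp add: D_def)
  have [measurable]: "D \<in> borel_measurable \<nu>" unfolding D_def by measurable
  have [measurable]: "D \<in> borel_measurable \<mu>" unfolding measurable_cong_sets[OF sets refl] by measurable
  have "density \<nu> (\<lambda>x. ennreal (D x)) = density \<nu> (RN_deriv \<nu> \<mu>)"
  proof (rule density_cong)
    show "AE x in \<nu>. ennreal (D x) = RN_deriv \<nu> \<mu> x"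
      using \<nu>.RN_deriv_finite[OF \<mu>.sigma_finite_measure_axioms ac sets]
      by eventually_elim (simp add: D_def less_top)
  qed measurable
  then have \<mu>D: "density \<nu> (\<lambda>x. ennreal (D x)) = \<mu>"
    using \<nu>.density_RN_deriv[OF ac sets] by simp
  have nnD: "(\<integral>\<^sup>+x. f x \<partial>\<mu>) = (\<integral>\<^sup>+x. ennreal (D x) * f x \<partial>\<nu>)" if "f \<in> borel_measurable \<nu>" for f
    using that by (subst \<mu>D[symmetric]) (rule nn_integral_density, measurable)
  have "AE x in density \<nu> (\<lambda>x. ennreal (D x)). 0 < D x"
    by (subst AE_density) auto
  then have Dpos: "AE x in \<mu>. 0 < D x" by (simp only: \<mu>D)
  have "(\<integral>\<^sup>+x. ennreal (D x) \<partial>\<nu>) = 1"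
    using nnD[of "\<lambda>_. 1"] by (simp add: \<mu>.emeasure_space_1)
  then have iD: "integrable \<nu> D" "(\<integral>x. D x \<partial>\<nu>) = 1"
    using D0 by (auto intro!: integrableI_nonneg simp: integral_eq_nn_integral)
  \<comment> \<open>The value -n where D vanishes is what makes exp (\<phi> n) \<le> D + exp (-n)
    hold everywhere; ln 0 = 0 would not do.\<close>
  define \<phi> where "\<phi> n x = (if 0 < D x then max (- real n) (min (real n) (ln (D x))) else - real n)" for n :: nat and x
  define p where "p n x = (if 0 < D x then max 0 (min (real n) (ln (D x))) else 0)" for n :: nat and x
  have [measurable]: "\<phi> n \<in> borel_measurable \<nu>" "p n \<in> borel_measurable \<nu>" for n
    unfolding \<phi>_def p_def by measurable
  have [measurable]: "\<phi> n \<in> borel_measurable \<mu>" "p n \<in> borel_measurable \<mu>" for n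
    unfolding measurable_cong_sets[OF sets refl] by measurable
  have \<phi>b: "\<bar>\<phi> n x\<bar> \<le> real n" for n x by (auto simp: \<phi>_def)
  have pb: "0 \<le> p n x \<and> p n x \<le> real n" for n x by (auto simp: p_def)
  have \<phi>int: "(\<integral>x. \<phi> n x \<partial>\<mu>) \<le> C + exp (- real n)" for n
  proof -
    have ie: "integrable \<nu> (\<lambda>x. exp (\<phi> n x))"
    proof (rule \<nu>.integrable_const_bound[where B = "exp (real n)"])
      show "AE x in \<nu>. norm (exp (\<phi> n x)) \<le> exp (real n)"
        using abs_le_D1[OF \<phi>b] by (intro AE_I2) simp
    qed measurable
    have "(\<integral>x. exp (\<phi> n x) \<partial>\<nu>) \<le> (\<integral>x. D x + exp (- real n) \<partial>\<nu>)"
    proof (rule integral_mono[OF ie])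
      show "exp (\<phi> n x) \<le> D x + exp (- real n)" for x
      proof (cases "0 < D x")
        case True
        have "exp (\<phi> n x) \<le> exp (max (- real n) (ln (D x)))"
          using True by (auto simp: \<phi>_def)
        also have "\<dots> = max (exp (- real n)) (D x)" using True by (auto simp: max_def) (smt (verit) exp_ln exp_le_cancel_iff)+
        also have "\<dots> \<le> D x + exp (- real n)" using True by simp
        finally show ?thesis .
      qed (use D0 in \<open>simp add: \<phi>_def\<close>)
    qed (use iD in auto)
    also have "\<dots> = 1 + exp (- real n)" using iD by (simp add: \<nu>.prob_space)
    finally have le: "(\<integral>x. exp (\<phi> n x) \<partial>\<nu>) \<le> 1 + exp (- real n)" .
    have pos: "0 < (\<integral>x. exp (\<phi> n x) \<partial>\<nu>)"
    proof -
      have "(\<integral>x. exp (- real n) \<partial>\<nu>) \<le> (\<integral>x. exp (\<phi> n x) \<partial>\<nu>)"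
      proof (rule integral_mono[OF _ ie])
        show "exp (- real n) \<le> exp (\<phi> n x)" for x using \<phi>b[of n x] by simp
      qed simp
      then show ?thesis using less_le_trans[OF exp_gt_zero[of "- real n"]] by (simp add: \<nu>.prob_space)
    qed
    have "(\<integral>x. \<phi> n x \<partial>\<mu>) \<le> C + ln (\<integral>x. exp (\<phi> n x) \<partial>\<nu>)"
      by (rule dv[OF _ \<phi>b]) measurable
    also have "ln (\<integral>x. exp (\<phi> n x) \<partial>\<nu>) \<le> ln (1 + exp (- real n))"
      using pos le by simp
    also have "ln (1 + exp (- real n)) \<le> exp (- real n)" by (rule ln_add_one_self_le_self) simp
    finally show ?thesis by simp
  qed
  define bn where "bn = (\<integral>\<^sup>+x. ennreal (- ln (D x)) \<partial>\<mu>)"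
  have "bn \<le> 1"
  proof -
    have "bn = (\<integral>\<^sup>+x. ennreal (D x) * ennreal (- ln (D x)) \<partial>\<nu>)"
      unfolding bn_def by (rule nnD) measurable
    also have "\<dots> \<le> (\<integral>\<^sup>+x. 1 \<partial>\<nu>)"
    proof (rule nn_integral_mono)
      show "ennreal (D x) * ennreal (- ln (D x)) \<le> 1" for x
      proof (cases "0 < D x")
        case True
        have "D x * (- ln (D x)) \<le> 1"
        proof -
          \<comment> \<open>Integrating against \<mu> = D \<nu> brings in the factor D, and -t ln t
            \<le> 1 - t is bounded although -ln t is not.\<close>
          have "- ln (D x) \<le> 1 / D x - 1"
            using ln_le_minus_one[of "1 / D x"] True by (simp add: ln_div)
          from mult_left_mono[OF this D0[of x]] True show ?thesis by (simp add: algebra_simps)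
        qed
        then show ?thesis
          using D0 by (simp add: ennreal_mult'[symmetric] ennreal_le_1)
      qed (use D0[of x] in \<open>simp add: not_less\<close>)
    qed
    finally show ?thesis by (simp add: \<nu>.emeasure_space_1)
  qed
  then obtain B where B: "bn = ennreal B" "0 \<le> B"
    by (cases bn) (auto simp: top_unique)
  have pint: "(\<integral>x. p n x \<partial>\<mu>) \<le> C + exp (- real n) + B" for n
  proof -
    have ip: "integrable \<mu> (p n)" "integrable \<mu> (\<phi> n)"
      by (rule \<mu>.integrable_const_bound[where B = "real n"]; use \<phi>b pb in auto)+
    have "ennreal (\<integral>x. p n x - \<phi> n x \<partial>\<mu>) = (\<integral>\<^sup>+x. ennreal (p n x - \<phi> n x) \<partial>\<mu>)"
    proof (intro nn_integral_eq_integral[symmetric] AE_I2)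
      show "integrable \<mu> (\<lambda>x. p n x - \<phi> n x)" using ip by simp
    qed (auto simp: p_def \<phi>_def)
    also have "\<dots> \<le> bn"
      unfolding bn_def
    proof (rule nn_integral_mono_AE, use Dpos in eventually_elim)
      case (elim x)
      show "ennreal (p n x - \<phi> n x) \<le> ennreal (- ln (D x))"
      proof (cases "0 \<le> ln (D x)")
        case True
        then have "0 \<le> min (real n) (ln (D x))" "- real n \<le> min (real n) (ln (D x))" by auto
        then have "p n x = \<phi> n x" using elim by (simp only: p_def \<phi>_def max_absorb2 if_True)
        then show ?thesis by simp
      next
        case False
        then show ?thesis using elim by (intro ennreal_leI) (simp only: p_def \<phi>_def max_def min_def, simp)
      qed
    qed
    finally have "(\<integral>x. p n x - \<phi> n x \<partial>\<mu>) \<le> B" using B by (simp add: ennreal_le_iff)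
    then show ?thesis using ip \<phi>int[of n] by simp
  qed
  define A where "A = (\<integral>\<^sup>+x. ennreal (ln (D x)) \<partial>\<mu>)"
  have mono: "p n x \<le> p m x" if "n \<le> m" for n m x
    using that by (auto simp: p_def)
  \<comment> \<open>The error exp (-n) is removed by comparing p n with p m for larger m and letting
    m tend to infinity.\<close>
  have pint': "(\<integral>x. p n x \<partial>\<mu>) \<le> C + B" for n
  proof -
    have "(\<integral>x. p n x \<partial>\<mu>) \<le> C + exp (- real m) + B" if "n \<le> m" for m
    proof -
      have "(\<integral>x. p n x \<partial>\<mu>) \<le> (\<integral>x. p m x \<partial>\<mu>)"
        by (intro integral_mono mono that; rule \<mu>.integrable_const_bound[where B = "real m"];
            use pb order_trans[OF conjunct2[OF pb[of n]], of "real m"] that in auto)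
      then show ?thesis using pint[of m] by linarith
    qed
    then have "\<forall>\<^sub>F m in sequentially. (\<integral>x. p n x \<partial>\<mu>) \<le> C + exp (- real m) + B"
      by (auto simp: eventually_sequentially)
    moreover have "(\<lambda>m. C + exp (- real m) + B) \<longlonglongrightarrow> C + 0 + B"
      by (intro tendsto_intros filterlim_compose[OF exp_at_bot] filterlim_uminus_at_bot[THEN iffD2]) (auto simp: filterlim_real_sequentially)
    ultimately show ?thesis using tendsto_lowerbound[of _ "C + 0 + B" sequentially] by auto
  qed
  have CB: "0 \<le> C + B"
    using order_trans[OF Bochner_Integration.integral_nonneg pint'[of 0]] pb by blast
  have "A \<le> ennreal (C + B)"
  proof -
    have "A = (\<integral>\<^sup>+x. (SUP n. ennreal (p n x)) \<partial>\<mu>)"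
      unfolding A_def
    proof (rule nn_integral_cong_AE, use Dpos in eventually_elim)
      case (elim x)
      show "ennreal (ln (D x)) = (SUP n. ennreal (p n x))"
      proof (rule antisym)
        obtain n where "ln (D x) \<le> real n" using real_arch_simple by blast
        then have "ennreal (ln (D x)) \<le> ennreal (p n x)"
          using elim by (intro ennreal_leI) (auto simp: p_def)
        then show "ennreal (ln (D x)) \<le> (SUP n. ennreal (p n x))" by (rule SUP_upper2[OF UNIV_I])
        show "(SUP n. ennreal (p n x)) \<le> ennreal (ln (D x))"
        proof (rule SUP_least)
          fix n
          have "p n x \<le> max 0 (ln (D x))" using elim by (auto simp: p_def)
          then have "ennreal (p n x) \<le> ennreal (max 0 (ln (D x)))" by (rule ennreal_leI)
          then show "ennreal (p n x) \<le> ennreal (ln (D x))" by simp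
        qed
      qed
    qed
    also have "\<dots> = (SUP n. \<integral>\<^sup>+x. ennreal (p n x) \<partial>\<mu>)"
      by (rule nn_integral_monotone_convergence_SUP) (auto simp: incseq_def le_fun_def intro!: ennreal_leI mono)
    also have "\<dots> \<le> ennreal (C + B)"
    proof (rule SUP_least)
      fix n
      have "(\<integral>\<^sup>+x. ennreal (p n x) \<partial>\<mu>) = ennreal (\<integral>x. p n x \<partial>\<mu>)"
        using pb by (intro nn_integral_eq_integral \<mu>.integrable_const_bound[where B = "real n"] AE_I2) auto
      then show "(\<integral>\<^sup>+x. ennreal (p n x) \<partial>\<mu>) \<le> ennreal (C + B)"
        using pint'[of n] by (simp add: ennreal_leI)
    qed
    finally show ?thesis .
  qed
  then have "enn2ereal A \<le> ereal (C + B)"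
    using CB by (metis enn2ereal_ennreal less_eq_ennreal.rep_eq)
  moreover have "enn2ereal bn = ereal B" using B by (simp add: enn2ereal_ennreal)
  ultimately have "enn2ereal A - enn2ereal bn \<le> ereal C"
    by (simp add: ereal_minus_le_iff add.commute)
  then show ?thesis
    using ac by (simp add: KL_def A_def bn_def D_def[abs_def] Let_def)
qed

section \<open>The Hamiltonian flow\<close>

lemma has_vector_derivative_reflect:
  assumes "(Y has_vector_derivative d) (at (- t))"
  shows "((\<lambda>t. Y (- t)) has_vector_derivative - d) (at t)"
proof -
  have "((\<lambda>t::real. - t) has_vector_derivative - 1) (at t)"
    by (auto intro!: derivative_eq_intros)
  from vector_diff_chain_at[OF this assms] show ?thesis by (simp add: comp_def)
qed

text \<open>Integration gains a factor 1 / \<kappa> in the exponentially weighted norm; this is the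
  source of the contraction in the existence proof. Negative times follow by reflection.\<close>

lemma norm_le_of_vector_derivative_exp:
  fixes Y :: "real \<Rightarrow> 'b::real_normed_vector"
  assumes Y: "Y 0 = 0" "\<And>t. (Y has_vector_derivative f t) (at t)"
    and f: "\<And>t. norm (f t) \<le> c * exp (\<kappa> * \<bar>t\<bar>)" and \<kappa>: "0 < \<kappa>" and c: "0 \<le> c"
  shows "norm (Y t) \<le> c / \<kappa> * exp (\<kappa> * \<bar>t\<bar>)"
proof -
  have *: "norm (Y t) \<le> c / \<kappa> * exp (\<kappa> * t)"
    if Y: "Y 0 = 0" "\<And>t. (Y has_vector_derivative f t) (at t)"
      and f: "\<And>t. norm (f t) \<le> c * exp (\<kappa> * \<bar>t\<bar>)" and t: "0 \<le> t"
    for Y f :: "real \<Rightarrow> 'b" and t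
  proof (cases "t = 0")
    case False
    have "norm (Y t - Y 0) \<le> c / \<kappa> * exp (\<kappa> * t) - c / \<kappa> * exp (\<kappa> * 0)"
    proof (rule differentiable_bound_general[where f' = f and \<phi> = "\<lambda>s. c / \<kappa> * exp (\<kappa> * s)" and \<phi>' = "\<lambda>s. c * exp (\<kappa> * s)"])
      show "continuous_on {0..t} Y"
        using Y(2) by (intro continuous_at_imp_continuous_on ballI) (rule has_vector_derivative_continuous)
      show "((\<lambda>s. c / \<kappa> * exp (\<kappa> * s)) has_vector_derivative c * exp (\<kappa> * s)) (at s)" for s
        unfolding has_real_derivative_iff_has_vector_derivative[symmetric]
        using \<kappa> by (auto intro!: derivative_eq_intros)
      show "norm (f s) \<le> c * exp (\<kappa> * s)" if "0 < s" for s
        using f[of s] that by simp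
    qed (use False t \<kappa> Y(2) in \<open>auto intro!: continuous_intros\<close>)
    then show ?thesis using Y(1) divide_nonneg_pos[OF c \<kappa>] by simp
  qed (use Y c \<kappa> in simp)
  show ?thesis
  proof (cases "0 \<le> t")
    case False
    have "norm ((\<lambda>t. Y (- t)) (- t)) \<le> c / \<kappa> * exp (\<kappa> * - t)"
    proof (rule *[where f = "\<lambda>t. - f (- t)"])
      show "((\<lambda>t. Y (- t)) has_vector_derivative - f (- t)) (at t)" for t
        by (rule has_vector_derivative_reflect) (rule Y(2))
      show "norm (- f (- t)) \<le> c * exp (\<kappa> * \<bar>t\<bar>)" for t using f[of "- t"] by simp
    qed (use Y(1) False in auto)
    then show ?thesis using False by simp
  qed (use *[OF Y f] in simp)
qed

lemma exists_antiderivative: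
  fixes f :: "real \<Rightarrow> 'b::euclidean_space"
  assumes "continuous_on UNIV f"
  obtains Y where "Y 0 = 0" "\<And>t. (Y has_vector_derivative f t) (at t)"
proof -
  have "\<exists>F. \<forall>x::real. -\<infinity> < ereal x \<longrightarrow> ereal x < \<infinity> \<longrightarrow> (F has_vector_derivative f x) (at x)"
    by (rule einterval_antiderivative) (use assms in \<open>auto simp: continuous_on_eq_continuous_at\<close>)
  then obtain F where F: "\<And>x. (F has_vector_derivative f x) (at x)" by auto
  show thesis
  proof (rule that)
    show "((\<lambda>t. F t - F 0) has_vector_derivative f t) (at t)" for t
      using has_vector_derivative_diff[OF F[of t] has_vector_derivative_const[of "F 0"]] by simp
  qed simp
qed

text \<open>Contraction in the norm \<open>sup\<^sub>t exp (- \<kappa> |t|) |y(t)|\<close> with \<open>\<kappa> = 2 K + 1\<close> gives a solution on all of the line at once.\<close>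

lemma ode_global_existence:
  fixes F :: "'b::euclidean_space \<Rightarrow> 'b"
  assumes lip: "\<And>y z. norm (F y - F z) \<le> K * norm (y - z)" and K: "0 \<le> K"
  obtains y where "y 0 = y0" "\<And>t. (y has_vector_derivative F (y t)) (at t)"
proof -
  define \<kappa> where "\<kappa> = 2 * K + 1"
  have \<kappa>: "0 < \<kappa>" "K / \<kappa> \<le> 1 / 2" using K by (auto simp: \<kappa>_def field_simps)
  have contF: "continuous_on UNIV F"
  proof (rule lipschitz_on_continuous_on)
    show "K-lipschitz_on UNIV F" using lip K by (intro lipschitz_onI) (auto simp: dist_norm)
  qed
  \<comment> \<open>The bounded function g represents a curve multiplied by exp (-\<kappa> |s|);
    undoing the weight gives the field along the curve itself.\<close>
  define w where "w g s = F (exp (\<kappa> * \<bar>s\<bar>) *\<^sub>R apply_bcontfun g s)" for g :: "real \<Rightarrow>\<^sub>C 'b" and s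
  have contw: "continuous_on UNIV (w g)" for g
    unfolding w_def by (rule continuous_on_compose2[OF contF]) (auto intro!: continuous_intros)
  have "\<exists>Y. Y 0 = 0 \<and> (\<forall>t. (Y has_vector_derivative w g t) (at t))" for g
    by (rule exists_antiderivative[OF contw[of g]]) blast
  then obtain Y where Y: "\<And>g. Y g 0 = 0" "\<And>g t. (Y g has_vector_derivative w g t) (at t)"
    by metis
  have contY: "continuous_on UNIV (Y g)" for g
    using Y(2) by (intro continuous_at_imp_continuous_on ballI) (rule has_vector_derivative_continuous)
  have wdiff: "norm (w g t - w g' t) \<le> (K * dist g g') * exp (\<kappa> * \<bar>t\<bar>)" for g g' t
  proof -
    have "norm (w g t - w g' t) \<le> K * norm (exp (\<kappa> * \<bar>t\<bar>) *\<^sub>R (apply_bcontfun g t - apply_bcontfun g' t))"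
      unfolding w_def scaleR_diff_right by (rule lip)
    also have "\<dots> = K * dist (g t) (g' t) * exp (\<kappa> * \<bar>t\<bar>)" by (simp add: dist_norm)
    also have "\<dots> \<le> (K * dist g g') * exp (\<kappa> * \<bar>t\<bar>)"
      using K by (intro mult_right_mono mult_left_mono dist_bounded) auto
    finally show ?thesis .
  qed
  have wbound: "norm (w g t) \<le> (norm (F 0) + K * norm g) * exp (\<kappa> * \<bar>t\<bar>)" for g t
  proof -
    have "norm (w g t) \<le> norm (w 0 t) + norm (w g t - w 0 t)" by (rule norm_triangle_sub)
    also have "\<dots> \<le> norm (F 0) * exp (\<kappa> * \<bar>t\<bar>) + (K * norm g) * exp (\<kappa> * \<bar>t\<bar>)"
    proof (rule add_mono)
      have "norm (F 0) * 1 \<le> norm (F 0) * exp (\<kappa> * \<bar>t\<bar>)" using \<kappa> by (intro mult_left_mono) auto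
      then show "norm (w 0 t) \<le> norm (F 0) * exp (\<kappa> * \<bar>t\<bar>)" by (simp add: w_def)
      show "norm (w g t - w 0 t) \<le> (K * norm g) * exp (\<kappa> * \<bar>t\<bar>)"
        using wdiff[of g t 0] by (simp add: dist_norm)
    qed
    finally show ?thesis by (simp add: algebra_simps)
  qed
  define P where "P g t = exp (- \<kappa> * \<bar>t\<bar>) *\<^sub>R (y0 + Y g t)" for g t
  have ex: "exp (- \<kappa> * \<bar>t\<bar>) * exp (\<kappa> * \<bar>t\<bar>) = 1" for t by (simp add: exp_add[symmetric])
  have Pb: "P g \<in> bcontfun" for g
  proof (rule bcontfun_normI)
    show "continuous_on UNIV (P g)"
      unfolding P_def by (intro continuous_intros contY)
    let ?c = "norm (F 0) + K * norm g"
    show "norm (P g t) \<le> norm y0 + ?c / \<kappa>" for t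
    proof -
      have "norm (Y g t) \<le> ?c / \<kappa> * exp (\<kappa> * \<bar>t\<bar>)"
        by (rule norm_le_of_vector_derivative_exp[OF Y wbound \<kappa>(1)]) (use K in auto)
      then have "norm (y0 + Y g t) \<le> norm y0 * exp (\<kappa> * \<bar>t\<bar>) + ?c / \<kappa> * exp (\<kappa> * \<bar>t\<bar>)"
        using mult_left_mono[of 1 "exp (\<kappa> * \<bar>t\<bar>)" "norm y0"] \<kappa> by (intro norm_triangle_le add_mono) auto
      from mult_left_mono[OF this, of "exp (- \<kappa> * \<bar>t\<bar>)"]
      have "norm (P g t) \<le> exp (- \<kappa> * \<bar>t\<bar>) * exp (\<kappa> * \<bar>t\<bar>) * (norm y0 + ?c / \<kappa>)"
        unfolding P_def by (simp only: norm_scaleR abs_exp_cancel distrib_left mult_ac) simp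
      then show ?thesis unfolding ex by simp
    qed
  qed
  define \<Psi> where "\<Psi> g = Bcontfun (P g)" for g
  have \<Psi>: "apply_bcontfun (\<Psi> g) = P g" for g unfolding \<Psi>_def using Pb by (rule Bcontfun_inverse)
  have "dist (\<Psi> g) (\<Psi> g') \<le> 1 / 2 * dist g g'" for g g'
  proof (rule dist_bound)
    fix t
    have "norm (Y g t - Y g' t) \<le> (K * dist g g') / \<kappa> * exp (\<kappa> * \<bar>t\<bar>)"
      by (rule norm_le_of_vector_derivative_exp[of "\<lambda>t. Y g t - Y g' t" "\<lambda>t. w g t - w g' t"])
        (use K \<kappa> Y(1) in \<open>auto intro!: has_vector_derivative_diff Y(2) wdiff\<close>)
    from mult_left_mono[OF this, of "exp (- \<kappa> * \<bar>t\<bar>)"]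
    have "exp (- \<kappa> * \<bar>t\<bar>) * norm (Y g t - Y g' t) \<le> (exp (- \<kappa> * \<bar>t\<bar>) * exp (\<kappa> * \<bar>t\<bar>)) * (K / \<kappa> * dist g g')"
      by (simp add: mult_ac)
    also have "\<dots> \<le> 1 / 2 * dist g g'"
      unfolding ex using mult_right_mono[OF \<kappa>(2), of "dist g g'"] by simp
    also have "exp (- \<kappa> * \<bar>t\<bar>) * norm (Y g t - Y g' t) = dist (\<Psi> g t) (\<Psi> g' t)"
      by (simp add: \<Psi> P_def dist_norm scaleR_diff_right[symmetric])
    finally show "dist (\<Psi> g t) (\<Psi> g' t) \<le> 1 / 2 * dist g g'" .
  qed
  then obtain g where g: "\<Psi> g = g"
    using banach_fix_type[of "1 / 2" \<Psi>] by auto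
  define y where "y t = y0 + Y g t" for t
  have "exp (\<kappa> * \<bar>t\<bar>) *\<^sub>R apply_bcontfun g t = y t" for t
  proof -
    have "exp (\<kappa> * \<bar>t\<bar>) *\<^sub>R apply_bcontfun g t = exp (\<kappa> * \<bar>t\<bar>) *\<^sub>R P g t" using \<Psi>[of g] g by simp
    also have "\<dots> = y t" unfolding P_def y_def scaleR_scaleR using ex[of t] by (simp add: mult.commute)
    finally show ?thesis .
  qed
  then have "w g t = F (y t)" for t by (simp add: w_def)
  then have "(y has_vector_derivative F (y t)) (at t)" for t
    unfolding y_def[abs_def] using has_vector_derivative_add[OF has_vector_derivative_const Y(2), of y0 g t] by (simp add: y_def)
  moreover have "y 0 = y0" by (simp add: y_def Y)
  ultimately show thesis using that by blast
qed

text \<open>Gronwall: exp (-2 K t) |y - z|^2 is nonincreasing for t \<ge> 0. Negative times follow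
  by reflection, which replaces F by -F. Uniqueness on the whole line is what identifies the
  description by \<open>THE\<close> in \<open>ham_flow_pos\<close>.\<close>

lemma ode_unique:
  fixes F :: "'b::euclidean_space \<Rightarrow> 'b"
  assumes lip: "\<And>y z. norm (F y - F z) \<le> K * norm (y - z)"
    and y: "\<And>t. (y has_vector_derivative F (y t)) (at t)"
    and z: "\<And>t. (z has_vector_derivative F (z t)) (at t)" and 0: "y 0 = z 0"
  shows "y = z"
proof -
  have *: "y t = z t"
    if lip: "\<And>y z. norm (F y - F z) \<le> K * norm (y - z)"
      and y: "\<And>t. (y has_vector_derivative F (y t)) (at t)"
      and z: "\<And>t. (z has_vector_derivative F (z t)) (at t)" and 0: "y 0 = z 0" and t: "0 \<le> t"
    for y z :: "real \<Rightarrow> 'b" and F t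
  proof -
    define E where "E t = exp (- (2 * K * t)) * ((y t - z t) \<bullet> (y t - z t))" for t
    have "E t \<le> E 0"
    proof (rule DERIV_nonpos_imp_nonincreasing[where f = E, OF t])
      fix s
      let ?d = "y s - z s"
      have eq: "(\<lambda>u. d \<bullet> (u *\<^sub>R w) + (u *\<^sub>R w) \<bullet> d) = (*) (2 * (d \<bullet> w))" for d w :: 'b
        by (simp add: fun_eq_iff inner_commute)
      have "((\<lambda>t. (y t - z t) \<bullet> (y t - z t)) has_derivative (\<lambda>u. ?d \<bullet> (u *\<^sub>R (F (y s) - F (z s))) + (u *\<^sub>R (F (y s) - F (z s))) \<bullet> ?d)) (at s)"
        using has_vector_derivative_diff[OF y z, of s] unfolding has_vector_derivative_def by (intro has_derivative_inner)
      then have "((\<lambda>t. (y t - z t) \<bullet> (y t - z t)) has_real_derivative 2 * (?d \<bullet> (F (y s) - F (z s)))) (at s)"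
        unfolding has_field_derivative_def eq .
      moreover have "((\<lambda>t. exp (- (2 * K * t))) has_real_derivative exp (- (2 * K * s)) * (- (2 * K))) (at s)"
        by (auto intro!: derivative_eq_intros)
      ultimately have "(E has_real_derivative exp (- (2 * K * s)) * (- (2 * K)) * (?d \<bullet> ?d)
          + 2 * (?d \<bullet> (F (y s) - F (z s))) * exp (- (2 * K * s))) (at s)"
        unfolding E_def[abs_def] by (intro DERIV_mult)
      moreover have "?d \<bullet> (F (y s) - F (z s)) \<le> K * (?d \<bullet> ?d)"
      proof -
        have "?d \<bullet> (F (y s) - F (z s)) \<le> norm ?d * norm (F (y s) - F (z s))" by (rule norm_cauchy_schwarz)
        also have "\<dots> \<le> norm ?d * (K * norm ?d)" by (intro mult_left_mono lip) auto
        finally show ?thesis by (simp add: dot_square_norm power2_eq_square mult_ac)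
      qed
      then have "exp (- (2 * K * s)) * (2 * (?d \<bullet> (F (y s) - F (z s)))) \<le> exp (- (2 * K * s)) * (2 * (K * (?d \<bullet> ?d)))"
        by (intro mult_left_mono) auto
      ultimately show "\<exists>y. (E has_real_derivative y) (at s) \<and> y \<le> 0"
        by (intro exI conjI) (assumption, simp add: mult_ac)
    qed
    then have "exp (- (2 * K * t)) * ((y t - z t) \<bullet> (y t - z t)) \<le> 0" by (simp add: E_def 0)
    then have "(y t - z t) \<bullet> (y t - z t) \<le> 0" by (simp add: mult_le_0_iff)
    then show ?thesis by (metis eq_iff_diff_eq_0 inner_eq_zero_iff inner_ge_zero order_antisym)
  qed
  show ?thesis
  proof
    fix t
    show "y t = z t"
    proof (cases "0 \<le> t")
      case False
      have "(\<lambda>t. y (- t)) (- t) = (\<lambda>t. z (- t)) (- t)"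
      proof (rule *[where F = "\<lambda>y. - F y" and y = "\<lambda>t. y (- t)" and z = "\<lambda>t. z (- t)" and t = "- t"])
        show "norm (- F y - - F z) \<le> K * norm (y - z)" for y z
          using lip[of y z] by (simp add: norm_minus_commute)
      qed (use 0 False in \<open>auto intro!: has_vector_derivative_reflect y z\<close>)
      then show ?thesis by simp
    qed (rule *[OF lip y z 0])
  qed
qed

section \<open>Convergence of the Verlet scheme to the flow\<close>

lemma perturbed_recursion_bound:
  fixes e :: "nat \<Rightarrow> real"
  assumes "e 0 = 0" and step: "\<And>j. j < N \<Longrightarrow> e (Suc j) \<le> (1 + c) * e j + r" and c: "0 \<le> c" and r: "0 \<le> r"
  shows "j \<le> N \<Longrightarrow> e j \<le> real j * r * exp (c * real j)"
proof (induction j)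
  case (Suc j)
  have "e (Suc j) \<le> (1 + c) * (real j * r * exp (c * real j)) + r"
  proof -
    have "e j \<le> real j * r * exp (c * real j)" using Suc by simp
    from mult_left_mono[OF this, of "1 + c"] step[of j] Suc.prems c show ?thesis by linarith
  qed
  also have "\<dots> \<le> exp c * (real j * r * exp (c * real j)) + r * exp (c * real (Suc j))"
  proof (rule add_mono)
    show "(1 + c) * (real j * r * exp (c * real j)) \<le> exp c * (real j * r * exp (c * real j))"
      using r by (intro mult_right_mono exp_ge_add_one_self) auto
    show "r \<le> r * exp (c * real (Suc j))"
      using mult_left_mono[of 1 "exp (c * real (Suc j))" r] r c by simp
  qed
  also have "\<dots> = real (Suc j) * r * exp (c * real (Suc j))"
    by (simp add: exp_add algebra_simps)
  finally show ?case .
qed (use assms in simp)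

lemma norm_fst_diff_le: "norm (fst z - fst w) \<le> norm (z - w)"
  by (metis fst_diff norm_fst_le prod.collapse)

lemma norm_snd_diff_le: "norm (snd z - snd w) \<le> norm (z - w)"
  by (metis snd_diff norm_snd_le prod.collapse)

context smooth_field
begin

definition ham :: "'a \<times> 'a \<Rightarrow> 'a \<times> 'a" where
  "ham z = (snd z, - G (fst z))"

lemma ham_lipschitz: "norm (ham z - ham w) \<le> (1 + L) * norm (z - w)"
proof -
  have "norm (ham z - ham w) \<le> norm (snd z - snd w) + norm (G (fst z) - G (fst w))"
    unfolding ham_def using norm_Pair_le[of "snd z - snd w" "G (fst w) - G (fst z)"] by (simp add: norm_minus_commute)
  also have "norm (snd z - snd w) \<le> norm (z - w)" by (rule norm_snd_diff_le)
  also have "norm (G (fst z) - G (fst w)) \<le> L * norm (z - w)"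
    by (rule order_trans[OF lipschitz mult_left_mono[OF norm_fst_diff_le L_nonneg]])
  finally show ?thesis by (simp add: algebra_simps)
qed

text \<open>An Euler step minus a correction of second order in h. Stability and consistency are
  both read off from this form; first-order convergence is all that is wanted.\<close>

lemma verlet_step_eq:
  "verlet_step G h z = z + h *\<^sub>R ham z - (h / 2) *\<^sub>R (h *\<^sub>R G (fst z), G (fst (verlet_step G h z)) - G (fst z))"
  by (cases z) (simp add: verlet_step_def ham_def Let_def power2_eq_square algebra_simps flip: scaleR_add_left)

lemma fst_verlet_step: "fst (verlet_step G h z) = fst z + h *\<^sub>R snd z - (h\<^sup>2 / 2) *\<^sub>R G (fst z)"
  by (cases z) (simp add: verlet_step_def Let_def)

lemma verlet_step_lipschitz:
  assumes h: "0 \<le> h" "h \<le> T"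
  shows "norm (verlet_step G h z - verlet_step G h w) \<le> (1 + (1 + L + (T * L + L * (2 + T + T\<^sup>2 * L)) / 2) * h) * norm (z - w)"
proof -
  define d where "d = norm (z - w)"
  have d: "norm (fst z - fst w) \<le> d" "norm (snd z - snd w) \<le> d"
    by (simp_all add: d_def norm_fst_diff_le norm_snd_diff_le)
  have d0: "0 \<le> d" by (simp add: d_def)
  define a where "a = G (fst z) - G (fst w)"
  define a' where "a' = G (fst (verlet_step G h z)) - G (fst (verlet_step G h w))"
  have a: "norm a \<le> L * d"
    unfolding a_def by (rule order_trans[OF lipschitz mult_left_mono[OF d(1) L_nonneg]])
  have "norm (fst (verlet_step G h z) - fst (verlet_step G h w)) \<le> (1 + T + T\<^sup>2 * L) * d"
  proof -
    have "fst (verlet_step G h z) - fst (verlet_step G h w) = (fst z - fst w) + h *\<^sub>R (snd z - snd w) - (h\<^sup>2 / 2) *\<^sub>R a"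
      by (simp add: fst_verlet_step a_def algebra_simps)
    also have "norm \<dots> \<le> norm (fst z - fst w) + norm (h *\<^sub>R (snd z - snd w)) + norm ((h\<^sup>2 / 2) *\<^sub>R a)"
      by (intro order_trans[OF norm_triangle_ineq4] add_right_mono norm_triangle_ineq)
    also have "\<dots> \<le> d + T * d + T\<^sup>2 * (L * d)"
    proof (intro add_mono d(1))
      show "norm (h *\<^sub>R (snd z - snd w)) \<le> T * d" using h d(2) d0 by (simp add: mult_mono)
      have "h\<^sup>2 / 2 \<le> T\<^sup>2" using power_mono[OF h(2,1), of 2] zero_le_power2[of T] by linarith
      then show "norm ((h\<^sup>2 / 2) *\<^sub>R a) \<le> T\<^sup>2 * (L * d)" using a by (simp only: norm_scaleR, intro mult_mono) auto
    qed
    finally show ?thesis by (simp add: algebra_simps)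
  qed
  then have a': "norm a' \<le> L * ((1 + T + T\<^sup>2 * L) * d)"
    unfolding a'_def by (intro order_trans[OF lipschitz] mult_left_mono L_nonneg)
  have "verlet_step G h z - verlet_step G h w = (z - w) + h *\<^sub>R (ham z - ham w) - (h / 2) *\<^sub>R (h *\<^sub>R a, a' - a)"
    unfolding a_def a'_def by (subst (1 2) verlet_step_eq) (simp add: algebra_simps)
  also have "norm \<dots> \<le> norm (z - w) + norm (h *\<^sub>R (ham z - ham w)) + norm ((h / 2) *\<^sub>R (h *\<^sub>R a, a' - a))"
    by (intro order_trans[OF norm_triangle_ineq4] add_right_mono norm_triangle_ineq)
  also have "\<dots> \<le> d + h * ((1 + L) * d) + (h / 2) * (T * (L * d) + (L * ((1 + T + T\<^sup>2 * L) * d) + L * d))"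
  proof (intro add_mono)
    show "norm (h *\<^sub>R (ham z - ham w)) \<le> h * ((1 + L) * d)"
      using h ham_lipschitz[of z w] by (simp add: d_def mult_left_mono)
    have "norm (h *\<^sub>R a) \<le> T * (L * d)" using h a by (simp add: mult_mono)
    moreover have "norm (a' - a) \<le> L * ((1 + T + T\<^sup>2 * L) * d) + L * d"
      using a a' by (intro order_trans[OF norm_triangle_ineq4] add_mono)
    ultimately have "norm (h *\<^sub>R a, a' - a) \<le> T * (L * d) + (L * ((1 + T + T\<^sup>2 * L) * d) + L * d)"
      by (intro order_trans[OF norm_Pair_le] add_mono)
    then show "norm ((h / 2) *\<^sub>R (h *\<^sub>R a, a' - a)) \<le> (h / 2) * (T * (L * d) + (L * ((1 + T + T\<^sup>2 * L) * d) + L * d))"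
      unfolding norm_scaleR using h by (intro mult_mono) auto
  qed (simp add: d_def)
  also have "\<dots> = (1 + (1 + L + (T * L + L * (2 + T + T\<^sup>2 * L)) / 2) * h) * d"
    by (simp add: field_simps)
  finally show ?thesis by (simp add: d_def)
qed

lemma verlet_step_consistent:
  assumes h: "0 \<le> h" "h \<le> T" and B: "norm (ham z) \<le> B"
  shows "norm (verlet_step G h z - (z + h *\<^sub>R ham z)) \<le> (B + L * (1 + T) * B) / 2 * h\<^sup>2"
proof -
  have b: "norm (snd z) \<le> B" "norm (G (fst z)) \<le> B"
    using B norm_fst_le[of "snd z" "- G (fst z)"] norm_snd_le[of "- G (fst z)" "snd z"] by (simp_all add: ham_def)
  have B0: "0 \<le> B" using order_trans[OF norm_ge_zero B] .
  have "norm (fst (verlet_step G h z) - fst z) \<le> norm (h *\<^sub>R snd z) + norm ((h\<^sup>2 / 2) *\<^sub>R G (fst z))"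
    unfolding fst_verlet_step by (simp add: norm_triangle_ineq4 del: norm_scaleR)
  also have "\<dots> \<le> h * B + (h * T) * B"
  proof (rule add_mono)
    show "norm (h *\<^sub>R snd z) \<le> h * B" using h b by (simp add: mult_left_mono)
    have "h\<^sup>2 / 2 \<le> h * T" using mult_left_mono[OF h(2,1)] zero_le_power2[of h] unfolding power2_eq_square by linarith
    then show "norm ((h\<^sup>2 / 2) *\<^sub>R G (fst z)) \<le> (h * T) * B"
      using b(2) h B0 unfolding norm_scaleR by (intro mult_mono) auto
  qed
  finally have "norm (G (fst (verlet_step G h z)) - G (fst z)) \<le> L * (h * B + (h * T) * B)"
    by (intro order_trans[OF lipschitz] mult_left_mono L_nonneg)
  moreover have "norm (h *\<^sub>R G (fst z)) \<le> h * B" using h b by (simp add: mult_left_mono)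
  ultimately have "norm (h *\<^sub>R G (fst z), G (fst (verlet_step G h z)) - G (fst z)) \<le> h * B + L * (h * B + (h * T) * B)"
    by (intro order_trans[OF norm_Pair_le] add_mono)
  then have "norm ((h / 2) *\<^sub>R (h *\<^sub>R G (fst z), G (fst (verlet_step G h z)) - G (fst z))) \<le> (h / 2) * (h * B + L * (h * B + (h * T) * B))"
    unfolding norm_scaleR using h by (intro mult_mono) auto
  moreover have "verlet_step G h z - (z + h *\<^sub>R ham z) = - ((h / 2) *\<^sub>R (h *\<^sub>R G (fst z), G (fst (verlet_step G h z)) - G (fst z)))"
    by (subst verlet_step_eq) simp
  ultimately have "norm (verlet_step G h z - (z + h *\<^sub>R ham z)) \<le> (h / 2) * (h * B + L * (h * B + (h * T) * B))"
    by (simp only: norm_minus_cancel)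
  also have "\<dots> = (B + L * (1 + T) * B) / 2 * h\<^sup>2" by (simp add: power2_eq_square field_simps)
  finally show ?thesis .
qed

text \<open>Consistency and stability: each step adds a local error of order h^2 and multiplies the
  previous error by at most 1 + c h, so the global error over T / h steps is of order h.\<close>

lemma verlet_converges:
  assumes y: "\<And>t. (y has_vector_derivative ham (y t)) (at t)" and y0: "y 0 = (x, v)" and T: "0 < T"
  shows "(\<lambda>n. verlet_pos G (T / real (Suc n)) (Suc n) x v) \<longlonglongrightarrow> fst (y T)"
proof -
  have conty: "continuous_on S y" for S
    using y by (intro continuous_at_imp_continuous_on ballI) (rule has_vector_derivative_continuous)
  have contham: "continuous_on UNIV ham"
  proof (rule lipschitz_on_continuous_on)
    show "(1 + L)-lipschitz_on UNIV ham"
      using ham_lipschitz L_nonneg by (intro lipschitz_onI) (auto simp: dist_norm)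
  qed
  have "compact ((\<lambda>t. ham (y t)) ` {0..T})"
    by (intro compact_continuous_image continuous_on_compose2[OF contham conty]) auto
  then obtain B where B: "\<And>t. 0 \<le> t \<Longrightarrow> t \<le> T \<Longrightarrow> norm (ham (y t)) \<le> B"
    using compact_imp_bounded bounded_iff by (metis atLeastAtMost_iff imageI)
  have B0: "0 \<le> B" using order_trans[OF norm_ge_zero B[of 0]] T by simp
  have ylip: "norm (y s - y t) \<le> B * (s - t)" if "0 \<le> t" "t \<le> s" "s \<le> T" for s t
  proof (cases "t = s")
    case False
    have "norm (y s - y t) \<le> B * s - B * t"
      using that False B y by (intro differentiable_bound_general[where f' = "\<lambda>t. ham (y t)" and \<phi>' = "\<lambda>_. B"] conty)
        (auto intro!: continuous_intros derivative_eq_intros)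
    then show ?thesis by (simp add: algebra_simps)
  qed simp
  define c where "c = 1 + L + (T * L + L * (2 + T + T\<^sup>2 * L)) / 2"
  define r where "r = (1 + L) * B + (B + L * (1 + T) * B) / 2"
  have c0: "0 \<le> c" using T L_nonneg by (simp add: c_def)
  have r0: "0 \<le> r" using T L_nonneg B0 by (simp add: r_def)
  have euler: "norm (y (t + h) - (y t + h *\<^sub>R ham (y t))) \<le> (1 + L) * B * h\<^sup>2" if "0 \<le> t" "0 < h" "t + h \<le> T" for t h
  proof -
    \<comment> \<open>Its increment is the Euler defect, and its derivative is small because both
      \<open>y\<close> and \<open>ham\<close> are Lipschitz.\<close>
    define g where "g s = y s - s *\<^sub>R ham (y t)" for s
    have "norm (g (t + h) - g t) \<le> ((1 + L) * (B * h)) * (t + h) - ((1 + L) * (B * h)) * t"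
    proof (rule differentiable_bound_general[where f' = "\<lambda>s. ham (y s) - ham (y t)" and \<phi>' = "\<lambda>_. (1 + L) * (B * h)"])
      show "(g has_vector_derivative ham (y s) - ham (y t)) (at s)" for s
        unfolding g_def by (auto intro!: derivative_eq_intros y)
      show "norm (ham (y s) - ham (y t)) \<le> (1 + L) * (B * h)" if s: "t < s" "s < t + h" for s
      proof -
        have "norm (y s - y t) \<le> B * (s - t)" using ylip[of t s] s that \<open>0 \<le> t\<close> \<open>t + h \<le> T\<close> by simp
        also have "\<dots> \<le> B * h" using s B0 by (intro mult_left_mono) auto
        finally show ?thesis
          using L_nonneg by (intro order_trans[OF ham_lipschitz] mult_left_mono) auto
      qed
    qed (use that in \<open>auto simp: g_def intro!: continuous_intros conty derivative_eq_intros\<close>)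
    then show ?thesis by (simp add: g_def algebra_simps power2_eq_square)
  qed
  have err: "norm (y T - (verlet_step G h ^^ N) (x, v)) \<le> T * r * exp (c * T) * h" if N: "real N * h = T" "0 < N" for N h
  proof -
    have h: "0 < h" "h \<le> T"
    proof -
      show "0 < h" using N T by (metis mult.commute not_less of_nat_0_less_iff zero_less_mult_pos2 mult_nonneg_nonpos of_nat_0_le_iff)
      then show "h \<le> T" using mult_right_mono[of 1 "real N" h] N by simp
    qed
    define e where "e j = norm (y (real j * h) - (verlet_step G h ^^ j) (x, v))" for j
    have "e (Suc j) \<le> (1 + c * h) * e j + r * h\<^sup>2" if j: "j < N" for j
    proof -
      let ?t = "real j * h" and ?w = "(verlet_step G h ^^ j) (x, v)"
      have t: "0 \<le> ?t" "?t + h \<le> T"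
        using h j mult_right_mono[of "real (Suc j)" "real N" h] by (auto simp: N(1)[symmetric] algebra_simps)
      have 1: "norm (y (?t + h) - (y ?t + h *\<^sub>R ham (y ?t))) \<le> (1 + L) * B * h\<^sup>2"
        by (rule euler) (use t h in auto)
      have 2: "norm (verlet_step G h (y ?t) - (y ?t + h *\<^sub>R ham (y ?t))) \<le> (B + L * (1 + T) * B) / 2 * h\<^sup>2"
        by (rule verlet_step_consistent) (use t h B in auto)
      have 3: "norm (verlet_step G h (y ?t) - verlet_step G h ?w) \<le> (1 + c * h) * e j"
        unfolding e_def c_def by (rule verlet_step_lipschitz) (use h in auto)
      \<comment> \<open>Euler defect of the solution, difference between Verlet and Euler steps from
        the exact point, and propagation of the earlier error.\<close>
      have "y (real (Suc j) * h) - (verlet_step G h ^^ Suc j) (x, v)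
          = (y (?t + h) - (y ?t + h *\<^sub>R ham (y ?t))) - (verlet_step G h (y ?t) - (y ?t + h *\<^sub>R ham (y ?t)))
            + (verlet_step G h (y ?t) - verlet_step G h ?w)"
        by (simp add: algebra_simps)
      also have "norm \<dots> \<le> (1 + L) * B * h\<^sup>2 + (B + L * (1 + T) * B) / 2 * h\<^sup>2 + (1 + c * h) * e j"
        by (rule order_trans[OF norm_triangle_ineq add_mono[OF order_trans[OF norm_triangle_ineq4 add_mono[OF 1 2]] 3]])
      finally show ?thesis by (simp add: e_def r_def algebra_simps)
    qed
    then have "e N \<le> real N * (r * h\<^sup>2) * exp (c * h * real N)"
      using h c0 r0 by (intro perturbed_recursion_bound[of e N]) (auto simp: e_def y0)
    also have "\<dots> = (real N * h) * r * exp (c * (real N * h)) * h" by (simp add: power2_eq_square mult_ac)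
    finally show ?thesis by (simp add: N e_def)
  qed
  have "(\<lambda>n. y T - (verlet_step G (T / real (Suc n)) ^^ Suc n) (x, v)) \<longlonglongrightarrow> 0"
  proof (rule Lim_null_comparison)
    show "\<forall>\<^sub>F n in sequentially. norm (y T - (verlet_step G (T / real (Suc n)) ^^ Suc n) (x, v)) \<le> T * r * exp (c * T) * (T / real (Suc n))"
      by (intro always_eventually allI err) auto
    have "(\<lambda>n. T * r * exp (c * T) * T * (1 / real (Suc n))) \<longlonglongrightarrow> T * r * exp (c * T) * T * 0"
      using LIMSEQ_inverse_real_of_nat by (intro tendsto_mult_left) (simp add: divide_inverse)
    then show "(\<lambda>n. T * r * exp (c * T) * (T / real (Suc n))) \<longlonglongrightarrow> 0" by simp
  qed
  then have "(\<lambda>n. y T - (y T - (verlet_step G (T / real (Suc n)) ^^ Suc n) (x, v))) \<longlonglongrightarrow> y T - 0"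
    by (intro tendsto_diff tendsto_const)
  then have "(\<lambda>n. (verlet_step G (T / real (Suc n)) ^^ Suc n) (x, v)) \<longlonglongrightarrow> y T" by (simp del: funpow.simps)
  from tendsto_fst[OF this] show ?thesis unfolding verlet_pos_def .
qed

end

section \<open>One step of the Markov kernel\<close>

context smooth_field
begin

lemma continuous_field: "continuous_on S G"
  using der by (intro continuous_at_imp_continuous_on ballI) (rule has_derivative_continuous)

lemma continuous_verlet: "continuous_on UNIV (verlet_step G h ^^ j)"
proof (induction j)
  case (Suc j)
  have "verlet_step G h = (\<lambda>z. (fst z + h *\<^sub>R snd z - (h\<^sup>2 / 2) *\<^sub>R G (fst z),
      snd z - (h / 2) *\<^sub>R (G (fst z) + G (fst z + h *\<^sub>R snd z - (h\<^sup>2 / 2) *\<^sub>R G (fst z)))))"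
    by (auto simp: verlet_step_def Let_def fun_eq_iff)
  moreover have "continuous_on UNIV (\<lambda>z. (fst z + h *\<^sub>R snd z - (h\<^sup>2 / 2) *\<^sub>R G (fst z),
      snd z - (h / 2) *\<^sub>R (G (fst z) + G (fst z + h *\<^sub>R snd z - (h\<^sup>2 / 2) *\<^sub>R G (fst z)))))"
    by (intro continuous_intros continuous_on_compose2[OF continuous_field[of UNIV]]) auto
  ultimately have "continuous_on UNIV (verlet_step G h)" by simp
  then show ?case
    using Suc by (auto intro: continuous_on_compose2 simp: comp_def)
qed (simp add: id_def)

lemma verlet_pos_measurable [measurable]:
  "(\<lambda>z. verlet_pos G h N (fst z) (snd z)) \<in> borel_measurable (borel \<Otimes>\<^sub>M borel)"
  unfolding borel_prod verlet_pos_def prod.collapse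
  by (intro borel_measurable_continuous_onI continuous_on_fst continuous_verlet)

lemma verlet_pos_measurable2 [measurable]: "verlet_pos G h N x \<in> borel_measurable borel"
  using measurable_compose[OF measurable_Pair1' verlet_pos_measurable, of x] by simp

text \<open>The Gaussian estimate is applied to \<phi> composed with the position map at y;
  composing once more with v + g v turns it into the position map at x.\<close>

lemma verlet_entropy_bound:
  fixes \<phi> :: "'a \<Rightarrow> real"
  assumes h: "0 \<le> h" "real N * h = T" "L * T\<^sup>2 \<le> 1 / 12" and T: "0 < T"
    and [measurable]: "\<phi> \<in> borel_measurable borel" and bd: "\<And>x. \<bar>\<phi> x\<bar> \<le> b"
  shows "(\<integral>v. \<phi> (verlet_pos G h N x v) \<partial>std_gauss)
    \<le> ln (\<integral>v. exp (\<phi> (verlet_pos G h N y v)) \<partial>std_gauss) + (9 / (4 * T\<^sup>2) + 20 * real DIM('a) * M\<^sup>2 * T ^ 4) * (norm (x - y))\<^sup>2"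
proof -
  obtain g Dg where g: "\<And>v. (g has_derivative Dg v) (at v)"
    "\<And>v. norm (g v) \<le> 12 / 11 * norm (x - y) / T"
    "\<And>v u. norm (Dg v u) \<le> 1 / 11 * norm u"
    "\<And>v u. norm (Dg v u) \<le> 5 / 4 * M * T\<^sup>2 * norm (x - y) * norm u"
    "\<And>v. verlet_pos G h N y (v + g v) = verlet_pos G h N x v"
    using verlet_transport[OF h T, of x y] by blast
  \<comment> \<open>The minimum satisfies a \<le> 1/2 for all x and y and still gives a cost
    quadratic in x - y.\<close>
  define a where "a = min (1 / 11) (5 / 4 * M * T\<^sup>2 * norm (x - y))"
  have a: "0 \<le> a" "a \<le> 1 / 2" "a \<le> 5 / 4 * M * T\<^sup>2 * norm (x - y)"
    using M_nonneg by (auto simp: a_def)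
  have "norm (Dg v u) \<le> a * norm u" for v u
    using g(3)[of v u] g(4)[of v u] by (auto simp: a_def min_def)
  note std_gauss_transport[OF g(1,2) this a(1,2), of "\<lambda>v. \<phi> (verlet_pos G h N y v)" b]
  then have "(\<integral>v. \<phi> (verlet_pos G h N x v) \<partial>std_gauss)
    \<le> ln (\<integral>v. exp (\<phi> (verlet_pos G h N y v)) \<partial>std_gauss)
      + ((12 / 11 * norm (x - y) / T)\<^sup>2 / 2 + real DIM('a) * a\<^sup>2)"
    using bd by (simp add: g(5))
  also have "(12 / 11 * norm (x - y) / T)\<^sup>2 / 2 + real DIM('a) * a\<^sup>2
      \<le> 9 / (4 * T\<^sup>2) * (norm (x - y))\<^sup>2 + real DIM('a) * (20 * M\<^sup>2 * T ^ 4 * (norm (x - y))\<^sup>2)"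
  proof (intro add_mono mult_left_mono)
    have "(12 / 11 * norm (x - y) / T)\<^sup>2 / 2 = 72 / 121 * ((norm (x - y))\<^sup>2 / T\<^sup>2)"
      by (simp add: power2_eq_square)
    also have "\<dots> \<le> 9 / 4 * ((norm (x - y))\<^sup>2 / T\<^sup>2)" by (intro mult_right_mono) auto
    finally show "(12 / 11 * norm (x - y) / T)\<^sup>2 / 2 \<le> 9 / (4 * T\<^sup>2) * (norm (x - y))\<^sup>2" by simp
    have "a\<^sup>2 \<le> (5 / 4 * M * T\<^sup>2 * norm (x - y))\<^sup>2" using a by (intro power_mono) auto
    also have "\<dots> = 25 / 16 * (M\<^sup>2 * T ^ 4 * (norm (x - y))\<^sup>2)"
      by (simp add: power2_eq_square power4_eq_xxxx)
    also have "\<dots> \<le> 20 * (M\<^sup>2 * T ^ 4 * (norm (x - y))\<^sup>2)" by (intro mult_right_mono) auto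
    finally show "a\<^sup>2 \<le> 20 * M\<^sup>2 * T ^ 4 * (norm (x - y))\<^sup>2" by (simp add: mult_ac)
  qed simp
  finally show ?thesis by (simp add: algebra_simps)
qed

lemma ham_flow_pos_solution:
  obtains y where "y 0 = (x, v)" "\<And>t. (y has_vector_derivative ham (y t)) (at t)"
    "ham_flow_pos G T x v = fst (y T)"
proof -
  have L1: "0 \<le> 1 + L" using L_nonneg by simp
  obtain y where y: "y 0 = (x, v)" "\<And>t. (y has_vector_derivative ham (y t)) (at t)"
    using ode_global_existence[OF ham_lipschitz L1, of "(x, v)"] by blast
  have "(THE y. y 0 = (x, v) \<and> (\<forall>t. (y has_vector_derivative (snd (y t), - G (fst (y t)))) (at t))) = y"
  proof (rule the_equality)
    show "z = y" if "z 0 = (x, v) \<and> (\<forall>t. (z has_vector_derivative (snd (z t), - G (fst (z t)))) (at t))" for z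
      using that y by (intro ode_unique[OF ham_lipschitz]) (auto simp: ham_def)
  qed (use y in \<open>simp add: ham_def\<close>)
  then show thesis using that[OF y] by (simp add: ham_flow_pos_def)
qed

lemma verlet_converges_ham_flow_pos:
  assumes "0 < T"
  shows "(\<lambda>n. verlet_pos G (T / real (Suc n)) (Suc n) x v) \<longlonglongrightarrow> ham_flow_pos G T x v"
proof -
  obtain y where y: "y 0 = (x, v)" "\<And>t. (y has_vector_derivative ham (y t)) (at t)"
    "ham_flow_pos G T x v = fst (y T)"
    using ham_flow_pos_solution[where x = x and v = v and T = T] by blast
  show ?thesis unfolding y(3) by (rule verlet_converges[OF y(2,1) assms])
qed

lemma qtilde_cases:
  assumes T: "0 < T" and h: "0 \<le> h" "0 < h \<longrightarrow> (\<exists>N::nat. T / h = real N)"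
  obtains (flow) "\<And>x v. qtilde G T h x v = ham_flow_pos G T x v"
    | (verlet) N where "real N * h = T" "\<And>x v. qtilde G T h x v = verlet_pos G h N x v"
proof (cases "h = 0")
  case True
  then show thesis by (intro flow) (simp add: qtilde_def)
next
  case False
  then obtain N :: nat where N: "T / h = real N" using h by auto
  then show thesis
    using False by (intro verlet[of N]) (auto simp: qtilde_def verlet_pos_def field_simps)
qed

lemma qtilde_measurable:
  assumes "0 < T" "0 \<le> h" "0 < h \<longrightarrow> (\<exists>N::nat. T / h = real N)"
  shows "(\<lambda>z. qtilde G T h (fst z) (snd z)) \<in> borel_measurable (borel \<Otimes>\<^sub>M borel)"
  using assms
proof (cases rule: qtilde_cases)
  case flow
  show ?thesis
    unfolding flow by (rule borel_measurable_LIMSEQ_metric[OF verlet_pos_measurable verlet_converges_ham_flow_pos[OF assms(1)]])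
next
  case (verlet N)
  then show ?thesis by simp
qed

text \<open>For h = 0 the bound for step T / (n + 1) has the same constant for every n. Continuity
  of \<phi> carries the pointwise convergence of positions into both integrals, and the limit under
  ln is at least exp (-b).\<close>

lemma qtilde_entropy_bound:
  fixes \<phi> :: "'a \<Rightarrow> real"
  assumes T: "0 < T" and h: "0 \<le> h" "0 < h \<longrightarrow> (\<exists>N::nat. T / h = real N)" and LT: "L * T\<^sup>2 \<le> 1 / 12"
    and cont: "continuous_on UNIV \<phi>" and bd: "\<And>x. \<bar>\<phi> x\<bar> \<le> b"
  shows "(\<integral>v. \<phi> (qtilde G T h x v) \<partial>std_gauss)
    \<le> ln (\<integral>v. exp (\<phi> (qtilde G T h y v)) \<partial>std_gauss) + (9 / (4 * T\<^sup>2) + 20 * real DIM('a) * M\<^sup>2 * T ^ 4) * (norm (x - y))\<^sup>2"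
  using T h
proof (cases rule: qtilde_cases)
  have \<phi>[measurable]: "\<phi> \<in> borel_measurable borel" by (rule borel_measurable_continuous_onI[OF cont])
  {
    case (verlet N)
    show ?thesis
      unfolding verlet(2) by (rule verlet_entropy_bound[OF h(1) verlet(1) LT T \<phi> bd])
  next
    case flow
    let ?V = "\<lambda>n. verlet_pos G (T / real (Suc n)) (Suc n)"
    let ?K = "(9 / (4 * T\<^sup>2) + 20 * real DIM('a) * M\<^sup>2 * T ^ 4) * (norm (x - y))\<^sup>2"
    have conv: "(\<lambda>n. \<phi> (?V n x v)) \<longlonglongrightarrow> \<phi> (qtilde G T h x v)" for x v
      using continuous_on_tendsto_compose[OF cont verlet_converges_ham_flow_pos[OF T, of x v]] by (simp add: flow)
    have [measurable]: "qtilde G T h x \<in> borel_measurable borel" for x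
      using measurable_compose[OF measurable_Pair1' qtilde_measurable[OF T h], of x] by simp
    have 1: "(\<lambda>n. \<integral>v. \<phi> (?V n x v) \<partial>std_gauss) \<longlonglongrightarrow> (\<integral>v. \<phi> (qtilde G T h x v) \<partial>std_gauss)"
      by (rule integral_dominated_convergence[where w = "\<lambda>_. b"]) (use conv bd in \<open>auto intro: AE_I2\<close>)
    have ebd: "exp (\<phi> z) \<le> exp b" "exp (- b) \<le> exp (\<phi> z)" for z using bd[of z] by auto
    have 2: "(\<lambda>n. \<integral>v. exp (\<phi> (?V n y v)) \<partial>std_gauss) \<longlonglongrightarrow> (\<integral>v. exp (\<phi> (qtilde G T h y v)) \<partial>std_gauss)"
      by (rule integral_dominated_convergence[where w = "\<lambda>_. exp b"]) (use conv ebd in \<open>auto intro!: AE_I2 tendsto_exp\<close>)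
    have "(\<integral>v. exp (- b) \<partial>(std_gauss :: 'a measure)) \<le> (\<integral>v. exp (\<phi> (qtilde G T h y v)) \<partial>std_gauss)"
    proof (rule integral_mono)
      show "integrable std_gauss (\<lambda>v. exp (\<phi> (qtilde G T h y v)))"
        by (rule integrable_std_gauss_bounded[where b = "exp b"], measurable, use ebd in simp)
    qed (use ebd in auto)
    then have "0 < (\<integral>v. exp (\<phi> (qtilde G T h y v)) \<partial>std_gauss)"
      using less_le_trans[OF exp_gt_zero[of "- b"]] by simp
    then have 3: "(\<lambda>n. ln (\<integral>v. exp (\<phi> (?V n y v)) \<partial>std_gauss) + ?K)
        \<longlonglongrightarrow> ln (\<integral>v. exp (\<phi> (qtilde G T h y v)) \<partial>std_gauss) + ?K"
      by (intro tendsto_intros 2) auto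
    show ?thesis
    proof (rule LIMSEQ_le[OF 1 3], intro exI allI impI)
      show "(\<integral>v. \<phi> (?V n x v) \<partial>std_gauss) \<le> ln (\<integral>v. exp (\<phi> (?V n y v)) \<partial>std_gauss) + ?K" for n
        by (rule verlet_entropy_bound[OF _ _ LT T \<phi> bd]) (use T in auto)
    qed
  }
qed

end

section \<open>From pairs of points to pairs of measures\<close>

lemma is_prob_distD:
  assumes "is_prob_dist \<rho>"
  shows "prob_space \<rho>" "sets \<rho> = sets borel"
  using assms by (auto simp: is_prob_dist_def)

lemma kernel_prob_dist:
  fixes q :: "'a::euclidean_space \<Rightarrow> 'a \<Rightarrow> 'a"
  assumes q: "(\<lambda>z. q (fst z) (snd z)) \<in> borel_measurable (borel \<Otimes>\<^sub>M borel)" and \<rho>: "is_prob_dist \<rho>"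
  shows "is_prob_dist (distr (\<rho> \<Otimes>\<^sub>M std_gauss) borel (\<lambda>(x, v). q x v))"
    and "\<And>\<phi> :: 'a \<Rightarrow> real. \<And>b. \<phi> \<in> borel_measurable borel \<Longrightarrow> (\<And>x. \<bar>\<phi> x\<bar> \<le> b) \<Longrightarrow>
      (\<integral>z. \<phi> z \<partial>distr (\<rho> \<Otimes>\<^sub>M std_gauss) borel (\<lambda>(x, v). q x v)) = (\<integral>x. (\<integral>v. \<phi> (q x v) \<partial>std_gauss) \<partial>\<rho>)"
proof -
  interpret \<rho>: prob_space \<rho> using \<rho> by (rule is_prob_distD)
  interpret pair_prob_space \<rho> "std_gauss :: 'a measure" ..
  note [measurable_cong] = is_prob_distD(2)[OF \<rho>]
  have [measurable]: "(\<lambda>(x, v). q x v) \<in> borel_measurable (borel \<Otimes>\<^sub>M borel)"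
    using q by (simp add: case_prod_beta')
  have m: "(\<lambda>(x, v). q x v) \<in> borel_measurable (\<rho> \<Otimes>\<^sub>M std_gauss)" by measurable
  show "is_prob_dist (distr (\<rho> \<Otimes>\<^sub>M std_gauss) borel (\<lambda>(x, v). q x v))"
    unfolding is_prob_dist_def using prob_space_distr[OF m] by simp
  fix \<phi> :: "'a \<Rightarrow> real" and b assume [measurable]: "\<phi> \<in> borel_measurable borel" and bd: "\<And>x. \<bar>\<phi> x\<bar> \<le> b"
  have "integrable (\<rho> \<Otimes>\<^sub>M std_gauss) (\<lambda>(x, v). \<phi> (q x v))"
    by (rule integrable_const_bound[where B = b]) (use bd in auto)
  from integral_fst'[OF this]
  show "(\<integral>z. \<phi> z \<partial>distr (\<rho> \<Otimes>\<^sub>M std_gauss) borel (\<lambda>(x, v). q x v)) = (\<integral>x. (\<integral>v. \<phi> (q x v) \<partial>std_gauss) \<partial>\<rho>)"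
    by (subst integral_distr[OF m]) (simp_all add: case_prod_beta')
qed

text \<open>The bound for pairs of points is integrated over \<gamma>: the left side depends only on
  the first marginal and the logarithm only on the second. Jensen for ln then gives the dual
  inequality between the two image measures.\<close>

lemma KL_kernel_le_coupling:
  fixes q :: "'a::euclidean_space \<Rightarrow> 'a \<Rightarrow> 'a"
  assumes q: "(\<lambda>z. q (fst z) (snd z)) \<in> borel_measurable (borel \<Otimes>\<^sub>M borel)"
    and bound: "\<And>(\<phi> :: 'a \<Rightarrow> real) b x y. continuous_on UNIV \<phi> \<Longrightarrow> (\<And>x. \<bar>\<phi> x\<bar> \<le> b) \<Longrightarrow>
      (\<integral>v. \<phi> (q x v) \<partial>std_gauss) \<le> ln (\<integral>v. exp (\<phi> (q y v)) \<partial>std_gauss) + K * (norm (x - y))\<^sup>2"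
    and \<mu>: "is_prob_dist \<mu>" and \<nu>: "is_prob_dist \<nu>" and \<gamma>: "\<gamma> \<in> couplings \<mu> \<nu>"
    and cost: "(\<integral>\<^sup>+z. ennreal ((norm (fst z - snd z))\<^sup>2) \<partial>\<gamma>) = ennreal c" "0 \<le> c"
  shows "KL (distr (\<mu> \<Otimes>\<^sub>M std_gauss) borel (\<lambda>(x, v). q x v)) (distr (\<nu> \<Otimes>\<^sub>M std_gauss) borel (\<lambda>(x, v). q x v)) \<le> ereal (K * c)"
proof -
  let ?P = "\<lambda>\<rho>. distr (\<rho> \<Otimes>\<^sub>M std_gauss) borel (\<lambda>(x, v). q x v)"
  note P\<mu> = is_prob_distD[OF kernel_prob_dist(1)[OF q \<mu>]] and P\<nu> = is_prob_distD[OF kernel_prob_dist(1)[OF q \<nu>]]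
  interpret \<nu>: prob_space \<nu> using \<nu> by (rule is_prob_distD)
  interpret \<gamma>: prob_space \<gamma> using \<gamma> by (simp add: couplings_def)
  have s\<gamma>[measurable_cong]: "sets \<gamma> = sets (borel \<Otimes>\<^sub>M borel)" using \<gamma> by (simp add: couplings_def)
  have marg: "distr \<gamma> borel fst = \<mu>" "distr \<gamma> borel snd = \<nu>" using \<gamma> by (simp_all add: couplings_def)
  have [measurable]: "(\<lambda>(x, v). q x v) \<in> borel_measurable (borel \<Otimes>\<^sub>M borel)"
    using q by (simp add: case_prod_beta')
  have [measurable]: "q x \<in> borel_measurable borel" for x
    using measurable_compose[OF measurable_Pair1' q, of x] by simp
  note [measurable_cong] = is_prob_distD(2)[OF \<nu>]
  have ic: "integrable \<gamma> (\<lambda>z. (norm (fst z - snd z))\<^sup>2)"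
    using cost by (intro integrableI_nonneg) auto
  have c_eq: "(\<integral>z. (norm (fst z - snd z))\<^sup>2 \<partial>\<gamma>) = c"
    using cost by (simp add: integral_eq_nn_integral)
  have main: "(\<integral>z. \<phi> z \<partial>?P \<mu>) \<le> K * c + ln (\<integral>z. exp (\<phi> z) \<partial>?P \<nu>)"
    if cont: "continuous_on UNIV \<phi>" and bd: "\<And>x. \<bar>\<phi> x\<bar> \<le> b" for \<phi> :: "'a \<Rightarrow> real" and b
  proof -
    have \<phi>[measurable]: "\<phi> \<in> borel_measurable borel" by (rule borel_measurable_continuous_onI[OF cont])
    have ebd: "exp (\<phi> x) \<le> exp b" "exp (- b) \<le> exp (\<phi> x)" for x using bd[of x] by auto
    define \<Phi> where "\<Phi> x = (\<integral>v. \<phi> (q x v) \<partial>std_gauss)" for x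
    define E where "E y = (\<integral>v. exp (\<phi> (q y v)) \<partial>std_gauss)" for y
    have [measurable]: "\<Phi> \<in> borel_measurable borel" "E \<in> borel_measurable borel"
      unfolding \<Phi>_def E_def by measurable
    have i1: "integrable std_gauss (\<lambda>v. \<phi> (q x v))" "integrable std_gauss (\<lambda>v. exp (\<phi> (q x v)))" for x
      by (rule integrable_std_gauss_bounded[where b = b], measurable, rule bd)
        (rule integrable_std_gauss_bounded[where b = "exp b"], measurable, use ebd in simp)
    have Eb: "exp (- b) \<le> E y \<and> E y \<le> exp b" for y
      using integral_mono[of std_gauss "\<lambda>_. exp (- b)" "\<lambda>v. exp (\<phi> (q y v))"]
        integral_mono[of std_gauss "\<lambda>v. exp (\<phi> (q y v))" "\<lambda>_. exp b"] i1(2)[of y] ebd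
      by (simp add: E_def)
    have Epos: "0 < E y" for y using Eb[of y] exp_gt_zero[of "- b"] by linarith
    have \<Phi>b: "\<bar>\<Phi> x\<bar> \<le> b" for x
    proof -
      have "\<bar>\<Phi> x\<bar> \<le> (\<integral>v. \<bar>\<phi> (q x v)\<bar> \<partial>std_gauss)" unfolding \<Phi>_def by (rule integral_abs_bound)
      also have "\<dots> \<le> (\<integral>v. b \<partial>(std_gauss :: 'a measure))"
        using i1(1)[of x] bd by (intro integral_mono) auto
      finally show ?thesis by simp
    qed
    have lnb: "\<bar>ln (E y)\<bar> \<le> b" for y
    proof -
      have "ln (exp (- b)) \<le> ln (E y)" "ln (E y) \<le> ln (exp b)"
        using Eb[of y] Epos[of y] by (subst ln_le_cancel_iff; simp)+
      then show ?thesis by simp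
    qed
    define m where "m = (\<integral>y. E y \<partial>\<nu>)"
    have iE: "integrable \<nu> E"
      using Eb Epos by (intro \<nu>.integrable_const_bound[where B = "exp b"] AE_I2) (auto simp: less_imp_le)
    have iln: "integrable \<nu> (\<lambda>y. ln (E y))"
      using lnb by (intro \<nu>.integrable_const_bound[where B = b] AE_I2) auto
    have mpos: "0 < m"
    proof -
      have "(\<integral>y. exp (- b) \<partial>\<nu>) \<le> m" unfolding m_def by (rule integral_mono) (use iE Eb in auto)
      then show ?thesis using less_le_trans[OF exp_gt_zero[of "- b"]] by (simp add: \<nu>.prob_space)
    qed
    have jensen: "(\<integral>y. ln (E y) \<partial>\<nu>) \<le> ln m"
    proof -
      have "(\<integral>y. ln (E y) \<partial>\<nu>) \<le> (\<integral>y. ln m + (E y / m - 1) \<partial>\<nu>)"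
      proof (rule integral_mono[OF iln])
        \<comment> \<open>Tangent line of ln at the mean m; its second part integrates to
          zero.\<close>
        show "ln (E y) \<le> ln m + (E y / m - 1)" for y
          using ln_le_minus_one[of "E y / m"] Epos[of y] mpos by (simp add: ln_div)
      qed (use iE in auto)
      also have "\<dots> = ln m" using iE mpos by (simp add: \<nu>.prob_space m_def[symmetric])
      finally show ?thesis .
    qed
    have "(\<integral>z. \<phi> z \<partial>?P \<mu>) = (\<integral>x. \<Phi> x \<partial>\<mu>)"
      unfolding \<Phi>_def by (rule kernel_prob_dist(2)[OF q \<mu> \<phi> bd])
    also have "\<dots> = (\<integral>z. \<Phi> (fst z) \<partial>\<gamma>)" by (subst marg(1)[symmetric], subst integral_distr) auto
    also have "\<dots> \<le> (\<integral>z. ln (E (snd z)) + K * (norm (fst z - snd z))\<^sup>2 \<partial>\<gamma>)"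
    proof (rule integral_mono)
      show "integrable \<gamma> (\<lambda>z. \<Phi> (fst z))"
        using \<Phi>b by (intro \<gamma>.integrable_const_bound[where B = b] AE_I2) auto
      have "integrable \<gamma> (\<lambda>z. ln (E (snd z)))"
        using lnb by (intro \<gamma>.integrable_const_bound[where B = b] AE_I2) auto
      then show "integrable \<gamma> (\<lambda>z. ln (E (snd z)) + K * (norm (fst z - snd z))\<^sup>2)" using ic by simp
      show "\<Phi> (fst z) \<le> ln (E (snd z)) + K * (norm (fst z - snd z))\<^sup>2" for z
        unfolding \<Phi>_def E_def by (rule bound[OF cont bd])
    qed
    also have "\<dots> = (\<integral>z. ln (E (snd z)) \<partial>\<gamma>) + K * c"
    proof -
      have "integrable \<gamma> (\<lambda>z. ln (E (snd z)))"
        using lnb by (intro \<gamma>.integrable_const_bound[where B = b] AE_I2) auto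
      then show ?thesis using ic c_eq by simp
    qed
    also have "(\<integral>z. ln (E (snd z)) \<partial>\<gamma>) = (\<integral>y. ln (E y) \<partial>\<nu>)"
      by (subst marg(2)[symmetric], subst integral_distr) auto
    also have "\<dots> \<le> ln m" by (rule jensen)
    also have "m = (\<integral>z. exp (\<phi> z) \<partial>?P \<nu>)"
      unfolding m_def E_def by (rule kernel_prob_dist(2)[OF q \<nu>, symmetric]) (use ebd in auto)
    finally show ?thesis by simp
  qed
  show ?thesis
  proof (rule KL_le_of_donsker_varadhan)
    fix \<phi> :: "'a \<Rightarrow> real" and b
    assume \<phi>: "\<phi> \<in> borel_measurable (?P \<nu>)" and bd: "\<And>x. \<bar>\<phi> x\<bar> \<le> b"
    show "(\<integral>z. \<phi> z \<partial>?P \<mu>) \<le> K * c + ln (\<integral>z. exp (\<phi> z) \<partial>?P \<nu>)"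
      by (rule donsker_varadhan_bounded_measurable[OF P\<mu> P\<nu> main _ bd]) (use \<phi> in auto)
  qed (use P\<mu> P\<nu> in auto)
qed

text \<open>Existence of an optimal coupling is not invoked: a coupling within e / K of the infimum
  costs at most e more.\<close>

lemma KL_kernel_le_W2sq:
  fixes q :: "'a::euclidean_space \<Rightarrow> 'a \<Rightarrow> 'a"
  assumes q: "(\<lambda>z. q (fst z) (snd z)) \<in> borel_measurable (borel \<Otimes>\<^sub>M borel)"
    and bound: "\<And>(\<phi> :: 'a \<Rightarrow> real) b x y. continuous_on UNIV \<phi> \<Longrightarrow> (\<And>x. \<bar>\<phi> x\<bar> \<le> b) \<Longrightarrow>
      (\<integral>v. \<phi> (q x v) \<partial>std_gauss) \<le> ln (\<integral>v. exp (\<phi> (q y v)) \<partial>std_gauss) + K * (norm (x - y))\<^sup>2"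
    and \<mu>: "is_prob_dist \<mu>" and \<nu>: "is_prob_dist \<nu>" and K: "0 < K"
  shows "KL (distr (\<mu> \<Otimes>\<^sub>M std_gauss) borel (\<lambda>(x, v). q x v)) (distr (\<nu> \<Otimes>\<^sub>M std_gauss) borel (\<lambda>(x, v). q x v))
    \<le> enn2ereal (ennreal K * W2sq \<mu> \<nu>)"
proof -
  let ?KL = "KL (distr (\<mu> \<Otimes>\<^sub>M std_gauss) borel (\<lambda>(x, v). q x v)) (distr (\<nu> \<Otimes>\<^sub>M std_gauss) borel (\<lambda>(x, v). q x v))"
  show ?thesis
  proof (cases "W2sq \<mu> \<nu>")
    case (real w)
    have "?KL \<le> ereal (K * w) + ereal e" if e: "0 < e" for e
    proof -
      have "W2sq \<mu> \<nu> < ennreal (w + e / K)"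
        using real e K by (simp add: ennreal_less_iff)
      then obtain \<gamma> where \<gamma>: "\<gamma> \<in> couplings \<mu> \<nu>"
        "(\<integral>\<^sup>+z. ennreal ((norm (fst z - snd z))\<^sup>2) \<partial>\<gamma>) < ennreal (w + e / K)"
        unfolding W2sq_def INF_less_iff by blast
      then obtain c where c: "(\<integral>\<^sup>+z. ennreal ((norm (fst z - snd z))\<^sup>2) \<partial>\<gamma>) = ennreal c" "0 \<le> c"
        by (cases "\<integral>\<^sup>+z. ennreal ((norm (fst z - snd z))\<^sup>2) \<partial>\<gamma>") auto
      have "c \<le> w + e / K" using \<gamma>(2) c by (simp add: ennreal_less_iff)
      then have "K * c \<le> K * w + e" using K by (simp add: field_simps)
      moreover have "?KL \<le> ereal (K * c)" by (rule KL_kernel_le_coupling[OF q bound \<mu> \<nu> \<gamma>(1) c])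
      ultimately show ?thesis by (metis ereal_less_eq(3) order_trans plus_ereal.simps(1))
    qed
    then have "?KL \<le> ereal (K * w)" by (rule ereal_le_epsilon2)
    also have "ereal (K * w) = enn2ereal (ennreal (K * w))"
      using real K by (intro enn2ereal_ennreal[symmetric]) simp
    also have "ennreal (K * w) = ennreal K * W2sq \<mu> \<nu>"
      unfolding real(2) using real(1) K by (intro ennreal_mult) auto
    finally show ?thesis .
  next
    case top
    then show ?thesis using K by (simp add: ennreal_mult_top)
  qed
qed

section \<open>The entropy bound\<close>

text \<open>Turns an operator norm given by a bilinear form on unit vectors into a bound on vectors,
  by testing against the normalised image A u.\<close>

lemma norm_le_of_unit_inner_bound:
  fixes A :: "'a::euclidean_space \<Rightarrow> 'a"
  assumes "linear A" and unit: "\<And>u1 u2. norm u1 = 1 \<Longrightarrow> norm u2 = 1 \<Longrightarrow> \<bar>A u1 \<bullet> u2\<bar> \<le> c"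
  shows "norm (A u) \<le> c * norm u"
proof -
  interpret linear A by fact
  obtain e :: 'a where "e \<in> Basis" using nonempty_Basis by blast
  then have c: "0 \<le> c" using order_trans[OF abs_ge_zero unit[of e e]] by simp
  show ?thesis
  proof (cases "u = 0 \<or> A u = 0")
    case True
    then show ?thesis using c zero by auto
  next
    case False
    then have "\<bar>A (u /\<^sub>R norm u) \<bullet> (A u /\<^sub>R norm (A u))\<bar> \<le> c" by (intro unit) auto
    also have "A (u /\<^sub>R norm u) \<bullet> (A u /\<^sub>R norm (A u)) = norm (A u) / norm u"
      using False by (simp add: scale dot_square_norm power2_eq_square field_simps)
    finally show ?thesis using False by (simp add: field_simps)
  qed
qed

lemma W2_power2: "(W2 \<mu> \<nu>)\<^sup>2 = W2sq \<mu> \<nu>"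
proof (cases "W2sq \<mu> \<nu>")
  case (real w)
  then show ?thesis by (simp add: W2_def ennreal_power)
next
  case top
  then show ?thesis by (simp add: W2_def power2_eq_square ennreal_mult_top)
qed

theorem theorem1:
  fixes f :: "'a::euclidean_space \<Rightarrow> real"
    and gradf :: "'a \<Rightarrow> 'a"
    and hessf :: "'a \<Rightarrow> 'a \<Rightarrow>\<^sub>L 'a"
    and d3f :: "'a \<Rightarrow> 'a \<Rightarrow>\<^sub>L 'a \<Rightarrow>\<^sub>L 'a"
    and L M T h c1 c2 :: real
    and \<mu> \<nu> :: "'a measure"
  assumes mu: "is_prob_dist \<mu>"
    \<comment> \<open>(a) global minimum at 0, f(0) = 0\<close>
    and min0: "\<forall>x. f 0 \<le> f x" and f0: "f 0 = 0"
    \<comment> \<open>(b) f is C^2 with Hessian operator norm at most L\<close>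
    and grad: "\<forall>x. (f has_derivative (\<lambda>u. gradf x \<bullet> u)) (at x)"
    and hess: "\<forall>x. (gradf has_derivative blinfun_apply (hessf x)) (at x)"
    and hess_cont: "continuous_on UNIV hessf"
    and hess_bd: "\<forall>x u1 u2. norm u1 = 1 \<longrightarrow> norm u2 = 1 \<longrightarrow>
                    \<bar>blinfun_apply (hessf x) u1 \<bullet> u2\<bar> \<le> L"
    \<comment> \<open>(c) f is C^3 with third derivative operator norm at most M\<close>
    and d3: "\<forall>x. (hessf has_derivative blinfun_apply (d3f x)) (at x)"
    and d3_cont: "continuous_on UNIV d3f"
    and d3_bd: "\<forall>x u1 u2 u3. norm u1 = 1 \<longrightarrow> norm u2 = 1 \<longrightarrow> norm u3 = 1 \<longrightarrow>
                    \<bar>blinfun_apply (blinfun_apply (d3f x) u1) u2 \<bullet> u3\<bar> \<le> M"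
    and T_pos: "T > 0" and h_nonneg: "h \<ge> 0"
    and Th_int: "h > 0 \<longrightarrow> (\<exists>N::nat. T / h = real N)"
    and step_cond: "L * (T\<^sup>2 + T * h) \<le> 1 / 12"
    and nu: "is_prob_dist \<nu>"
    and stationary: "uhmc gradf T h \<nu> = \<nu>"
    and c1: "c1 \<ge> 1" and c2: "c2 > 0"
    and contraction: "\<forall>k::nat. \<forall>\<rho>. k \<ge> 1 \<longrightarrow> is_prob_dist \<rho> \<longrightarrow>
        W2 ((uhmc gradf T h ^^ k) \<rho>) \<nu> \<le> ennreal (c1 * exp (- c2 * real k)) * W2 \<rho> \<nu>"
  shows "\<forall>k::nat. KL ((uhmc gradf T h ^^ (k + 1)) \<mu>) \<nu>
           \<le> enn2ereal (ennreal (c1\<^sup>2 * exp (- 2 * c2 * real k)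
                 * (9 / (4 * T\<^sup>2) + 20 * real DIM('a) * M\<^sup>2 * T ^ 4)) * (W2 \<mu> \<nu>)\<^sup>2)"
proof
  fix k :: nat
  let ?P = "uhmc gradf T h"
  let ?K = "9 / (4 * T\<^sup>2) + 20 * real DIM('a) * M\<^sup>2 * T ^ 4"
  define \<rho> where "\<rho> = (?P ^^ k) \<mu>"
  have H: "norm (blinfun_apply (hessf x) u) \<le> L * norm u" for x u
    using hess_bd by (intro norm_le_of_unit_inner_bound bounded_linear.linear blinfun.bounded_linear_right) auto
  have D3: "norm (blinfun_apply (blinfun_apply (d3f x) w) u) \<le> M * norm w * norm u" for x w u
  proof (cases "w = 0")
    case False
    \<comment> \<open>The first slot is normalised by hand; the criterion for linear maps treats the
      other two.\<close>
    have "norm (blinfun_apply (blinfun_apply (d3f x) (w /\<^sub>R norm w)) u) \<le> M * norm u"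
      using d3_bd False by (intro norm_le_of_unit_inner_bound bounded_linear.linear blinfun.bounded_linear_right) auto
    then show ?thesis
      using False by (simp add: blinfun.scaleR_right blinfun.scaleR_left field_simps)
  qed (simp add: blinfun.zero_right)
  interpret smooth_field gradf "\<lambda>x. blinfun_apply (hessf x)" L M
  proof
    show "norm (blinfun_apply (hessf x) u - blinfun_apply (hessf y) u) \<le> M * norm (x - y) * norm u" for x y u
    proof -
      have "((\<lambda>x. blinfun_apply (hessf x) u) has_derivative (\<lambda>w. blinfun_apply (blinfun_apply (d3f z) w) u)) (at z)" for z
        using d3 by (intro bounded_linear.has_derivative[OF blinfun.bounded_linear_left]) simp
      from lipschitz_of_derivative_bound[OF this, of "M * norm u" x y] D3
      show ?thesis by (simp add: mult_ac)
    qed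
  qed (use hess H in auto)
  have "0 \<le> L * (T * h)" using L_nonneg T_pos h_nonneg by simp
  then have LT: "L * T\<^sup>2 \<le> 1 / 12" using step_cond by (simp add: algebra_simps)
  have K: "0 < ?K" using T_pos by (intro add_pos_nonneg) auto
  note q = qtilde_measurable[OF T_pos h_nonneg Th_int]
  have \<rho>: "is_prob_dist \<rho>"
    unfolding \<rho>_def
  proof (induction k)
    case (Suc k)
    then show ?case using kernel_prob_dist(1)[OF q Suc] by (simp add: uhmc_def)
  qed (simp add: mu)
  have "KL (?P \<rho>) (?P \<nu>) \<le> enn2ereal (ennreal ?K * W2sq \<rho> \<nu>)"
    unfolding uhmc_def
    by (rule KL_kernel_le_W2sq[OF q qtilde_entropy_bound[OF T_pos h_nonneg Th_int LT] \<rho> nu K])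
  \<comment> \<open>Stationarity turns the image of \<nu> back into \<nu>; the last of the k + 1
    steps is the one that converts distance into entropy.\<close>
  then have "KL ((?P ^^ (k + 1)) \<mu>) \<nu> \<le> enn2ereal (ennreal ?K * (W2 \<rho> \<nu>)\<^sup>2)"
    by (simp add: \<rho>_def stationary W2_power2)
  also have "enn2ereal (ennreal ?K * (W2 \<rho> \<nu>)\<^sup>2)
      \<le> enn2ereal (ennreal (c1\<^sup>2 * exp (- 2 * c2 * real k) * ?K) * (W2 \<mu> \<nu>)\<^sup>2)"
  proof -
    have "W2 \<rho> \<nu> \<le> ennreal (c1 * exp (- c2 * real k)) * W2 \<mu> \<nu>"
    \<comment> \<open>The contraction hypothesis starts at one step; for zero steps the estimate is
      c1 \<ge> 1.\<close>
    proof (cases "k = 0")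
      case True
      have "1 * W2 \<mu> \<nu> \<le> ennreal c1 * W2 \<mu> \<nu>" using c1 by (intro mult_right_mono) auto
      then show ?thesis using True by (simp add: \<rho>_def)
    next
      case False
      then show ?thesis using contraction mu by (simp add: \<rho>_def)
    qed
    then have "(W2 \<rho> \<nu>)\<^sup>2 \<le> (ennreal (c1 * exp (- c2 * real k)) * W2 \<mu> \<nu>)\<^sup>2" by (rule power_mono) simp
    also have "\<dots> = ennreal ((c1 * exp (- c2 * real k))\<^sup>2) * (W2 \<mu> \<nu>)\<^sup>2"
      using c1 by (simp add: power_mult_distrib ennreal_power)
    also have "(c1 * exp (- c2 * real k))\<^sup>2 = c1\<^sup>2 * exp (- 2 * c2 * real k)"
      by (simp add: power_mult_distrib power2_eq_square exp_add[symmetric])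
    finally have "ennreal ?K * (W2 \<rho> \<nu>)\<^sup>2 \<le> ennreal ?K * (ennreal (c1\<^sup>2 * exp (- 2 * c2 * real k)) * (W2 \<mu> \<nu>)\<^sup>2)"
      by (rule mult_left_mono) simp
    also have "\<dots> = ennreal (c1\<^sup>2 * exp (- 2 * c2 * real k) * ?K) * (W2 \<mu> \<nu>)\<^sup>2"
      using K by (subst ennreal_mult) (auto simp: mult_ac)
    finally show ?thesis by (simp add: less_eq_ennreal.rep_eq)
  qed
  finally show "KL ((?P ^^ (k + 1)) \<mu>) \<nu>
      \<le> enn2ereal (ennreal (c1\<^sup>2 * exp (- 2 * c2 * real k) * ?K) * (W2 \<mu> \<nu>)\<^sup>2)" .
qed

end
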